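(* Let $\varepsilon_0(p)$ be the John--Nirenberg constant of $\mathrm{BMO}^p((0,1))$ and let $C(\varepsilon,p)$ be the best constant in the integral John--Nirenberg inequality on $(0,1)$ (both defined in the context). For every $p\in[1,2]$, $$\varepsilon_0(p)=\left[\frac pe\Big(\Gamma(p)-\int_0^1t^{p-1}e^t\,dt\Big)+1\right]^{1/p}.$$ Furthermore, if $1<p\le2$, then for all $\varepsilon$ with $(2-p)\varepsilon_0(p)\le\varepsilon<\varepsilon_0(p)$, $$C(\varepsilon,p)=\frac{e^{-\varepsilon/\varepsilon_0(p)}}{1-\varepsilon/\varepsilon_0(p)};$$ and for all $0\le\varepsilon<\frac2e$, $$\frac{e^{-\frac e2\varepsilon}}{1-\frac e2\varepsilon}\le C(\varepsilon,1)\le k^{-1}(\varepsilon),$$ where $k^{-1}:[0,\frac2e)\to[1,\infty)$ is the inverse of the function $k$ defined in the context.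
   Context: For an interval $J$, $\langle\varphi\rangle_J=\frac1{|J|}\int_J\varphi$. For an interval $Q$ and $p>0$, $\|\varphi\|_{\mathrm{BMO}^p(Q)}=\sup_{J\subset Q}\langle|\varphi-\langle\varphi\rangle_J|^p\rangle_J^{1/p}$, the supremum being over all subintervals $J$ of $Q$; $\mathrm{BMO}(Q)$ is the set of locally integrable $\varphi$ for which this is finite (the set is the same for all $p>0$). For $p>0$ and $\varepsilon\ge0$ let $C(\varepsilon,p)\in[1,\infty]$ be the smallest constant such that $\langle e^\varphi\rangle_J\le C(\varepsilon,p)\,e^{\langle\varphi\rangle_J}$ for every $\varphi\in\mathrm{BMO}((0,1))$ with $\|\varphi\|_{\mathrm{BMO}^p((0,1))}\le\varepsilon$ and every subinterval $J\subset(0,1)$. The John--Nirenberg constant $\varepsilon_0(p)$ is the largest number such that $C(\varepsilon,p)<\infty$ for all $0\le\varepsilon<\varepsilon_0(p)$. For $C\ge1$, $\xi^\pm=\xi^\pm(C)$ are the two solutions of $e^{-\xi}=C(1-\xi)$ with $-\infty<\xi^-\le0\le\xi^+<1$ (both are $0$ when $C=1$). For $C>1$, $$k(C)=2\,\frac{(1-\xi^-)(1-\xi^+)}{\xi^+-\xi^-}\,(C-1),$$ and $k(1)=0$. The function $k$ is a continuous strictly increasing bijection of $[1,\infty)$ onto $[0,\frac2e)$. *)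

theory Defs
  imports "HOL-Analysis.Analysis"
begin

definition subintervals :: "real set \<Rightarrow> real set set" where
  "subintervals Q = {J. is_interval J \<and> bounded J \<and> interior J \<noteq> {} \<and> J \<subseteq> Q}"

definition locally_integrable :: "real set \<Rightarrow> (real \<Rightarrow> real) \<Rightarrow> bool" where
  "locally_integrable Q \<phi> \<longleftrightarrow> (\<forall>K. compact K \<and> K \<subseteq> Q \<longrightarrow> \<phi> absolutely_integrable_on K)"

definition avg :: "real set \<Rightarrow> (real \<Rightarrow> real) \<Rightarrow> real" where
  "avg J \<phi> = (LINT x:J|lebesgue. \<phi> x) / measure lebesgue J"

text \<open>Average of a nonnegative function, with value \<open>\<infinity>\<close> if the function is not integrable.\<close>

definition nnavg :: "real set \<Rightarrow> (real \<Rightarrow> real) \<Rightarrow> ennreal" where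
  "nnavg J f = (\<integral>\<^sup>+x\<in>J. ennreal (f x) \<partial>lebesgue) / emeasure lebesgue J"

definition epowr :: "ennreal \<Rightarrow> real \<Rightarrow> ennreal" where
  "epowr x a = (if x = \<infinity> then \<infinity> else ennreal (enn2real x powr a))"

text \<open>
  A subinterval may share an endpoint with an open \<open>Q\<close>, and there a locally integrable \<open>\<phi>\<close> could
  fail to be integrable, in which case \<open>avg J \<phi>\<close> has the junk value \<open>0\<close>. This does not affect
  \<open>bmo\<close>: finiteness of the supremum over the compact subintervals alone forces \<open>\<phi>\<close> to be
  integrable on every bounded subinterval of \<open>Q\<close>.
\<close>

definition bmo_norm :: "real \<Rightarrow> real set \<Rightarrow> (real \<Rightarrow> real) \<Rightarrow> ennreal" where
  "bmo_norm p Q \<phi> =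
     (SUP J \<in> subintervals Q. epowr (nnavg J (\<lambda>x. \<bar>\<phi> x - avg J \<phi>\<bar> powr p)) (1 / p))"

definition bmo :: "real \<Rightarrow> real set \<Rightarrow> (real \<Rightarrow> real) set" where
  "bmo p Q = {\<phi>. locally_integrable Q \<phi> \<and> bmo_norm p Q \<phi> < \<infinity>}"

definition jn_admissible :: "real \<Rightarrow> real \<Rightarrow> ennreal \<Rightarrow> bool" where
  "jn_admissible \<epsilon> p C \<longleftrightarrow>
     (\<forall>\<phi> \<in> bmo p {0<..<1}. bmo_norm p {0<..<1} \<phi> \<le> ennreal \<epsilon> \<longrightarrow>
        (\<forall>J \<in> subintervals {0<..<1}.
           nnavg J (\<lambda>x. exp (\<phi> x)) \<le> C * ennreal (exp (avg J \<phi>))))"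

definition jn_C :: "real \<Rightarrow> real \<Rightarrow> ennreal" where
  "jn_C \<epsilon> p = Inf {C. 1 \<le> C \<and> jn_admissible \<epsilon> p C}"

text \<open>The infimum is attained, so \<open>jn_C\<close> is the smallest constant.\<close>

lemma jn_admissible_jn_C: "1 \<le> jn_C \<epsilon> p" "jn_admissible \<epsilon> p (jn_C \<epsilon> p)"
proof -
  show "1 \<le> jn_C \<epsilon> p"
    unfolding jn_C_def by (rule Inf_greatest) auto
  have *: "x \<le> C * ennreal (exp a) \<longleftrightarrow> x * ennreal (exp (- a)) \<le> C" for x C a
  proof -
    have 1: "ennreal (exp a) * ennreal (exp (- a)) = 1"
      by (simp flip: ennreal_mult exp_add)
    have "x * ennreal (exp (- a)) \<le> C" if "x \<le> C * ennreal (exp a)"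
      using mult_right_mono[OF that, of "ennreal (exp (- a))"] by (simp add: mult.assoc 1)
    moreover have "x \<le> C * ennreal (exp a)" if "x * ennreal (exp (- a)) \<le> C"
      using mult_right_mono[OF that, of "ennreal (exp a)"]
      by (simp add: mult.assoc mult.commute[of "ennreal (exp (- a))"] 1)
    ultimately show ?thesis by blast
  qed
  show "jn_admissible \<epsilon> p (jn_C \<epsilon> p)"
    unfolding jn_C_def jn_admissible_def *
    by (intro ballI impI Inf_greatest) auto
qed

definition jn_eps0 :: "real \<Rightarrow> ereal" where
  "jn_eps0 p = Sup {d. \<forall>\<epsilon>\<ge>0. ereal \<epsilon> < d \<longrightarrow> jn_C \<epsilon> p < \<infinity>}"

definition xi_plus :: "real \<Rightarrow> real" where
  "xi_plus C = (THE \<xi>. 0 \<le> \<xi> \<and> \<xi> < 1 \<and> exp (- \<xi>) = C * (1 - \<xi>))"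

definition xi_minus :: "real \<Rightarrow> real" where
  "xi_minus C = (THE \<xi>. \<xi> \<le> 0 \<and> exp (- \<xi>) = C * (1 - \<xi>))"

definition jn_k :: "real \<Rightarrow> real" where
  "jn_k C =
     (if C = 1 then 0
      else 2 * ((1 - xi_minus C) * (1 - xi_plus C) / (xi_plus C - xi_minus C)) * (C - 1))"

end

theory Submission
  imports Defs "HOL-Probability.Weak_Convergence" "HOL-Real_Asymp.Real_Asymp"
begin

text \<open>
  The lower bounds come from \<open>\<phi> = - \<xi> ln\<close>, whose oscillation is largest on intervals touching \<open>0\<close>: adding to
  a function one that is comonotone with it increases every convex mean of the centered function. The same
  comparison shows that truncation does not increase the \<open>BMO\<^sup>p\<close> norm, so the upper bounds only have to be
  proved for bounded \<open>\<phi>\<close>, for which the best constant \<open>C\<close> with \<open>\<langle>exp \<phi>\<rangle> \<le> C exp \<langle>\<phi>\<rangle>\<close> on all subintervals is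
  finite. It is almost attained on some \<open>J\<close>, and there \<open>\<langle>|\<phi> - \<langle>\<phi>\<rangle>|\<^sup>p\<rangle>\<close> is bounded below by a quantity that
  increases with \<open>C\<close>.

  That lower bound only concerns the monotone rearrangement of \<open>\<phi>\<close>, whose averages over initial and final
  intervals inherit the constant \<open>C\<close> by the rising sun lemma. For \<open>p > 1\<close> let \<open>u(s)\<close> be the average over
  \<open>(s, 1)\<close>: the planes supporting the Bellman candidate along the tangents to the upper boundary of
  \<open>{(x, y). exp x \<le> y \<le> C exp x}\<close>, evaluated at the point of tangency over \<open>u(s)\<close>, integrate to the
  claimed bound, because \<open>u\<close> is monotone and the candidate is locally convex when \<open>\<xi> \<ge> 2 - p\<close>. For \<open>p = 1\<close>
  a single plane through the bottom point \<open>(0, 1)\<close> and the two tangents from it suffices.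
\<close>

section \<open>Averages and bounded measurable functions\<close>

definition mean :: "real \<Rightarrow> real \<Rightarrow> (real \<Rightarrow> real) \<Rightarrow> real" where
  "mean a b f = integral {a..b} f / (b - a)"

lemma integral_eq_mean: "a < b \<Longrightarrow> integral {a..b} f = (b - a) * mean a b f"
  by (simp add: mean_def)

lemma mean_const [simp]: "a < b \<Longrightarrow> mean a b (\<lambda>_. k) = k"
  by (simp add: mean_def)

lemma mean_cong: "(\<And>x. x \<in> {a..b} \<Longrightarrow> f x = g x) \<Longrightarrow> mean a b f = mean a b g"
  unfolding mean_def by (metis Henstock_Kurzweil_Integration.integral_cong)

lemma mean_cmult: "mean a b (\<lambda>x. k * f x) = k * mean a b f"
  by (simp add: mean_def)

lemma mean_add:
  assumes "f integrable_on {a..b}" "g integrable_on {a..b}"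
  shows "mean a b (\<lambda>x. f x + g x) = mean a b f + mean a b g"
  using assms by (simp add: mean_def integral_add add_divide_distrib)

lemma mean_mono:
  assumes "f integrable_on {a..b}" "g integrable_on {a..b}" "a \<le> b"
    and "\<And>x. x \<in> {a..b} \<Longrightarrow> f x \<le> g x"
  shows "mean a b f \<le> mean a b g"
  unfolding mean_def using assms by (intro divide_right_mono integral_le) auto

lemma mean_ge_const:
  assumes "f integrable_on {a..b}" "a < b" "\<And>x. x \<in> {a..b} \<Longrightarrow> k \<le> f x"
  shows "k \<le> mean a b f"
  using mean_mono[of "\<lambda>_. k" a b f] assms by auto

lemma mean_le_const:
  assumes "f integrable_on {a..b}" "a < b" "\<And>x. x \<in> {a..b} \<Longrightarrow> f x \<le> k"
  shows "mean a b f \<le> k"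
  using mean_mono[of f a b "\<lambda>_. k"] assms by auto

lemma mean_affine:
  assumes "f integrable_on {a..b}" "a < b"
  shows "mean a b (\<lambda>x. k * f x + m) = k * mean a b f + m"
  using assms mean_add[of "\<lambda>x. k * f x" a b "\<lambda>_. m"]
  by (simp add: mean_cmult integrable_on_mult_right integrable_const_ivl)

lemma integral_reflect_shift:
  fixes f :: "real \<Rightarrow> real"
  shows "integral {k - b..k - a} (\<lambda>t. f (k - t)) = integral {a..b} f"
  using integral_shift_real_ivl[of "- b" "- k" "- a" "\<lambda>t. f (- t)"] by (simp add: algebra_simps)

lemma mean_reflect: "mean (k - b) (k - a) (\<lambda>t. f (k - t)) = mean a b f"
  by (simp add: mean_def integral_reflect_shift)

definition bounded_measurable_on :: "'a::euclidean_space set \<Rightarrow> ('a \<Rightarrow> real) \<Rightarrow> bool" where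
  "bounded_measurable_on S f \<longleftrightarrow> f \<in> borel_measurable (lebesgue_on S) \<and> bounded (f ` S)"

lemma bounded_measurable_on_subset:
  "bounded_measurable_on S f \<Longrightarrow> T \<subseteq> S \<Longrightarrow> bounded_measurable_on T f"
  unfolding bounded_measurable_on_def
  by (meson bounded_subset image_mono measurable_restrict_mono)

lemma bounded_measurable_on_compose:
  assumes f: "bounded_measurable_on S f" and h: "continuous_on UNIV h"
  shows "bounded_measurable_on S (\<lambda>x. h (f x))"
proof -
  have "compact (h ` closure (f ` S))"
    using f continuous_on_subset[OF h] unfolding bounded_measurable_on_def
    by (intro compact_continuous_image) (auto simp: compact_closure)
  then have "bounded ((\<lambda>x. h (f x)) ` S)"
    by (rule bounded_subset[OF compact_imp_bounded]) (use closure_subset[of "f ` S"] in auto)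
  moreover have "(\<lambda>x. h (f x)) \<in> borel_measurable (lebesgue_on S)"
    by (rule measurable_compose[OF _ borel_measurable_continuous_onI[OF h]])
      (use f in \<open>simp add: bounded_measurable_on_def\<close>)
  ultimately show ?thesis by (simp add: bounded_measurable_on_def)
qed

lemma bounded_measurable_on_imp_absolutely_integrable:
  assumes "bounded_measurable_on S f" "S \<in> lmeasurable"
  shows "f absolutely_integrable_on S"
proof -
  obtain B where "\<And>x. x \<in> S \<Longrightarrow> norm (f x) \<le> B"
    using assms(1) by (auto simp: bounded_measurable_on_def bounded_iff)
  then show ?thesis
    using assms by (intro measurable_bounded_by_integrable_imp_absolutely_integrable[where g="\<lambda>_. B"])
      (auto simp: bounded_measurable_on_def integrable_on_const)
qed

lemma bounded_measurable_on_imp_integrable: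
  "bounded_measurable_on S f \<Longrightarrow> S \<in> lmeasurable \<Longrightarrow> f integrable_on S"
  by (meson bounded_measurable_on_imp_absolutely_integrable set_lebesgue_integral_eq_integral(1))

lemma bounded_measurable_on_compose_integrable:
  fixes f h :: "real \<Rightarrow> real"
  assumes "bounded_measurable_on {a..b} f" "continuous_on UNIV h" "a \<le> c" "d \<le> b"
  shows "(\<lambda>x. h (f x)) integrable_on {c..d}"
  using bounded_measurable_on_subset[OF bounded_measurable_on_compose[OF assms(1,2)], of "{c..d}"] assms(3,4)
  by (intro bounded_measurable_on_imp_integrable) auto

lemma bounded_measurable_on_mono:
  fixes f :: "real \<Rightarrow> real"
  assumes "mono f" "bounded (range f)"
  shows "bounded_measurable_on S f"
proof -
  have "f \<in> borel_measurable (lebesgue_on S)"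
    using borel_measurable_mono[OF assms(1)]
    by (intro measurable_restrict_space1 measurable_completion) simp
  then show ?thesis
    using assms(2) by (auto simp: bounded_measurable_on_def bounded_iff)
qed

section \<open>Monotone rearrangement\<close>

definition monotone_rearrangement :: "real \<Rightarrow> real \<Rightarrow> (real \<Rightarrow> real) \<Rightarrow> (real \<Rightarrow> real) \<Rightarrow> bool" where
  "monotone_rearrangement a b \<phi> I \<longleftrightarrow> mono I \<and> bounded (range I) \<and>
     (\<forall>h. continuous_on UNIV h \<longrightarrow> mean 0 1 (\<lambda>t. h (I t)) = mean a b (\<lambda>x. h (\<phi> x)))"

lemma monotone_rearrangementD:
  assumes "monotone_rearrangement a b \<phi> I"
  shows "mono I" "bounded (range I)" "bounded_measurable_on S I"
    and "continuous_on UNIV h \<Longrightarrow> mean 0 1 (\<lambda>t. h (I t)) = mean a b (\<lambda>x. h (\<phi> x))"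
  using assms bounded_measurable_on_mono by (auto simp: monotone_rearrangement_def)

lemma monotone_rearrangement_integrable:
  fixes h :: "real \<Rightarrow> real"
  assumes "monotone_rearrangement a b \<phi> I" "continuous_on UNIV h"
  shows "(\<lambda>t. h (I t)) integrable_on {c..d}"
  using bounded_measurable_on_compose_integrable[OF monotone_rearrangementD(3)] assms by blast

lemma mono_reflect:
  fixes I :: "real \<Rightarrow> real"
  shows "mono I \<Longrightarrow> mono (\<lambda>t. - I (1 - t))"
  by (simp add: mono_def)

lemma bounded_range_reflect:
  fixes I :: "real \<Rightarrow> real"
  shows "bounded (range I) \<Longrightarrow> bounded (range (\<lambda>t. - I (1 - t)))"
  by (auto simp: bounded_iff)

lemma monotone_rearrangement_reflect:
  assumes "monotone_rearrangement a b \<phi> I"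
  shows "monotone_rearrangement a b (\<lambda>x. - \<phi> x) (\<lambda>t. - I (1 - t))"
  unfolding monotone_rearrangement_def
proof (intro conjI allI impI)
  note I = monotone_rearrangementD[OF assms]
  show "mono (\<lambda>t. - I (1 - t))" using I(1) by (rule mono_reflect)
  show "bounded (range (\<lambda>t. - I (1 - t)))" using I(2) by (rule bounded_range_reflect)
  fix h :: "real \<Rightarrow> real" assume "continuous_on UNIV h"
  then have "continuous_on UNIV (\<lambda>y. h (- y))"
    by (rule continuous_on_compose2) (auto intro: continuous_intros)
  from I(4)[OF this] show "mean 0 1 (\<lambda>t. h (- I (1 - t))) = mean a b (\<lambda>x. h (- \<phi> x))"
    using mean_reflect[of 1 1 0 "\<lambda>t. h (- I t)"] by simp
qed

lemma real_distribution_bounded_quantile: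
  assumes \<mu>: "real_distribution \<mu>" and bd: "AE x in \<mu>. \<bar>x\<bar> \<le> M"
  obtains I :: "real \<Rightarrow> real" where "mono I" "\<And>t. \<bar>I t\<bar> \<le> M" "distr (restrict_space lborel {0<..<1}) borel I = \<mu>"
proof -
  interpret cdf_distribution \<mu> using \<mu> by (simp add: cdf_distribution_def)
  define Q where "Q t = Inf {x. t \<le> cdf \<mu> x}" for t
  have Q_le_iff: "Q t \<le> x \<longleftrightarrow> t \<le> cdf \<mu> x" if "0 < t" "t < 1" for t x
    unfolding Q_def using pseudoinverse[OF that] by blast
  have "cdf \<mu> M = 1"
    unfolding cdf_def using bd by (subst prob_eq_1) auto
  moreover have "cdf \<mu> x = 0" if "x < - M" for x
    unfolding cdf_def using bd that by (subst prob_eq_0) auto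
  ultimately have Q_bounds: "- M \<le> Q t \<and> Q t \<le> M" if "0 < t" "t < 1" for t
    using Q_le_iff[OF that, of M] Q_le_iff[OF that, of "Q t"] that by (metis less_imp_le not_less order_refl)
  have Q_mono: "Q s \<le> Q t" if "0 < s" "s \<le> t" "t < 1" for s t
    using Q_le_iff[of s "Q t"] Q_le_iff[of t "Q t"] that by auto
  define I where "I t = (if t \<le> 0 then - M else if t < 1 then Q t else M)" for t
  have "\<bar>I t\<bar> \<le> M" for t
    using Q_bounds[of t] Q_bounds[of "1 / 2"] by (auto simp: I_def)
  moreover have "mono I"
  proof (rule monoI)
    fix s t :: real assume "s \<le> t"
    then show "I s \<le> I t"
      using Q_bounds[of s] Q_bounds[of t] Q_bounds[of "1 / 2"] Q_mono[of s t] by (auto simp: I_def)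
  qed
  moreover have "distr (restrict_space lborel {0<..<1}) borel I = \<mu>"
    by (rule trans[OF distr_cong distr_I_eq_M]) (simp_all add: space_restrict_space I_def Q_def)
  ultimately show ?thesis using that[of I] by simp
qed

lemma integral_uniform_measure_eq_mean:
  assumes f: "bounded_measurable_on {a..b} f" and "a < b"
  shows "integral\<^sup>L (uniform_measure (lebesgue_on {a..b}) {a..b}) f = mean a b f"
proof -
  let ?L = "lebesgue_on {a..b}"
  have "emeasure ?L {a..b} = ennreal (b - a)"
    using \<open>a < b\<close> by (simp add: emeasure_restrict_space)
  then have "uniform_measure ?L {a..b} = density ?L (\<lambda>_. ennreal (1 / (b - a)))"
    unfolding uniform_measure_def using \<open>a < b\<close> divide_ennreal[of 1 "b - a"]
    by (intro density_cong borel_measurable_divide_ennreal borel_measurable_indicator) auto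
  moreover have "integral\<^sup>L (density ?L (\<lambda>_. ennreal (1 / (b - a)))) f = integral\<^sup>L ?L (\<lambda>x. (1 / (b - a)) *\<^sub>R f x)"
    using f \<open>a < b\<close> by (intro integral_density) (auto simp: bounded_measurable_on_def)
  moreover have "integral\<^sup>L ?L f = integral {a..b} f"
    using bounded_measurable_on_imp_absolutely_integrable[OF f]
    by (intro lebesgue_integral_eq_integral) (auto simp: set_integrable_def integrable_restrict_space)
  ultimately show ?thesis by (simp add: mean_def)
qed

lemma integral_distr_lborel_eq_mean:
  fixes I h :: "real \<Rightarrow> real"
  assumes "mono I" "bounded (range I)" "continuous_on UNIV h"
  shows "integral\<^sup>L (distr (restrict_space lborel {0<..<1}) borel I) h = mean 0 1 (\<lambda>t. h (I t))"
proof -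
  have [measurable]: "I \<in> borel_measurable borel" "h \<in> borel_measurable borel"
    using borel_measurable_mono[OF assms(1)] borel_measurable_continuous_onI[OF assms(3)] .
  have "bounded_measurable_on {0<..<1} (\<lambda>t. h (I t))"
    using bounded_measurable_on_compose[OF bounded_measurable_on_mono] assms by blast
  then have hI: "(\<lambda>t. h (I t)) absolutely_integrable_on {0<..<1}"
    by (rule bounded_measurable_on_imp_absolutely_integrable) simp
  have "integral\<^sup>L (distr (restrict_space lborel {0<..<1}) borel I) h
      = integral\<^sup>L (restrict_space lborel {0<..<1}) (\<lambda>t. h (I t))"
    by (intro integral_distr measurable_restrict_space1) auto
  also have "\<dots> = (LINT t:{0<..<1}|lebesgue. h (I t))"
    by (simp add: integral_restrict_space set_lebesgue_integral_def integral_completion)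
  also have "\<dots> = integral {0..1} (\<lambda>t. h (I t))"
    using set_lebesgue_integral_eq_integral(2)[OF hI] integral_open_interval_real[of 0 1 "\<lambda>t. h (I t)"]
    by simp
  finally show ?thesis by (simp add: mean_def)
qed

theorem monotone_rearrangement_exists:
  assumes \<phi>: "bounded_measurable_on {a..b} \<phi>" and "a < b"
  obtains I where "monotone_rearrangement a b \<phi> I"
proof -
  let ?N = "uniform_measure (lebesgue_on {a..b}) {a..b}"
  have [measurable]: "\<phi> \<in> borel_measurable ?N"
    using \<phi> by (simp add: bounded_measurable_on_def cong: measurable_cong_sets)
  interpret N: prob_space ?N
    by (rule prob_space_uniform_measure) (use \<open>a < b\<close> in \<open>auto simp: emeasure_restrict_space\<close>)
  obtain M where M: "\<And>x. x \<in> {a..b} \<Longrightarrow> \<bar>\<phi> x\<bar> \<le> M"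
    using \<phi> unfolding bounded_measurable_on_def bounded_iff by fastforce
  have "real_distribution (distr ?N borel \<phi>)"
    by (rule N.real_distribution_distr) simp
  moreover have "AE x in distr ?N borel \<phi>. \<bar>x\<bar> \<le> M"
    using M by (subst AE_distr_iff) auto
  ultimately obtain I :: "real \<Rightarrow> real" where I: "mono I" "\<And>t. \<bar>I t\<bar> \<le> M"
      and law: "distr (restrict_space lborel {0<..<1}) borel I = distr ?N borel \<phi>"
    using real_distribution_bounded_quantile by blast
  have "bounded (range I)" using I(2) by (auto simp: bounded_iff)
  moreover have "mean 0 1 (\<lambda>t. h (I t)) = mean a b (\<lambda>x. h (\<phi> x))" if h: "continuous_on UNIV h"
    for h :: "real \<Rightarrow> real"
  proof -
    have "mean 0 1 (\<lambda>t. h (I t)) = integral\<^sup>L (distr ?N borel \<phi>) h"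
      using integral_distr_lborel_eq_mean[OF I(1) \<open>bounded (range I)\<close> h] law by simp
    also have "\<dots> = integral\<^sup>L ?N (\<lambda>x. h (\<phi> x))"
      using borel_measurable_continuous_onI[OF h] by (intro integral_distr) auto
    also have "\<dots> = mean a b (\<lambda>x. h (\<phi> x))"
      using integral_uniform_measure_eq_mean[OF bounded_measurable_on_compose[OF \<phi> h] \<open>a < b\<close>] .
    finally show ?thesis .
  qed
  ultimately show ?thesis using I(1) that by (auto simp: monotone_rearrangement_def)
qed

section \<open>The rising sun lemma\<close>

lemma is_interval_Inf_Sup:
  fixes J :: "real set"
  assumes J: "is_interval J" "bounded J" "J \<noteq> {}"
  shows "{Inf J<..<Sup J} \<subseteq> J" "J \<subseteq> {Inf J..Sup J}"
proof
  have bdd: "bdd_below J" "bdd_above J"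
    using J(2) by (auto simp: bounded_imp_bdd_below bounded_imp_bdd_above)
  show "J \<subseteq> {Inf J..Sup J}" using bdd by (auto intro: cInf_lower cSup_upper)
  fix x assume "x \<in> {Inf J<..<Sup J}"
  then obtain u v where "u \<in> J" "u < x" "v \<in> J" "x < v"
    using cInf_less_iff[OF J(3) bdd(1)] less_cSup_iff[OF J(3) bdd(2)] by auto
  then show "x \<in> J" using J(1) by (meson is_interval_1 less_imp_le)
qed

lemma bounded_open_real_component:
  fixes U :: "real set"
  assumes "open U" "bounded U" and K: "K \<in> components U"
  obtains c d where "c < d" "K = {c<..<d}" "c \<notin> U" "d \<notin> U"
proof -
  define c d where "c = Inf K" and "d = Sup K"
  have "is_interval K" "bounded K" "K \<noteq> {}" "open K"
    using assms in_components_connected[OF K] in_components_subset[OF K] in_components_nonempty[OF K]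
      open_components
    by (auto simp: is_interval_connected_1 bounded_subset)
  with is_interval_Inf_Sup[of K] interior_mono[of K "{c..d}"] have K_eq: "K = {c<..<d}"
    by (simp add: c_def d_def interior_open subset_antisym)
  then have "c < d" using \<open>K \<noteq> {}\<close> by simp
  have subset_K: "T \<subseteq> K" if "T = insert c K \<or> T = insert d K" "T \<subseteq> U" for T
  proof (rule components_maximal[OF K _ that(2)])
    have "T = {c..<d} \<or> T = {c<..d}" using that(1) \<open>c < d\<close> K_eq by auto
    then show "connected T" by auto
    show "K \<inter> T \<noteq> {}" using that(1) \<open>K \<noteq> {}\<close> by auto
  qed
  have "c \<notin> U" "d \<notin> U"
    using subset_K[of "insert c K"] subset_K[of "insert d K"] in_components_subset[OF K] K_eq by auto
  then show ?thesis using that[of c d] \<open>c < d\<close> K_eq by simp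
qed

definition rising_sun_set :: "real \<Rightarrow> real \<Rightarrow> (real \<Rightarrow> real) \<Rightarrow> real set" where
  "rising_sun_set a b G = {x \<in> {a<..<b}. \<exists>y \<in> {x<..b}. G x < G y}"

lemma open_rising_sun_set:
  assumes G: "continuous_on {a..b} G"
  shows "open (rising_sun_set a b G)"
proof -
  have "open {x \<in> {a<..<y}. G x < G y}" if "y \<in> {a..b}" for y
  proof -
    have "continuous_on {a<..<y} G" by (rule continuous_on_subset[OF G]) (use that in auto)
    then have "open ({a<..<y} \<inter> G -` {..<G y})" by (rule continuous_open_preimage) auto
    then show ?thesis by (simp add: vimage_def Int_def)
  qed
  moreover have "rising_sun_set a b G = (\<Union>y\<in>{a..b}. {x \<in> {a<..<y}. G x < G y})"
    by (fastforce simp: rising_sun_set_def)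
  ultimately show ?thesis by auto
qed

lemma rising_sun:
  assumes G: "continuous_on {a..b} G" and K: "K \<in> components (rising_sun_set a b G)"
  obtains c d where "K = {c<..<d}" "a \<le> c" "c < d" "d \<le> b" "G c \<le> G d" "a < c \<Longrightarrow> G c = G d"
proof -
  let ?U = "rising_sun_set a b G"
  have U: "?U \<subseteq> {a<..<b}" by (auto simp: rising_sun_set_def)
  then have "bounded ?U" by (rule bounded_subset[rotated]) simp
  then obtain c d where cd: "c < d" "K = {c<..<d}" "c \<notin> ?U" "d \<notin> ?U"
    using bounded_open_real_component[OF open_rising_sun_set[OF G] _ K] by blast
  have "{c<..<d} \<subseteq> {a<..<b}" using in_components_subset[OF K] U cd by auto
  then have ab: "a \<le> c" "d \<le> b"
    using cd by (simp_all add: greaterThanLessThan_subseteq_greaterThanLessThan)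
  have "G x \<le> G d" if x: "x \<in> {c<..<d}" for x
  proof -
    obtain z where z: "z \<in> {x..b}" "\<And>y. y \<in> {x..b} \<Longrightarrow> G y \<le> G z"
      using continuous_attains_sup[of "{x..b}" G] continuous_on_subset[OF G, of "{x..b}"] x ab by fastforce
    have "\<not> G z < G y" if "y \<in> {z<..b}" for y using z(2)[of y] z(1) that by auto
    then have "z \<notin> ?U" by (auto simp: rising_sun_set_def)
    then have "d \<le> z" using in_components_subset[OF K] cd x z(1) by force
    have "G z \<le> G d"
    proof (cases "d = z")
      case False
      then have "d \<in> {a<..<b}" "z \<in> {d<..b}" using \<open>d \<le> z\<close> z x ab by auto
      then show ?thesis using \<open>d \<notin> ?U\<close> by (auto simp: rising_sun_set_def not_less)
    qed simp
    then show ?thesis using z(2)[of x] x ab by force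
  qed
  then have "G c \<le> G d"
    using continuous_le_on_closure[of "{c<..<d}" G c "G d"] continuous_on_subset[OF G, of "{c..d}"] cd ab
    by simp
  moreover have "G d \<le> G c" if "a < c"
  proof -
    have "c \<in> {a<..<b}" "d \<in> {c<..b}" using that cd ab by auto
    then show ?thesis using \<open>c \<notin> ?U\<close> by (auto simp: rising_sun_set_def not_less)
  qed
  ultimately show ?thesis using that cd ab by (metis order_antisym)
qed

lemma AE_nonpos_off_rising_sun_set:
  fixes g :: "real \<Rightarrow> real"
  assumes g: "g integrable_on {a..b}"
  shows "AE x in lebesgue. x \<in> {a..b} - rising_sun_set a b (\<lambda>x. integral {a..x} g) \<longrightarrow> g x \<le> 0"
proof -
  define f where "f = (\<lambda>x. if x \<in> {a..b} then g x else 0)"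
  define G where "G x = integral {a..x} g" for x
  have "f integrable_on UNIV" using g by (simp only: f_def integrable_restrict_UNIV)
  then have "f integrable_on cbox c d" for c d by (rule integrable_on_subcbox) auto
  then obtain N where N: "negligible N" "\<And>x e. x \<notin> N \<Longrightarrow> 0 < e \<Longrightarrow>
      \<exists>d>0. \<forall>h. 0 < h \<and> h < d \<longrightarrow> \<bar>integral {x..x + h} f / h - f x\<bar> < e"
    using integrable_ccontinuous_explicit[of f] by (simp add: divide_inverse mult.commute) metis
  have "g x \<le> 0" if x: "x \<in> {a..b} - rising_sun_set a b G" "x \<notin> N \<union> {a, b}" for x
  proof (rule ccontr)
    assume "\<not> g x \<le> 0"
    then obtain d where d: "d > 0" "\<And>h. 0 < h \<Longrightarrow> h < d \<Longrightarrow> \<bar>integral {x..x + h} f / h - g x\<bar> < g x"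
      using N(2)[of x "g x"] x by (auto simp: f_def)
    define h where "h = min (d / 2) (b - x)"
    have h: "0 < h" "h < d" "x + h \<le> b" using d x by (auto simp: h_def min_def)
    have "integral {x..x + h} f = integral {x..x + h} g"
      by (rule Henstock_Kurzweil_Integration.integral_cong) (use x h in \<open>auto simp: f_def\<close>)
    also have "\<dots> = G (x + h) - G x"
      using Henstock_Kurzweil_Integration.integral_combine[of a x "x + h" g]
        integrable_on_subinterval[OF g, of a "x + h"] x h
      by (auto simp: G_def)
    also have "\<dots> \<le> 0" using x h by (auto simp: rising_sun_set_def not_less)
    finally show False using d(2)[OF h(1,2)] h(1) by (smt (verit) divide_nonpos_pos)
  qed
  moreover have "negligible (N \<union> {a, b})" using N(1) by simp
  ultimately show ?thesis
    unfolding eventually_ae_filter_negligible G_def by blast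
qed

lemma continuous_last_zero:
  fixes G :: "real \<Rightarrow> real"
  assumes "a \<le> b" and G: "continuous_on {a..b} G" and "G a = 0" "G b \<le> 0"
  obtains z where "a \<le> z" "z \<le> b" "G z = 0" "\<And>x. z < x \<Longrightarrow> x \<le> b \<Longrightarrow> G x < 0"
proof -
  define Z where "Z = {x \<in> {a..b}. G x = 0}"
  have "closed Z" unfolding Z_def by (rule continuous_closed_preimage_constant[OF G]) simp
  moreover have "Z \<noteq> {}" "bdd_above Z" using assms by (auto simp: Z_def)
  ultimately have z: "Sup Z \<in> Z" by (rule closed_contains_Sup[rotated 2])
  have "G x < 0" if x: "Sup Z < x" "x \<le> b" for x
  proof (rule ccontr)
    assume "\<not> G x < 0"
    then obtain y where "x \<le> y" "y \<le> b" "G y = 0"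
      using IVT2'[of G b 0 x] assms x z continuous_on_subset[OF G, of "{x..b}"] by (auto simp: Z_def)
    then have "y \<le> Sup Z" using z x by (intro cSup_upper \<open>bdd_above Z\<close>) (auto simp: Z_def)
    then show False using x \<open>x \<le> y\<close> by simp
  qed
  then show ?thesis using z that by (auto simp: Z_def)
qed

lemma rising_sun_level_intervals:
  assumes G: "continuous_on {a..b} G" and "a < b" and "G a = 0" "G b \<le> 0"
  obtains z \<D> where "a \<le> z" "z \<le> b" "G z = 0" "countable \<D>" "disjoint \<D>"
    "\<And>K. K \<in> \<D> \<Longrightarrow> \<exists>c d. K = {c<..<d} \<and> a \<le> c \<and> c < d \<and> d \<le> b \<and> G c = G d"
    "\<Union>\<D> = {a<..<z} \<union> rising_sun_set z b G"
proof -
  obtain z where z: "a \<le> z" "z \<le> b" "G z = 0" and neg: "\<And>x. z < x \<Longrightarrow> x \<le> b \<Longrightarrow> G x < 0"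
    using continuous_last_zero[of a b G] assms by auto
  define U where "U = rising_sun_set z b G"
  define \<D> where "\<D> = components U \<union> {K. K = {a<..<z} \<and> a < z}"
  have Gz: "continuous_on {z..b} G" by (rule continuous_on_subset[OF G]) (use z in auto)
  have D: "\<exists>c d. K = {c<..<d} \<and> a \<le> c \<and> c < d \<and> d \<le> b \<and> G c = G d" if "K \<in> \<D>" for K
  proof (cases "K \<in> components U")
    case True
    then obtain c d where cd: "K = {c<..<d}" "z \<le> c" "c < d" "d \<le> b" "G c \<le> G d" "z < c \<Longrightarrow> G c = G d"
      using rising_sun[OF Gz] unfolding U_def by blast
    have "G c = G d" using cd neg[of d] z by (cases "z = c") auto
    then show ?thesis using cd z by (intro exI[of _ c] exI[of _ d]) auto
  next
    case False
    then show ?thesis using that z \<open>G a = 0\<close> by (intro exI[of _ a] exI[of _ z]) (auto simp: \<D>_def)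
  qed
  have "U \<subseteq> {z<..<b}" by (auto simp: U_def rising_sun_set_def)
  then have "K \<inter> {a<..<z} = {}" if "K \<in> components U" for K
    using in_components_subset[OF that] by force
  then have dis: "disjoint \<D>"
    using pairwise_disjoint_components[of U] unfolding \<D>_def disjnt_def pairwise_def by blast
  have "countable \<D>"
    using D by (intro countable_disjoint_open_subsets[OF _ dis]) force
  moreover have "\<Union>\<D> = {a<..<z} \<union> U"
    unfolding \<D>_def Union_Un_distrib Union_components by auto
  ultimately show ?thesis using that[OF z] dis D by (simp add: U_def)
qed

theorem rising_sun_level:
  assumes f: "f integrable_on {a..b}" and "a < b" and mean_le: "mean a b f \<le> \<alpha>"
  obtains \<D> where "countable \<D>" "disjoint \<D>"
    "\<And>K. K \<in> \<D> \<Longrightarrow> \<exists>c d. K = {c<..<d} \<and> a \<le> c \<and> c < d \<and> d \<le> b \<and> mean c d f = \<alpha>"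
    "AE x in lebesgue. x \<in> {a..b} - \<Union>\<D> \<longrightarrow> f x \<le> \<alpha>"
proof -
  define g where "g = (\<lambda>x. f x - \<alpha>)"
  define G where "G x = integral {a..x} g" for x
  have g: "g integrable_on {c..d}" if "a \<le> c" "d \<le> b" for c d
    unfolding g_def using integrable_on_subinterval[OF f, of c d] that by (auto intro!: integrable_diff)
  have G_diff: "integral {c..d} g = G d - G c" if "a \<le> c" "c \<le> d" "d \<le> b" for c d
    using Henstock_Kurzweil_Integration.integral_combine[of a c d g] that g by (simp add: G_def)
  have mean_g: "mean c d g = mean c d f - \<alpha>" if "a \<le> c" "c < d" "d \<le> b" for c d
    using mean_affine[of f c d 1 "- \<alpha>"] integrable_on_subinterval[OF f, of c d] that by (simp add: g_def)
  have "continuous_on {a..b} G"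
    unfolding G_def using g by (intro indefinite_integral_continuous_1) auto
  moreover have "mean a b g \<le> 0" using mean_g[of a b] \<open>a < b\<close> mean_le by simp
  then have "G a = 0" "G b \<le> 0" using \<open>a < b\<close> by (auto simp: G_def mean_def divide_le_0_iff)
  ultimately obtain z \<D> where z: "a \<le> z" "z \<le> b" "G z = 0" and D: "countable \<D>" "disjoint \<D>"
      "\<And>K. K \<in> \<D> \<Longrightarrow> \<exists>c d. K = {c<..<d} \<and> a \<le> c \<and> c < d \<and> d \<le> b \<and> G c = G d"
      "\<Union>\<D> = {a<..<z} \<union> rising_sun_set z b G"
    using rising_sun_level_intervals[of a b G] \<open>a < b\<close> by metis
  have "\<exists>c d. K = {c<..<d} \<and> a \<le> c \<and> c < d \<and> d \<le> b \<and> mean c d f = \<alpha>" if "K \<in> \<D>" for K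
  proof -
    obtain c d where cd: "K = {c<..<d}" "a \<le> c" "c < d" "d \<le> b" "G c = G d"
      using D(3)[OF \<open>K \<in> \<D>\<close>] by blast
    then have "mean c d f = \<alpha>" using G_diff[of c d] mean_g[of c d] by (simp add: mean_def)
    with cd show ?thesis by blast
  qed
  moreover have "AE x in lebesgue. x \<in> {a..b} - \<Union>\<D> \<longrightarrow> f x \<le> \<alpha>"
  proof -
    have "integral {z..x} g = G x" if "z \<le> x" "x \<le> b" for x
      using G_diff[of z x] that z by simp
    then have "rising_sun_set z b (\<lambda>x. integral {z..x} g) = rising_sun_set z b G"
      unfolding rising_sun_set_def by (intro Collect_cong conj_cong bex_cong) auto
    then have "AE x in lebesgue. x \<in> {z..b} - rising_sun_set z b G \<longrightarrow> g x \<le> 0"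
      using AE_nonpos_off_rising_sun_set[OF g, of z b] z by simp
    moreover have "negligible {a, z}" by simp
    then have "AE x in lebesgue. x \<notin> {a, z}"
      by (intro AE_not_in) (simp only: negligible_iff_null_sets)
    ultimately show ?thesis
      unfolding D(4) by eventually_elim (auto simp: g_def)
  qed
  ultimately show ?thesis using D(1,2) that by blast
qed

section \<open>Mean bounds pass to the monotone rearrangement\<close>

definition mean_dominated :: "(real \<Rightarrow> real) \<Rightarrow> (real \<Rightarrow> real) \<Rightarrow> real \<Rightarrow> real \<Rightarrow> (real \<Rightarrow> real) \<Rightarrow> bool" where
  "mean_dominated \<Psi> K a b \<phi> \<longleftrightarrow>
     (\<forall>c d. a \<le> c \<longrightarrow> c < d \<longrightarrow> d \<le> b \<longrightarrow> mean c d (\<lambda>x. \<Psi> (\<phi> x)) \<le> K (mean c d \<phi>))"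

lemma mean_dominatedD:
  "mean_dominated \<Psi> K a b \<phi> \<Longrightarrow> a \<le> c \<Longrightarrow> c < d \<Longrightarrow> d \<le> b \<Longrightarrow>
    mean c d (\<lambda>x. \<Psi> (\<phi> x)) \<le> K (mean c d \<phi>)"
  by (simp add: mean_dominated_def)

lemma set_integral_Union_nonpos:
  fixes f :: "'a \<Rightarrow> real"
  assumes "countable \<D>" and dis: "disjoint \<D>" and meas: "\<D> \<subseteq> sets M"
    and f: "set_integrable M (\<Union>\<D>) f"
    and nonpos: "\<And>A. A \<in> \<D> \<Longrightarrow> (LINT x:A|M. f x) \<le> 0"
  shows "(LINT x:\<Union>\<D>|M. f x) \<le> 0"
proof (cases "\<D> = {}")
  case False
  define A where "A n = \<Union>(from_nat_into \<D> ` {..<n})" for n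
  have sub: "from_nat_into \<D> ` {..<n} \<subseteq> \<D>" for n
    using from_nat_into[OF False] by auto
  have Un: "(\<Union>n. A n) = \<Union>\<D>"
  proof -
    have "(\<Union>n. A n) = \<Union>(range (from_nat_into \<D>))" by (auto simp: A_def)
    then show ?thesis using range_from_nat_into[OF False \<open>countable \<D>\<close>] by simp
  qed
  have "(LINT x:A n|M. f x) \<le> 0" for n
  proof -
    have "(LINT x:A n|M. f x) = (\<Sum>K\<in>from_nat_into \<D> ` {..<n}. LINT x:K|M. f x)"
      unfolding A_def using set_integral_finite_Union[of "from_nat_into \<D> ` {..<n}" "\<lambda>K. K" M f] sub[of n] dis meas
      by (simp add: disjoint_family_on_def disjnt_def pairwise_def subset_iff)
        (metis Sup_upper f set_integrable_subset)
    also have "\<dots> \<le> 0" using sub by (intro sum_nonpos nonpos) blast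
    finally show ?thesis .
  qed
  moreover have "(\<lambda>n. LINT x:A n|M. f x) \<longlonglongrightarrow> (LINT x:\<Union>\<D>|M. f x)"
    unfolding Un[symmetric]
  proof (rule set_integral_cont_up)
    show "A n \<in> sets M" for n
      unfolding A_def using sub meas by (intro sets.finite_Union) auto
    show "incseq A" by (auto simp: A_def incseq_def intro: less_le_trans)
    show "set_integrable M (\<Union>n. A n) f" unfolding Un by (rule f)
  qed
  ultimately show ?thesis by (intro LIMSEQ_le_const2) auto
qed (simp add: set_lebesgue_integral_def)

lemma set_integral_Union_intervals_le:
  assumes \<D>: "countable \<D>" "disjoint \<D>"
    and mean_le: "\<And>K. K \<in> \<D> \<Longrightarrow> \<exists>c d. K = {c<..<d} \<and> a \<le> c \<and> c < d \<and> d \<le> b \<and> mean c d h \<le> \<beta>"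
    and h: "h absolutely_integrable_on {a..b}"
  shows "(LINT x:\<Union>\<D>|lebesgue. h x) \<le> \<beta> * measure lebesgue (\<Union>\<D>)"
proof -
  have "K \<in> sets lebesgue" "K \<subseteq> {a..b}" if "K \<in> \<D>" for K
    using mean_le[OF that] by auto
  then have "\<D> \<subseteq> sets lebesgue" and Un: "\<Union>\<D> \<in> sets lebesgue" "\<Union>\<D> \<subseteq> {a..b}"
    using sets.countable_Union[OF \<D>(1)] by blast+
  have const: "set_integrable lebesgue (\<Union>\<D>) (\<lambda>x. \<beta>)"
    by (rule set_integrable_subset[OF _ Un]) auto
  have "(LINT x:\<Union>\<D>|lebesgue. h x - \<beta>) \<le> 0"
  proof (rule set_integral_Union_nonpos[OF \<D> \<open>\<D> \<subseteq> sets lebesgue\<close>])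
    show "set_integrable lebesgue (\<Union>\<D>) (\<lambda>x. h x - \<beta>)"
      by (intro set_integral_diff const set_integrable_subset[OF h] Un)
    fix K assume "K \<in> \<D>"
    then obtain c d where cd: "K = {c<..<d}" "a \<le> c" "c < d" "d \<le> b" "mean c d h \<le> \<beta>"
      using mean_le by blast
    have h_cd: "h absolutely_integrable_on {c..d}"
      by (rule set_integrable_subset[OF h]) (use cd in auto)
    have "(\<lambda>x. h x - \<beta>) absolutely_integrable_on {c<..<d}"
      by (rule set_integrable_subset[OF set_integral_diff(1)[OF h_cd]]) auto
    then have "(LINT x:K|lebesgue. h x - \<beta>) = integral {c..d} (\<lambda>x. h x - \<beta>)"
      using set_lebesgue_integral_eq_integral(2) integral_open_interval_real cd(1) by metis
    also have "\<dots> = (d - c) * (mean c d h - \<beta>)"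
      using mean_affine[of h c d 1 "- \<beta>"] set_lebesgue_integral_eq_integral(1)[OF h_cd] cd(3)
      by (simp add: integral_eq_mean)
    also have "\<dots> \<le> 0" using cd by (simp add: mult_le_0_iff)
    finally show "(LINT x:K|lebesgue. h x - \<beta>) \<le> 0" .
  qed
  moreover have "\<Union>\<D> \<in> lmeasurable"
    using bounded_subset[OF _ Un(2)] Un(1) by (intro bounded_set_imp_lmeasurable) auto
  then have "(LINT x:\<Union>\<D>|lebesgue. \<beta>) = \<beta> * measure lebesgue (\<Union>\<D>)"
    using set_integral_const[OF Un(1), of \<beta>] fmeasurableD2[of "\<Union>\<D>" lebesgue]
    by (simp only: infinity_ennreal_def real_scaleR_def mult.commute simp_thms)
  then have "(LINT x:\<Union>\<D>|lebesgue. h x - \<beta>) = (LINT x:\<Union>\<D>|lebesgue. h x) - \<beta> * measure lebesgue (\<Union>\<D>)"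
    using set_integral_diff(2)[OF set_integrable_subset[OF h Un] const] by simp
  ultimately show ?thesis by simp
qed

text \<open>\<open>E\<close> plays the role of the superlevel set \<open>{x. \<alpha> < f x}\<close>, but it is a union of intervals on which \<open>f\<close> has
  mean exactly \<open>\<alpha>\<close>.\<close>

lemma rising_sun_superlevel_set:
  assumes f: "f absolutely_integrable_on {a..b}" and "a < b" and "mean a b f \<le> \<alpha>"
  obtains E where "E \<in> sets lebesgue" "E \<subseteq> {a..b}" "AE x in lebesgue. x \<in> {a..b} - E \<longrightarrow> f x \<le> \<alpha>"
    "\<And>h \<beta>. h absolutely_integrable_on {a..b} \<Longrightarrow>
      (\<And>c d. a \<le> c \<Longrightarrow> c < d \<Longrightarrow> d \<le> b \<Longrightarrow> mean c d f = \<alpha> \<Longrightarrow> mean c d h \<le> \<beta>) \<Longrightarrow>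
      (LINT x:E|lebesgue. h x) \<le> \<beta> * measure lebesgue E"
proof -
  obtain \<D> where D: "countable \<D>" "disjoint \<D>"
      "\<And>K. K \<in> \<D> \<Longrightarrow> \<exists>c d. K = {c<..<d} \<and> a \<le> c \<and> c < d \<and> d \<le> b \<and> mean c d f = \<alpha>"
    and off: "AE x in lebesgue. x \<in> {a..b} - \<Union>\<D> \<longrightarrow> f x \<le> \<alpha>"
    by (rule rising_sun_level[OF set_lebesgue_integral_eq_integral(1)[OF f] assms(2,3)]) (rule that)
  have "K \<in> sets lebesgue" "K \<subseteq> {a..b}" if "K \<in> \<D>" for K
    using D(3)[OF that] by auto
  then have E: "\<Union>\<D> \<in> sets lebesgue" "\<Union>\<D> \<subseteq> {a..b}"
    using sets.countable_Union[OF D(1)] by blast+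
  show ?thesis
  proof (rule that[OF E off])
    fix h \<beta>
    assume h: "h absolutely_integrable_on {a..b}"
      and mean_le: "\<And>c d. a \<le> c \<Longrightarrow> c < d \<Longrightarrow> d \<le> b \<Longrightarrow> mean c d f = \<alpha> \<Longrightarrow> mean c d h \<le> \<beta>"
    have "\<exists>c d. K = {c<..<d} \<and> a \<le> c \<and> c < d \<and> d \<le> b \<and> mean c d h \<le> \<beta>" if "K \<in> \<D>" for K
      using D(3)[OF that] mean_le by blast
    then show "(LINT x:\<Union>\<D>|lebesgue. h x) \<le> \<beta> * measure lebesgue (\<Union>\<D>)"
      by (intro set_integral_Union_intervals_le[OF D(1,2) _ h])
  qed
qed

lemma convex_chord:
  fixes \<Psi> :: "real \<Rightarrow> real"
  assumes \<Psi>: "convex_on UNIV \<Psi>" and "c < \<alpha>"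
  obtains k where "\<Psi> c = \<Psi> \<alpha> + k * (c - \<alpha>)"
    "\<And>y. y \<le> \<alpha> \<Longrightarrow> \<Psi> (max c y) \<le> \<Psi> \<alpha> + k * (max c y - \<alpha>)"
    "\<And>y. \<Psi> (max c y) - k * max c y \<le> \<Psi> y - k * y"
proof -
  define k where "k = (\<Psi> c - \<Psi> \<alpha>) / (c - \<alpha>)"
  have c: "\<Psi> c = \<Psi> \<alpha> + k * (c - \<alpha>)" using \<open>c < \<alpha>\<close> by (simp add: k_def)
  moreover have "\<Psi> (max c y) \<le> \<Psi> \<alpha> + k * (max c y - \<alpha>)" if "y \<le> \<alpha>" for y
  proof (cases "c < y \<and> y < \<alpha>")
    case True
    then show ?thesis
      using convex_on_slope_le(2)[OF \<Psi>, of c \<alpha> y] by (simp add: k_def max_def field_simps)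
  next
    case False
    then have "max c y = c \<or> max c y = \<alpha>" using that \<open>c < \<alpha>\<close> by auto
    then show ?thesis using c by auto
  qed
  moreover have "\<Psi> (max c y) - k * max c y \<le> \<Psi> y - k * y" for y
  proof (cases "c \<le> y")
    case False
    then have "(\<Psi> y - \<Psi> c) / (y - c) \<le> (\<Psi> y - \<Psi> \<alpha>) / (y - \<alpha>)" "(\<Psi> y - \<Psi> \<alpha>) / (y - \<alpha>) \<le> k"
      using convex_on_slope_le[OF \<Psi>, of y \<alpha> c] \<open>c < \<alpha>\<close> by (auto simp: k_def)
    then have "(\<Psi> y - \<Psi> c) / (y - c) \<le> k" by linarith
    then show ?thesis using False by (simp add: divide_le_eq algebra_simps)
  qed simp
  ultimately show ?thesis using that by blast
qed

lemma mean_final_segment: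
  assumes "f integrable_on {0..1}" "0 \<le> s" "s < 1" and zero: "\<And>t. t \<in> {0..s} \<Longrightarrow> f t = 0"
  shows "mean 0 1 f = (1 - s) * mean s 1 f"
proof -
  have "integral {0..s} f = integral {0..s} (\<lambda>_. 0)"
    by (rule Henstock_Kurzweil_Integration.integral_cong) (rule zero)
  then have "integral {0..1} f = integral {s..1} f"
    using Henstock_Kurzweil_Integration.integral_combine[of 0 s 1 f] assms by simp
  then show ?thesis using \<open>s < 1\<close> by (simp add: mean_def)
qed

lemma mono_eq_mean_imp_constant:
  assumes "mono I" "I integrable_on {s..1}" "s < 1" "I s = mean s 1 I" "t \<in> {s..<1}"
  shows "I t = I s"
proof (rule antisym)
  have "integral {s..t} I + integral {t..1} I = (1 - s) * I s"
    using Henstock_Kurzweil_Integration.integral_combine[of s t 1 I] assms by (simp add: mean_def)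
  moreover have "I integrable_on {s..t}" "I integrable_on {t..1}"
    using integrable_on_subinterval[OF assms(2)] assms(5) by auto
  then have "integral {s..t} (\<lambda>_. I s) \<le> integral {s..t} I"
    using monoD[OF \<open>mono I\<close>] by (intro integral_le) auto
  moreover have "integral {t..1} (\<lambda>_. I t) \<le> integral {t..1} I"
    using \<open>I integrable_on {t..1}\<close> monoD[OF \<open>mono I\<close>] by (intro integral_le) auto
  ultimately have "(1 - t) * I t \<le> (1 - t) * I s" using assms(5) by (simp add: algebra_simps)
  then show "I t \<le> I s" using assms(5) by simp
qed (use assms(5) monoD[OF \<open>mono I\<close>] in auto)

lemma mono_mean_final_mono:
  assumes "mono I" and int: "\<And>u v. I integrable_on {u..v}" and "r \<le> s" "s < 1"
  shows "mean r 1 I \<le> mean s 1 I"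
proof -
  have "I s \<le> mean s 1 I"
    using \<open>mono I\<close> \<open>s < 1\<close> by (intro mean_ge_const int) (auto dest: monoD)
  have "integral {r..s} I \<le> integral {r..s} (\<lambda>_. I s)"
    using \<open>mono I\<close> by (intro integral_le int) (auto dest: monoD)
  also have "\<dots> \<le> (s - r) * mean s 1 I"
    using \<open>r \<le> s\<close> \<open>I s \<le> mean s 1 I\<close> by (simp add: mult_left_mono)
  finally have "integral {r..1} I \<le> (s - r) * mean s 1 I + (1 - s) * mean s 1 I"
    using Henstock_Kurzweil_Integration.integral_combine[of r s 1 I] assms integral_eq_mean[of s 1 I] by simp
  then show ?thesis using assms by (simp add: mean_def[of r] field_simps)
qed

lemma set_integral_le_subset:
  fixes f g :: "'a \<Rightarrow> real"
  assumes "set_integrable M S f" "set_integrable M E g" "E \<subseteq> S"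
    and "AE x in M. x \<in> S - E \<longrightarrow> f x \<le> 0" "\<And>x. x \<in> E \<Longrightarrow> f x \<le> g x"
  shows "(LINT x:S|M. f x) \<le> (LINT x:E|M. g x)"
  using assms unfolding set_lebesgue_integral_def set_integrable_def
  by (intro integral_mono_AE) (auto simp: indicator_def)

text \<open>\<open>\<rho>\<close> stands for the relative measure of the substitute \<open>E\<close> for the superlevel set \<open>{x. mean s 1 I < \<phi> x}\<close>, and \<open>H\<close>
  for a majorant of \<open>F\<close> that is integrated over \<open>E\<close> only.\<close>

definition level_comparison :: "real \<Rightarrow> real \<Rightarrow> (real \<Rightarrow> real) \<Rightarrow> (real \<Rightarrow> real) \<Rightarrow> real \<Rightarrow> real \<Rightarrow> bool" where
  "level_comparison a b \<phi> I s \<rho> \<longleftrightarrow> (\<forall>F H \<beta>. continuous_on UNIV F \<longrightarrow> continuous_on UNIV H \<longrightarrow> (\<forall>y. F y \<le> H y) \<longrightarrow>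
     (\<forall>y\<le>mean s 1 I. F y \<le> 0) \<longrightarrow> (\<forall>y\<le>I s. F y = 0) \<longrightarrow>
     (\<forall>u v. a \<le> u \<longrightarrow> u < v \<longrightarrow> v \<le> b \<longrightarrow> mean u v \<phi> = mean s 1 I \<longrightarrow> mean u v (\<lambda>x. H (\<phi> x)) \<le> \<beta>) \<longrightarrow>
     (1 - s) * mean s 1 (\<lambda>t. F (I t)) \<le> \<beta> * \<rho>)"

lemma level_comparisonD:
  assumes "level_comparison a b \<phi> I s \<rho>" "continuous_on UNIV F" "continuous_on UNIV H" "\<And>y. F y \<le> H y"
    and "\<And>y. y \<le> mean s 1 I \<Longrightarrow> F y \<le> 0" "\<And>y. y \<le> I s \<Longrightarrow> F y = 0"
    and "\<And>u v. a \<le> u \<Longrightarrow> u < v \<Longrightarrow> v \<le> b \<Longrightarrow> mean u v \<phi> = mean s 1 I \<Longrightarrow> mean u v (\<lambda>x. H (\<phi> x)) \<le> \<beta>"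
  shows "(1 - s) * mean s 1 (\<lambda>t. F (I t)) \<le> \<beta> * \<rho>"
  using assms unfolding level_comparison_def by blast

lemma level_comparison_exists:
  assumes \<phi>: "bounded_measurable_on {a..b} \<phi>" and "a < b" and I: "monotone_rearrangement a b \<phi> I"
    and s: "0 \<le> s" "s < 1"
  obtains \<rho> where "level_comparison a b \<phi> I s \<rho>"
proof -
  define \<alpha> where "\<alpha> = mean s 1 I"
  have mono: "mono I" using I by (rule monotone_rearrangementD)
  note I_int = monotone_rearrangement_integrable[OF I]
  have int: "(\<lambda>x. h (\<phi> x)) absolutely_integrable_on {a..b}" if "continuous_on UNIV h" for h :: "real \<Rightarrow> real"
    by (rule bounded_measurable_on_imp_absolutely_integrable[OF bounded_measurable_on_compose[OF \<phi> that]]) simp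
  have "mean a b \<phi> \<le> \<alpha>"
    using monotone_rearrangementD(4)[OF I continuous_on_id]
      mono_mean_final_mono[OF mono I_int[OF continuous_on_id] s]
    by (simp add: \<alpha>_def)
  show ?thesis
  proof (rule rising_sun_superlevel_set[OF int[OF continuous_on_id] \<open>a < b\<close> \<open>mean a b \<phi> \<le> \<alpha>\<close>],
      rule that[of "measure lebesgue E / (b - a)" for E],
      unfold level_comparison_def \<alpha>_def[symmetric], intro allI impI)
    fix E
    assume E: "E \<in> sets lebesgue" "E \<subseteq> {a..b}" "AE x in lebesgue. x \<in> {a..b} - E \<longrightarrow> \<phi> x \<le> \<alpha>"
      and E_le: "\<And>h \<beta>. h absolutely_integrable_on {a..b} \<Longrightarrow>
        (\<And>u v. a \<le> u \<Longrightarrow> u < v \<Longrightarrow> v \<le> b \<Longrightarrow> mean u v \<phi> = \<alpha> \<Longrightarrow> mean u v h \<le> \<beta>) \<Longrightarrow>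
        (LINT x:E|lebesgue. h x) \<le> \<beta> * measure lebesgue E"
    fix F H :: "real \<Rightarrow> real" and \<beta>
    assume F: "continuous_on UNIV F" "\<forall>y\<le>\<alpha>. F y \<le> 0" "\<forall>y\<le>I s. F y = 0"
      and H: "continuous_on UNIV H" and FH: "\<forall>y. F y \<le> H y"
      and H_le: "\<forall>u v. a \<le> u \<longrightarrow> u < v \<longrightarrow> v \<le> b \<longrightarrow> mean u v \<phi> = \<alpha> \<longrightarrow> mean u v (\<lambda>x. H (\<phi> x)) \<le> \<beta>"
    have "(1 - s) * mean s 1 (\<lambda>t. F (I t)) = mean 0 1 (\<lambda>t. F (I t))"
      using F(3) monoD[OF mono] by (intro mean_final_segment[symmetric] I_int F(1) s) auto
    also have "\<dots> = (LINT x:{a..b}|lebesgue. F (\<phi> x)) / (b - a)"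
      using monotone_rearrangementD(4)[OF I F(1)] set_lebesgue_integral_eq_integral(2)[OF int[OF F(1)]]
      by (simp add: mean_def)
    also have "\<dots> \<le> (LINT x:E|lebesgue. H (\<phi> x)) / (b - a)"
    proof (intro divide_right_mono set_integral_le_subset int[OF F(1)] E(2))
      show "set_integrable lebesgue E (\<lambda>x. H (\<phi> x))"
        by (rule set_integrable_subset[OF int[OF H] E(1,2)])
      show "AE x in lebesgue. x \<in> {a..b} - E \<longrightarrow> F (\<phi> x) \<le> 0"
        using E(3) by eventually_elim (use F(2) in blast)
    qed (use \<open>a < b\<close> FH in auto)
    also have "\<dots> \<le> \<beta> * measure lebesgue E / (b - a)"
      using \<open>a < b\<close> H_le by (intro divide_right_mono E_le int[OF H]) auto
    finally show "(1 - s) * mean s 1 (\<lambda>t. F (I t)) \<le> \<beta> * (measure lebesgue E / (b - a))" by simp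
  qed
qed

lemma level_comparison_measure_le:
  assumes level: "level_comparison a b \<phi> I s \<rho>"
    and \<phi>_int: "\<And>u v. a \<le> u \<Longrightarrow> v \<le> b \<Longrightarrow> \<phi> integrable_on {u..v}"
    and I: "mono I" "I integrable_on {s..1}" and "s < 1" and strict: "I s < mean s 1 I"
  shows "\<rho> \<le> 1 - s"
proof -
  define c where "c = I s"
  have "mean u v (\<lambda>x. c - \<phi> x) = c - mean u v \<phi>" if "a \<le> u" "u < v" "v \<le> b" for u v
    using mean_affine[of \<phi> u v "- 1" c] \<phi>_int[OF that(1,3)] that(2) by simp
  then have "(1 - s) * mean s 1 (\<lambda>t. c - max c (I t)) \<le> (c - mean s 1 I) * \<rho>"
    by (intro level_comparisonD[OF level, where H = "\<lambda>y. c - y"] continuous_intros) (auto simp: c_def)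
  moreover have "mean s 1 (\<lambda>t. c - max c (I t)) = mean s 1 (\<lambda>t. c - I t)"
    using monoD[OF I(1)] by (intro mean_cong) (simp add: c_def max_absorb2)
  moreover have "mean s 1 (\<lambda>t. c - I t) = c - mean s 1 I"
    using mean_affine[OF I(2) \<open>s < 1\<close>, of "- 1" c] by simp
  ultimately have "(mean s 1 I - c) * \<rho> \<le> (mean s 1 I - c) * (1 - s)" by (simp add: algebra_simps)
  then show ?thesis using strict by (simp add: c_def)
qed

lemma mean_affine_defect:
  assumes "u < v" "f integrable_on {u..v}" "(\<lambda>x. \<Psi> (f x)) integrable_on {u..v}"
  shows "mean u v (\<lambda>x. \<Psi> (f x) - B - k * (f x - mean u v f)) = mean u v (\<lambda>x. \<Psi> (f x)) - B"
proof -
  have "(\<lambda>x. \<Psi> (f x) - B - k * (f x - mean u v f)) = (\<lambda>x. \<Psi> (f x) + ((- k) * f x + (k * mean u v f - B)))"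
    by (auto simp: algebra_simps)
  then have "mean u v (\<lambda>x. \<Psi> (f x) - B - k * (f x - mean u v f))
      = mean u v (\<lambda>x. \<Psi> (f x)) + mean u v (\<lambda>x. (- k) * f x + (k * mean u v f - B))"
    using assms by (simp only:) (intro mean_add integrable_add integrable_on_mult_right integrable_const_ivl)
  also have "mean u v (\<lambda>x. (- k) * f x + (k * mean u v f - B)) = - B"
    using mean_affine[OF assms(2,1), of "- k" "k * mean u v f - B"] by simp
  finally show ?thesis by simp
qed

lemma mean_dominated_rearrangement_final_strict:
  assumes \<phi>: "bounded_measurable_on {a..b} \<phi>" "a < b" and I: "monotone_rearrangement a b \<phi> I"
    and \<Psi>: "convex_on UNIV \<Psi>" and \<Psi>_le: "\<And>y. \<Psi> y \<le> K y" and dom: "mean_dominated \<Psi> K a b \<phi>"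
    and s: "0 \<le> s" "s < 1" and strict: "I s < mean s 1 I"
  shows "mean s 1 (\<lambda>t. \<Psi> (I t)) \<le> K (mean s 1 I)"
proof -
  define \<alpha> where "\<alpha> = mean s 1 I"
  define c where "c = I s"
  have cont: "continuous_on UNIV \<Psi>" by (rule convex_on_continuous[OF open_UNIV \<Psi>])
  have mono: "mono I" using I by (rule monotone_rearrangementD)
  note I_int = monotone_rearrangement_integrable[OF I]
  note \<phi>_int = bounded_measurable_on_compose_integrable[OF \<phi>(1)]
  obtain \<rho> where level: "level_comparison a b \<phi> I s \<rho>"
    using level_comparison_exists[OF \<phi> I s] .
  have "\<rho> \<le> 1 - s"
    by (rule level_comparison_measure_le[OF level \<phi>_int[OF continuous_on_id] mono
          I_int[OF continuous_on_id] s(2) strict])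
  obtain k where k: "\<Psi> c = \<Psi> \<alpha> + k * (c - \<alpha>)"
      "\<And>y. y \<le> \<alpha> \<Longrightarrow> \<Psi> (max c y) \<le> \<Psi> \<alpha> + k * (max c y - \<alpha>)"
      "\<And>y. \<Psi> (max c y) - k * max c y \<le> \<Psi> y - k * y"
    using convex_chord[OF \<Psi> strict] unfolding \<alpha>_def c_def by blast
  define F where "F = (\<lambda>y. \<Psi> (max c y) - \<Psi> \<alpha> - k * (max c y - \<alpha>))"
  have "(1 - s) * mean s 1 (\<lambda>t. F (I t)) \<le> (K \<alpha> - \<Psi> \<alpha>) * \<rho>"
  proof (rule level_comparisonD[OF level, where H = "\<lambda>y. \<Psi> y - \<Psi> \<alpha> - k * (y - \<alpha>)"])
    show "continuous_on UNIV F"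
      unfolding F_def by (intro continuous_intros continuous_on_compose2[OF cont]) auto
    show "continuous_on UNIV (\<lambda>y. \<Psi> y - \<Psi> \<alpha> - k * (y - \<alpha>))" by (intro continuous_intros cont)
    show "F y \<le> \<Psi> y - \<Psi> \<alpha> - k * (y - \<alpha>)" for y
      using k(3)[of y] by (simp add: F_def algebra_simps)
    fix u v assume uv: "a \<le> u" "u < v" "v \<le> b" "mean u v \<phi> = mean s 1 I"
    then show "mean u v (\<lambda>x. \<Psi> (\<phi> x) - \<Psi> \<alpha> - k * (\<phi> x - \<alpha>)) \<le> K \<alpha> - \<Psi> \<alpha>"
      using mean_affine_defect[OF uv(2) \<phi>_int[OF continuous_on_id] \<phi>_int[OF cont], of "\<Psi> \<alpha>" k]
        mean_dominatedD[OF dom uv(1-3)] by (simp add: \<alpha>_def)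
  qed (use k(1,2) in \<open>auto simp: F_def \<alpha>_def[symmetric] c_def[symmetric] max_def algebra_simps\<close>)
  also have "mean s 1 (\<lambda>t. F (I t)) = mean s 1 (\<lambda>t. \<Psi> (I t) - \<Psi> \<alpha> - k * (I t - \<alpha>))"
    using monoD[OF mono] by (intro mean_cong) (simp add: F_def c_def max_absorb2)
  also have "\<dots> = mean s 1 (\<lambda>t. \<Psi> (I t)) - \<Psi> \<alpha>"
    unfolding \<alpha>_def by (rule mean_affine_defect[OF s(2) I_int[OF continuous_on_id] I_int[OF cont]])
  finally have "(1 - s) * (mean s 1 (\<lambda>t. \<Psi> (I t)) - \<Psi> \<alpha>) \<le> (1 - s) * (K \<alpha> - \<Psi> \<alpha>)"
    using mult_left_mono[OF \<open>\<rho> \<le> 1 - s\<close>, of "K \<alpha> - \<Psi> \<alpha>"] \<Psi>_le[of \<alpha>] by (simp add: mult.commute)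
  then show ?thesis using s by (simp add: \<alpha>_def)
qed

theorem mean_dominated_rearrangement_final:
  assumes "bounded_measurable_on {a..b} \<phi>" "a < b" and I: "monotone_rearrangement a b \<phi> I"
    and "convex_on UNIV \<Psi>" and \<Psi>_le: "\<And>y. \<Psi> y \<le> K y" and "mean_dominated \<Psi> K a b \<phi>"
    and s: "0 \<le> s" "s < 1"
  shows "mean s 1 (\<lambda>t. \<Psi> (I t)) \<le> K (mean s 1 I)"
proof (cases "I s < mean s 1 I")
  case True
  then show ?thesis by (rule mean_dominated_rearrangement_final_strict[OF assms])
next
  case False
  have mono: "mono I" using I by (rule monotone_rearrangementD)
  note int = monotone_rearrangement_integrable[OF I continuous_on_id]
  have "I s \<le> mean s 1 I"
    using monoD[OF mono] by (intro mean_ge_const[OF int s(2)]) simp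
  then have const: "I t = mean s 1 I" if "t \<in> {s..1} - {1}" for t
    using mono_eq_mean_imp_constant[OF mono int s(2), of t] that False by simp
  have "integral {s..1} (\<lambda>t. \<Psi> (I t)) = integral {s..1} (\<lambda>t. \<Psi> (mean s 1 I))"
    by (rule integral_spike[of "{1}"]) (simp_all add: const)
  then have "mean s 1 (\<lambda>t. \<Psi> (I t)) = \<Psi> (mean s 1 I)"
    using s by (simp add: mean_def[of _ _ "\<lambda>t. \<Psi> (I t)"])
  then show ?thesis using \<Psi>_le by simp
qed

corollary mean_dominated_rearrangement_initial:
  assumes \<phi>: "bounded_measurable_on {a..b} \<phi>" "a < b" and I: "monotone_rearrangement a b \<phi> I"
    and \<Psi>: "convex_on UNIV \<Psi>" and "\<And>y. \<Psi> y \<le> K y" and dom: "mean_dominated \<Psi> K a b \<phi>"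
    and s: "0 < s" "s \<le> 1"
  shows "mean 0 s (\<lambda>t. \<Psi> (I t)) \<le> K (mean 0 s I)"
proof -
  have neg: "mean u v (\<lambda>x. - f x) = - mean u v f" for u v f
    using mean_cmult[of u v "- 1" f] by simp
  have "mean (1 - s) 1 (\<lambda>t. \<Psi> (- (- I (1 - t)))) \<le> K (- mean (1 - s) 1 (\<lambda>t. - I (1 - t)))"
  proof (rule mean_dominated_rearrangement_final[where \<Psi>="\<lambda>y. \<Psi> (- y)" and K="\<lambda>y. K (- y)"])
    show "bounded_measurable_on {a..b} (\<lambda>x. - \<phi> x)"
      by (rule bounded_measurable_on_compose[OF \<phi>(1)]) (intro continuous_intros)
    show "convex_on UNIV (\<lambda>y. \<Psi> (- y))"
    proof (rule convex_onI)
      fix t x y :: real assume "0 < t" "t < 1"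
      then show "\<Psi> (- ((1 - t) *\<^sub>R x + t *\<^sub>R y)) \<le> (1 - t) * \<Psi> (- x) + t * \<Psi> (- y)"
        using convex_onD[OF \<Psi>, of t "- x" "- y"] by (simp add: algebra_simps)
    qed simp
    show "mean_dominated (\<lambda>y. \<Psi> (- y)) (\<lambda>y. K (- y)) a b (\<lambda>x. - \<phi> x)"
      using dom by (simp add: mean_dominated_def neg)
  qed (use assms monotone_rearrangement_reflect in auto)
  then show ?thesis
    using mean_reflect[of 1 s 0 "\<lambda>t. \<Psi> (I t)"] mean_reflect[of 1 s 0 I] by (simp add: neg)
qed

section \<open>Supporting planes of the Bellman candidate\<close>

lemma DERIV_nonneg_off_zero_imp_nondecreasing:
  fixes f :: "real \<Rightarrow> real"
  assumes "a \<le> b" and cont: "continuous_on {a..b} f"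
    and D: "\<And>x. a < x \<Longrightarrow> x < b \<Longrightarrow> x \<noteq> 0 \<Longrightarrow> \<exists>y. DERIV f x :> y \<and> y \<ge> 0"
  shows "f a \<le> f b"
proof (cases "a < 0 \<and> 0 < b")
  case True
  have "f a \<le> f 0"
    by (rule DERIV_nonneg_imp_increasing_open) (use True D cont in \<open>auto intro: continuous_on_subset\<close>)
  also have "f 0 \<le> f b"
    by (rule DERIV_nonneg_imp_increasing_open) (use True D cont in \<open>auto intro: continuous_on_subset\<close>)
  finally show ?thesis .
next
  case False
  show ?thesis
    by (rule DERIV_nonneg_imp_increasing_open) (use assms False in auto)
qed

lemma DERIV_nonpos_off_zero_imp_nonincreasing:
  fixes f :: "real \<Rightarrow> real"
  assumes "a \<le> b" and cont: "continuous_on {a..b} f"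
    and D: "\<And>x. a < x \<Longrightarrow> x < b \<Longrightarrow> x \<noteq> 0 \<Longrightarrow> \<exists>y. DERIV f x :> y \<and> y \<le> 0"
  shows "f b \<le> f a"
proof -
  have "\<exists>y. DERIV (\<lambda>x. - f x) x :> y \<and> y \<ge> 0" if "a < x" "x < b" "x \<noteq> 0" for x
    using D[OF that] DERIV_minus by fastforce
  then have "- f a \<le> - f b"
    by (intro DERIV_nonneg_off_zero_imp_nondecreasing[OF \<open>a \<le> b\<close> continuous_on_minus[OF cont]])
  then show ?thesis by simp
qed

definition sgn_powr :: "real \<Rightarrow> real \<Rightarrow> real" where
  "sgn_powr a r = sgn r * \<bar>r\<bar> powr a"

lemma sgn_powr_nonneg_eq: "r \<ge> 0 \<Longrightarrow> sgn_powr a r = r powr a"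
  and sgn_powr_nonpos_eq: "r \<le> 0 \<Longrightarrow> sgn_powr a r = - ((- r) powr a)"
  by (auto simp: sgn_powr_def sgn_if)

lemma continuous_on_sgn_powr:
  assumes "a > 0" shows "continuous_on S (sgn_powr a)"
proof -
  have "sgn_powr a = (\<lambda>r. max r 0 powr a - max (- r) 0 powr a)"
    by (auto simp: sgn_powr_def sgn_if max_def)
  then show ?thesis
    using assms by (simp only:) (intro continuous_on_diff continuous_on_powr' continuous_intros; auto)
qed

lemma DERIV_abs_powr:
  assumes "r \<noteq> 0"
  shows "((\<lambda>r. \<bar>r\<bar> powr a) has_real_derivative a * sgn_powr (a - 1) r) (at r)"
proof (rule has_field_derivative_transform_within_open)
  have "0 < sgn r * r" using assms by (simp add: sgn_if)
  then show "((\<lambda>x. (sgn r * x) powr a) has_real_derivative a * sgn_powr (a - 1) r) (at r)"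
    by (auto intro!: derivative_eq_intros simp: sgn_powr_def abs_sgn mult.commute)
  show "open {x. 0 < r * x}" by (intro open_Collect_less continuous_intros)
qed (use assms in \<open>auto simp: zero_less_mult_iff sgn_if\<close>)

lemma DERIV_sgn_powr:
  assumes "r \<noteq> 0"
  shows "(sgn_powr a has_real_derivative a * \<bar>r\<bar> powr (a - 1)) (at r)"
proof (rule has_field_derivative_transform_within_open)
  have "((\<lambda>x. sgn r * \<bar>x\<bar> powr a) has_real_derivative sgn r * (a * sgn_powr (a - 1) r)) (at r)"
    by (intro DERIV_cmult DERIV_abs_powr assms)
  then show "((\<lambda>x. sgn r * \<bar>x\<bar> powr a) has_real_derivative a * \<bar>r\<bar> powr (a - 1)) (at r)"
    using assms by (simp add: sgn_powr_def sgn_if split: if_splits)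
  show "open {x. 0 < r * x}" by (intro open_Collect_less continuous_intros)
qed (use assms in \<open>auto simp: sgn_powr_def zero_less_mult_iff sgn_if\<close>)

definition incomplete_Gamma :: "real \<Rightarrow> real \<Rightarrow> real \<Rightarrow> real" where
  "incomplete_Gamma c p r = integral {0..r} (\<lambda>s. s powr (p - 1) * exp (c * s))"

lemma incomplete_Gamma_nonpos [simp]: "r \<le> 0 \<Longrightarrow> incomplete_Gamma c p r = 0"
  by (cases "r = 0") (auto simp: incomplete_Gamma_def)

lemma continuous_on_powr_mult_exp:
  fixes p c :: real
  assumes "p > 1" shows "continuous_on {0..b} (\<lambda>s. s powr (p - 1) * exp (c * s))"
  using assms by (intro continuous_on_mult continuous_on_powr' continuous_intros) auto

lemma DERIV_incomplete_Gamma: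
  assumes "p > 1" "r > 0"
  shows "(incomplete_Gamma c p has_real_derivative r powr (p - 1) * exp (c * r)) (at r)"
proof -
  have "((\<lambda>u. integral {0..u} (\<lambda>s. s powr (p - 1) * exp (c * s))) has_real_derivative
      r powr (p - 1) * exp (c * r)) (at r within {0..r + 1})"
    by (rule integral_has_real_derivative[OF continuous_on_powr_mult_exp]) (use assms in auto)
  moreover have "at r within {0..r + 1} = at r"
    by (rule at_within_interior) (use assms in auto)
  ultimately show ?thesis unfolding incomplete_Gamma_def[abs_def] by simp
qed

lemma continuous_on_incomplete_Gamma:
  assumes "p > 1" shows "continuous_on S (incomplete_Gamma c p)"
proof -
  have "isCont (incomplete_Gamma c p) r" for r
  proof -
    let ?b = "\<bar>r\<bar> + 1"
    have "continuous_on {0..?b} (incomplete_Gamma c p)"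
      unfolding incomplete_Gamma_def[abs_def]
      by (intro indefinite_integral_continuous_1 integrable_continuous_real continuous_on_powr_mult_exp assms)
    then have "continuous_on {..<?b} (\<lambda>r. incomplete_Gamma c p (max r 0))"
      by (rule continuous_on_compose2) (auto intro!: continuous_intros)
    moreover have "incomplete_Gamma c p (max r 0) = incomplete_Gamma c p r" for r
      by (simp add: max_def)
    ultimately show ?thesis
      by (simp add: continuous_on_eq_continuous_at)
  qed
  then show ?thesis by (simp add: continuous_at_imp_continuous_on)
qed

lemma incomplete_Gamma_tendsto_Gamma:
  assumes "p > 0"
  shows "(incomplete_Gamma (-1) p \<longlongrightarrow> Gamma p) at_top"
proof -
  let ?f = "\<lambda>s. s powr (p - 1) * exp (-1 * s)"
  have "(\<lambda>t. t powr (p - 1) / exp t) = ?f"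
    by (simp add: exp_minus field_simps)
  then have Gamma: "(?f has_integral Gamma p) {0..}"
    using Gamma_integral_real[OF assms] by simp
  then have int: "?f absolutely_integrable_on {0..}"
    by (intro nonnegative_absolutely_integrable_1) auto
  have "((\<lambda>b. LINT x:{0..b}|lebesgue. ?f x) \<longlongrightarrow> (LINT x:{0..}|lebesgue. ?f x)) at_top"
    by (rule tendsto_set_lebesgue_integral_at_top) (use int in auto)
  moreover have "(LINT x:{0..}|lebesgue. ?f x) = Gamma p"
    using int Gamma by (simp add: set_lebesgue_integral_eq_integral integral_unique)
  moreover have "(LINT x:{0..b}|lebesgue. ?f x) = incomplete_Gamma (-1) p b" for b
    unfolding incomplete_Gamma_def
    by (rule set_lebesgue_integral_eq_integral(2)[OF set_integrable_subset[OF int]]) auto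
  ultimately show ?thesis by simp
qed

text \<open>This is the integral of \<open>sgn_powr (p - 1) (r + t) * exp (- t)\<close> over \<open>t \<ge> 0\<close>; at most one of the two
  incomplete Gamma functions is nonzero.\<close>

definition tangent_slope :: "real \<Rightarrow> real \<Rightarrow> real" where
  "tangent_slope p r = exp r * (Gamma p - incomplete_Gamma (-1) p r - incomplete_Gamma 1 p (- r))"

lemma continuous_on_tangent_slope:
  assumes "p > 1" shows "continuous_on S (tangent_slope p)"
  unfolding tangent_slope_def[abs_def]
  by (intro continuous_intros continuous_on_incomplete_Gamma[OF assms]
      continuous_on_compose2[OF continuous_on_incomplete_Gamma[OF assms, of UNIV]]) auto

lemma DERIV_tangent_slope:
  assumes "p > 1" "r \<noteq> 0"
  shows "(tangent_slope p has_real_derivative tangent_slope p r - sgn_powr (p - 1) r) (at r)"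
proof (cases "r > 0")
  case True
  have "((\<lambda>r. exp r * (Gamma p - incomplete_Gamma (-1) p r)) has_real_derivative
      tangent_slope p r - sgn_powr (p - 1) r) (at r)"
    using True assms
    by (auto intro!: derivative_eq_intros DERIV_incomplete_Gamma
        simp: tangent_slope_def sgn_powr_nonneg_eq exp_minus field_simps)
  then show ?thesis
    by (rule has_field_derivative_transform_within_open[where S="{0<..}"])
       (use True in \<open>auto simp: tangent_slope_def\<close>)
next
  case False
  then have r: "r < 0" using assms by simp
  have "((\<lambda>r. incomplete_Gamma 1 p (- r)) has_real_derivative (- r) powr (p - 1) * exp (1 * (- r)) * (- 1)) (at r)"
    by (rule DERIV_chain2[OF DERIV_incomplete_Gamma]) (use r assms in \<open>auto intro!: derivative_eq_intros\<close>)
  then have "((\<lambda>r. exp r * (Gamma p - incomplete_Gamma 1 p (- r))) has_real_derivative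
      tangent_slope p r - sgn_powr (p - 1) r) (at r)"
    using r by (auto intro!: derivative_eq_intros simp: tangent_slope_def sgn_powr_nonpos_eq exp_minus field_simps)
  then show ?thesis
    by (rule has_field_derivative_transform_within_open[where S="{..<0}"])
       (use r in \<open>auto simp: tangent_slope_def\<close>)
qed

lemma Gamma_le_1:
  fixes p :: real
  assumes "1 \<le> p" "p \<le> 2" shows "Gamma p \<le> 1"
proof -
  have "ln (Gamma ((1 - (p - 1)) *\<^sub>R 1 + (p - 1) *\<^sub>R 2))
      \<le> (1 - (p - 1)) * ln (Gamma 1) + (p - 1) * ln (Gamma (2::real))"
    using convex_onD[OF log_convex_Gamma_real, of "p - 1" 1 2] assms by simp
  moreover have "Gamma (2::real) = 1" using Gamma_fact[of 1, where 'a=real] by simp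
  ultimately have "ln (Gamma p) \<le> 0" by simp
  then show ?thesis using Gamma_real_pos[of p] assms by simp
qed

lemma incomplete_Gamma_ge_1:
  assumes "1 < p" "p \<le> 2" shows "incomplete_Gamma 1 p 1 \<ge> 1"
proof -
  have "((\<lambda>x::real. x * exp x) has_integral ((1 - 1) * exp 1 - (0 - 1) * exp 0)) {0..1}"
    by (rule fundamental_theorem_of_calculus)
       (auto intro!: derivative_eq_intros simp: algebra_simps simp flip: has_real_derivative_iff_has_vector_derivative)
  then have ibp: "((\<lambda>x::real. x * exp x) has_integral 1) {0..1}" by simp
  have "x * exp x \<le> x powr (p - 1) * exp (1 * x)" if "x \<in> {0..1}" for x :: real
    using that assms powr_mono'[of "p - 1" 1 x] by auto
  then have "integral {0..1} (\<lambda>x::real. x * exp x) \<le> incomplete_Gamma 1 p 1"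
    unfolding incomplete_Gamma_def using assms
    by (intro integral_le[OF has_integral_integrable[OF ibp]] integrable_continuous_real continuous_on_powr_mult_exp) auto
  then show ?thesis using ibp by (simp add: integral_unique)
qed

lemma upper_Gamma_le:
  assumes "1 < p" "p \<le> 2" "r > 0"
  shows "Gamma p - incomplete_Gamma (-1) p r \<le> exp (- r) * (r powr (p - 1) + r powr (p - 2))"
proof -
  define h where "h x = exp (- x) * (x powr (p - 1) + x powr (p - 2)) + incomplete_Gamma (-1) p x" for x
  have D: "(h has_real_derivative exp (- x) * ((p - 2) * (x powr (p - 2) + x powr (p - 3)))) (at x)"
    if "x > 0" for x
    unfolding h_def[abs_def] using that assms
    by (auto intro!: derivative_eq_intros DERIV_incomplete_Gamma simp: algebra_simps)
  have "h y \<le> h r" if "r \<le> y" for y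
  proof (rule DERIV_nonpos_imp_nonincreasing[OF that])
    fix x assume "r \<le> x" "x \<le> y"
    then show "\<exists>y. (h has_real_derivative y) (at x) \<and> y \<le> 0"
      using D[of x] assms by (intro exI conjI) (auto simp: mult_le_0_iff zero_le_mult_iff)
  qed
  moreover have "(h \<longlongrightarrow> 0 + Gamma p) at_top"
    unfolding h_def
  proof (intro tendsto_add incomplete_Gamma_tendsto_Gamma)
    show "((\<lambda>x. exp (- x) * (x powr (p - 1) + x powr (p - 2))) \<longlongrightarrow> 0) at_top"
      using assms by real_asymp
  qed (use assms in simp)
  ultimately have "0 + Gamma p \<le> h r"
    by (intro tendsto_upperbound[where f=h and F=at_top]) (auto simp: eventually_at_top_linorder)
  then show ?thesis by (simp add: h_def)
qed

lemma Gamma_le_incomplete_Gamma_add: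
  assumes p: "1 < p" "p \<le> 2" and "w > 0"
  shows "Gamma p \<le> exp w * (w powr (p - 2) - w powr (p - 1)) + incomplete_Gamma 1 p w"
proof -
  define h where "h x = exp x * (x powr (p - 2) - x powr (p - 1)) + incomplete_Gamma 1 p x" for x
  have D: "(h has_real_derivative (2 - p) * exp x * x powr (p - 3) * (x - 1)) (at x)" if "x > 0" for x
  proof -
    have "x powr (p - 2) = x powr (p - 3) * x"
      using that powr_add[of x "p - 3" 1] by simp
    then show ?thesis
      unfolding h_def[abs_def] using that p
      by (auto intro!: derivative_eq_intros DERIV_incomplete_Gamma simp: algebra_simps)
  qed
  have "h 1 \<le> h w"
  proof (cases "1 \<le> w")
    case True
    show ?thesis
    proof (rule DERIV_nonneg_imp_nondecreasing[where f=h, OF True])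
      fix x assume "1 \<le> x" "x \<le> w"
      then show "\<exists>y. (h has_real_derivative y) (at x) \<and> y \<ge> 0"
        using D[of x] p by (intro exI conjI) auto
    qed
  next
    case False
    show ?thesis
    proof (rule DERIV_nonpos_imp_nonincreasing[where f=h])
      show "w \<le> 1" using False by simp
      fix x assume "w \<le> x" "x \<le> 1"
      then show "\<exists>y. (h has_real_derivative y) (at x) \<and> y \<le> 0"
        using D[of x] p \<open>w > 0\<close> by (intro exI conjI) (auto intro!: mult_nonneg_nonpos)
    qed
  qed
  then show ?thesis
    using Gamma_le_1[of p] incomplete_Gamma_ge_1[of p] p by (simp add: h_def)
qed

lemma tangent_slope_minus_sgn_powr_le:
  assumes p: "1 < p" "p \<le> 2" and "r \<noteq> 0"
  shows "tangent_slope p r - sgn_powr (p - 1) r \<le> \<bar>r\<bar> powr (p - 2)"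
proof (cases "r > 0")
  case True
  have "exp r * (Gamma p - incomplete_Gamma (-1) p r) \<le> exp r * (exp (- r) * (r powr (p - 1) + r powr (p - 2)))"
    by (intro mult_left_mono upper_Gamma_le p True) simp
  also have "\<dots> = r powr (p - 1) + r powr (p - 2)" by (simp add: exp_minus)
  finally show ?thesis using True by (simp add: tangent_slope_def sgn_powr_nonneg_eq)
next
  case False
  define w where "w = - r"
  have "w > 0" using False \<open>r \<noteq> 0\<close> by (simp add: w_def)
  have "exp (- w) * (Gamma p - incomplete_Gamma 1 p w) \<le> exp (- w) * (exp w * (w powr (p - 2) - w powr (p - 1)))"
    using Gamma_le_incomplete_Gamma_add[OF p \<open>w > 0\<close>] by (intro mult_left_mono) auto
  also have "\<dots> = w powr (p - 2) - w powr (p - 1)" by (simp add: exp_minus)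
  finally show ?thesis using False by (simp add: tangent_slope_def sgn_powr_nonpos_eq w_def)
qed

text \<open>The first coordinate is scaled by \<open>\<xi>\<close>: \<open>(z, y)\<close> stands for \<open>z = \<langle>\<phi>\<rangle> / \<xi>\<close> and \<open>y = \<langle>exp \<phi>\<rangle>\<close>. The tangent to the
  upper boundary with parameter \<open>r\<close> meets the lower boundary at \<open>z = r\<close> and touches the upper one at \<open>z = r + 1\<close>.\<close>

locale bellman_planes =
  fixes p \<xi> :: real
  assumes p: "1 < p" "p \<le> 2" and \<xi>: "2 - p \<le> \<xi>" "0 < \<xi>" "\<xi> < 1"
begin

definition tangent_line :: "real \<Rightarrow> real \<Rightarrow> real" where
  "tangent_line r z = exp (\<xi> * r) * (1 + \<xi> * (z - r) / (1 - \<xi>))"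

definition exp_slope :: "real \<Rightarrow> real" where
  "exp_slope r = (1 - \<xi>) / \<xi>\<^sup>2 * (exp (- (\<xi> * r)) * (tangent_slope p r - sgn_powr (p - 1) r))"

definition support_plane :: "real \<Rightarrow> real \<Rightarrow> real \<Rightarrow> real" where
  "support_plane r z y =
     \<bar>r\<bar> powr p + p * tangent_slope p r * (z - r) + p * exp_slope r * (y - tangent_line r z)"

lemma continuous_on_exp_slope: "continuous_on S exp_slope"
  unfolding exp_slope_def[abs_def] using p
  by (intro continuous_intros continuous_on_tangent_slope continuous_on_sgn_powr) auto

lemma continuous_on_support_plane:
  assumes "continuous_on S r" "continuous_on S z" "continuous_on S y"
  shows "continuous_on S (\<lambda>x. support_plane (r x) (z x) (y x))"
  unfolding support_plane_def tangent_line_def using p \<xi>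
  by (intro continuous_intros continuous_on_powr' assms
      continuous_on_compose2[OF continuous_on_exp_slope[of UNIV]]
      continuous_on_compose2[OF continuous_on_tangent_slope[of p UNIV]]) auto

lemma support_plane_affine:
  "support_plane r z y = support_plane r 0 0 + (support_plane r 1 0 - support_plane r 0 0) * z + p * exp_slope r * y"
proof -
  define d where "d = \<xi> / (1 - \<xi>)"
  have d: "\<xi> * x / (1 - \<xi>) = d * x" for x by (simp add: d_def)
  show ?thesis unfolding support_plane_def tangent_line_def d by (simp add: algebra_simps)
qed

lemma tangent_line_touch: "tangent_line (z - 1) z = exp (- \<xi>) / (1 - \<xi>) * exp (\<xi> * z)"
  using \<xi> by (simp add: tangent_line_def algebra_simps exp_diff exp_minus field_simps)

lemma DERIV_exp_slope:
  assumes "r \<noteq> 0"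
  obtains D where "(exp_slope has_real_derivative D) (at r)" "D \<le> 0"
proof
  let ?gap = "(1 - \<xi>) * (tangent_slope p r - sgn_powr (p - 1) r) - (p - 1) * \<bar>r\<bar> powr (p - 2)"
  show "(exp_slope has_real_derivative (1 - \<xi>) / \<xi>\<^sup>2 * (exp (- (\<xi> * r)) * ?gap)) (at r)"
    unfolding exp_slope_def[abs_def] using assms p
    by (intro DERIV_cmult)
      (auto intro!: derivative_eq_intros DERIV_tangent_slope DERIV_sgn_powr simp: algebra_simps)
  have "(1 - \<xi>) * (tangent_slope p r - sgn_powr (p - 1) r) \<le> (1 - \<xi>) * \<bar>r\<bar> powr (p - 2)"
    using tangent_slope_minus_sgn_powr_le[OF p assms] \<xi> by (intro mult_left_mono) auto
  also have "\<dots> \<le> (p - 1) * \<bar>r\<bar> powr (p - 2)"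
    using \<xi> by (intro mult_right_mono) auto
  finally show "(1 - \<xi>) / \<xi>\<^sup>2 * (exp (- (\<xi> * r)) * ?gap) \<le> 0"
    using \<xi> by (intro mult_nonneg_nonpos) auto
qed

lemma exp_slope_antimono: "r \<le> s \<Longrightarrow> exp_slope s \<le> exp_slope r"
  by (rule DERIV_nonpos_off_zero_imp_nonincreasing[OF _ continuous_on_exp_slope])
     (use DERIV_exp_slope in blast)+

lemma DERIV_tangent_line:
  "((\<lambda>r. tangent_line r z) has_real_derivative exp (\<xi> * r) * (\<xi>\<^sup>2 / (1 - \<xi>)) * (z - r - 1)) (at r)"
proof -
  have "((\<lambda>r. tangent_line r z) has_real_derivative
      exp (\<xi> * r) * \<xi> * (1 + \<xi> * (z - r) / (1 - \<xi>)) + exp (\<xi> * r) * (- (\<xi> / (1 - \<xi>)))) (at r)"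
    unfolding tangent_line_def using \<xi> by (auto intro!: derivative_eq_intros)
  moreover have "\<xi> * (1 + \<xi> * (z - r) / (1 - \<xi>)) + - (\<xi> / (1 - \<xi>)) = \<xi>\<^sup>2 / (1 - \<xi>) * (z - r - 1)"
    using \<xi> by (simp add: divide_simps power2_eq_square) (simp add: algebra_simps)
  ultimately show ?thesis by (simp only: mult.assoc flip: distrib_left)
qed

lemma tangent_line_antimono:
  assumes "z - 1 \<le> r" "r \<le> s" shows "tangent_line s z \<le> tangent_line r z"
  using assms(2)
proof (rule DERIV_nonpos_imp_nonincreasing)
  fix x assume "r \<le> x" "x \<le> s"
  then show "\<exists>D. ((\<lambda>r. tangent_line r z) has_real_derivative D) (at x) \<and> D \<le> 0"
    using assms \<xi> by (intro exI[where x="exp (\<xi> * x) * (\<xi>\<^sup>2 / (1 - \<xi>)) * (z - x - 1)"] conjI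
        DERIV_tangent_line mult_nonneg_nonpos) auto
qed

text \<open>The envelope property: moving the point of tangency changes the plane only through \<open>exp_slope\<close>.\<close>

lemma DERIV_support_plane:
  assumes "r \<noteq> 0" and D: "(exp_slope has_real_derivative D) (at r)"
  shows "((\<lambda>r. support_plane r z y) has_real_derivative p * D * (y - tangent_line r z)) (at r)"
proof -
  let ?m = "tangent_slope p r" and ?s = "sgn_powr (p - 1) r"
  let ?l' = "exp (\<xi> * r) * (\<xi>\<^sup>2 / (1 - \<xi>)) * (z - r - 1)"
  have "((\<lambda>r. support_plane r z y) has_real_derivative
      p * ?s + (p * (?m - ?s) * (z - r) - p * ?m) + (p * D * (y - tangent_line r z) - p * exp_slope r * ?l')) (at r)"
    unfolding support_plane_def using assms p
    by (intro DERIV_add DERIV_abs_powr)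
      (auto intro!: derivative_eq_intros DERIV_tangent_slope DERIV_tangent_line D simp: algebra_simps)
  moreover have "exp_slope r * ?l' = (?m - ?s) * (z - r - 1)"
    using \<xi> by (simp add: exp_slope_def exp_minus field_simps)
  then have "p * exp_slope r * ?l' = p * ((?m - ?s) * (z - r - 1))" by (simp only: mult.assoc)
  then have "p * ?s + (p * (?m - ?s) * (z - r) - p * ?m) + (p * D * (y - tangent_line r z) - p * exp_slope r * ?l')
      = p * D * (y - tangent_line r z)"
    by (simp add: algebra_simps)
  ultimately show ?thesis by (simp only:)
qed

lemma support_plane_mono:
  assumes "r \<le> s" and y: "\<And>x. r < x \<Longrightarrow> x < s \<Longrightarrow> y \<le> tangent_line x z + \<kappa>"
  shows "support_plane r z y \<le> support_plane s z y + p * \<kappa> * (exp_slope r - exp_slope s)"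
proof -
  let ?g = "\<lambda>x. support_plane x z y - p * \<kappa> * exp_slope x"
  have "?g r \<le> ?g s"
  proof (rule DERIV_nonneg_off_zero_imp_nondecreasing[OF \<open>r \<le> s\<close>])
    show "continuous_on {r..s} ?g"
      by (intro continuous_intros continuous_on_support_plane continuous_on_exp_slope)
    fix x assume x: "r < x" "x < s" "x \<noteq> 0"
    obtain D where D: "(exp_slope has_real_derivative D) (at x)" "D \<le> 0"
      using DERIV_exp_slope[OF x(3)] .
    have "(?g has_real_derivative p * D * (y - tangent_line x z) - p * \<kappa> * D) (at x)"
      by (intro DERIV_diff DERIV_support_plane x D DERIV_cmult)
    moreover have "0 \<le> p * (D * (y - tangent_line x z - \<kappa>))"
      using D p y[OF x(1,2)] by (intro mult_nonneg_nonneg mult_nonpos_nonpos) auto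
    ultimately show "\<exists>D. (?g has_real_derivative D) (at x) \<and> 0 \<le> D"
      by (auto simp: algebra_simps)
  qed
  then show ?thesis by (simp add: algebra_simps)
qed

lemma support_plane_antimono:
  assumes "r \<le> s" and y: "\<And>x. r < x \<Longrightarrow> x < s \<Longrightarrow> tangent_line x z \<le> y"
  shows "support_plane s z y \<le> support_plane r z y"
proof (rule DERIV_nonpos_off_zero_imp_nonincreasing[OF \<open>r \<le> s\<close>])
  show "continuous_on {r..s} (\<lambda>x. support_plane x z y)"
    by (intro continuous_on_support_plane continuous_intros)
  fix x assume x: "r < x" "x < s" "x \<noteq> 0"
  obtain D where D: "(exp_slope has_real_derivative D) (at x)" "D \<le> 0"
    using DERIV_exp_slope[OF x(3)] .
  have "p * (D * (y - tangent_line x z)) \<le> 0"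
    using D p y[OF x(1,2)] by (intro mult_nonneg_nonpos mult_nonpos_nonneg) auto
  then show "\<exists>D. ((\<lambda>x. support_plane x z y) has_real_derivative D) (at x) \<and> D \<le> 0"
    using DERIV_support_plane[OF x(3) D(1)] by (auto simp: mult.assoc)
qed

lemma support_plane_le_lower_boundary:
  assumes "z \<le> r + 1"
  shows "support_plane r z (exp (\<xi> * z)) \<le> \<bar>z\<bar> powr p"
proof -
  have diag: "tangent_line z z = exp (\<xi> * z)" by (simp add: tangent_line_def)
  have "support_plane r z (exp (\<xi> * z)) \<le> support_plane z z (exp (\<xi> * z))"
  proof (cases "r \<le> z")
    case True
    have "exp (\<xi> * z) \<le> tangent_line x z + 0" if "r < x" "x < z" for x
      using tangent_line_antimono[of z x z] that assms by (simp add: diag)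
    from support_plane_mono[OF True this] show ?thesis by simp
  next
    case False
    show ?thesis
    proof (rule support_plane_antimono)
      show "tangent_line x z \<le> exp (\<xi> * z)" if "z < x" "x < r" for x
        using tangent_line_antimono[of z z x] that by (simp add: diag)
    qed (use False in simp)
  qed
  also have "\<dots> = \<bar>z\<bar> powr p" by (simp add: support_plane_def diag)
  finally show ?thesis .
qed

lemma tangent_line_gap_le:
  assumes "r \<le> s"
  shows "tangent_line r (r + 1) \<le> tangent_line s (r + 1) + exp (\<xi> * s) * (\<xi>\<^sup>2 / (1 - \<xi>)) * (s - r)\<^sup>2"
proof -
  define t where "t = \<xi> * (s - r)"
  have "t \<ge> 0" using assms \<xi> by (simp add: t_def)
  have "1 \<le> (1 + t) * (1 - t + t\<^sup>2)"
    using \<open>t \<ge> 0\<close> by (simp add: algebra_simps power2_eq_square)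
  also have "\<dots> \<le> exp t * (1 - t + t\<^sup>2)"
    using sum_power2_ge_zero[of "t - 1 / 2" 0]
    by (intro mult_right_mono exp_ge_add_one_self) (simp add: power2_eq_square algebra_simps)
  finally have "exp (\<xi> * r) / (1 - \<xi>) * 1 \<le> exp (\<xi> * r) / (1 - \<xi>) * (exp t * (1 - t + t\<^sup>2))"
    using \<xi> by (intro mult_left_mono) auto
  also have "\<dots> = exp (\<xi> * s) / (1 - \<xi>) * (1 - t + t\<^sup>2)"
    by (simp add: t_def algebra_simps flip: exp_add)
  also have "\<dots> = exp (\<xi> * s) / (1 - \<xi>) * (1 - t) + exp (\<xi> * s) * (\<xi>\<^sup>2 / (1 - \<xi>)) * (s - r)\<^sup>2"
    by (simp add: t_def power_mult_distrib distrib_left)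
  also have "exp (\<xi> * s) / (1 - \<xi>) * (1 - t) = tangent_line s (r + 1)"
    using \<xi> by (simp add: tangent_line_def t_def field_simps)
  also have "exp (\<xi> * r) / (1 - \<xi>) * 1 = tangent_line r (r + 1)"
    using \<xi> by (simp add: tangent_line_def field_simps)
  finally show ?thesis .
qed

lemma support_plane_shift_le:
  assumes "r \<le> s" "s \<le> R" and y: "y \<le> tangent_line r (r + 1)"
  shows "support_plane r (r + 1) y
    \<le> support_plane s (r + 1) y + p * (exp (\<xi> * R) * (\<xi>\<^sup>2 / (1 - \<xi>)) * (s - r)\<^sup>2) * (exp_slope r - exp_slope s)"
proof (rule support_plane_mono[OF \<open>r \<le> s\<close>])
  fix x assume "r < x" "x < s"
  note y
  also have "tangent_line r (r + 1) \<le> tangent_line s (r + 1) + exp (\<xi> * s) * (\<xi>\<^sup>2 / (1 - \<xi>)) * (s - r)\<^sup>2"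
    by (rule tangent_line_gap_le[OF \<open>r \<le> s\<close>])
  also have "\<dots> \<le> tangent_line x (r + 1) + exp (\<xi> * R) * (\<xi>\<^sup>2 / (1 - \<xi>)) * (s - r)\<^sup>2"
    using \<xi> \<open>r < x\<close> \<open>x < s\<close> \<open>s \<le> R\<close>
    by (intro add_mono mult_right_mono tangent_line_antimono) auto
  finally show "y \<le> tangent_line x (r + 1) + exp (\<xi> * R) * (\<xi>\<^sup>2 / (1 - \<xi>)) * (s - r)\<^sup>2" .
qed

end

lemma le_if_quadratic_increments:
  fixes K :: "real \<Rightarrow> real"
  assumes "a \<le> b" and K: "\<And>r s. a \<le> r \<Longrightarrow> r \<le> s \<Longrightarrow> s \<le> b \<Longrightarrow> K r \<le> K s + M * (s - r)\<^sup>2"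
  shows "K a \<le> K b"
proof -
  have "K a - K b \<le> M * (b - a)\<^sup>2 * inverse (real (Suc n))" for n
  proof -
    define h where "h = (b - a) / real (Suc n)"
    define t where "t i = a + real i * h" for i
    have h: "h \<ge> 0" "real (Suc n) * h = b - a" using \<open>a \<le> b\<close> by (auto simp: h_def)
    have "K (t i) - K (t (Suc i)) \<le> M * h\<^sup>2" if "i \<le> n" for i
    proof -
      have "real (Suc i) * h \<le> real (Suc n) * h" using that h(1) by (intro mult_right_mono) auto
      then have "t (Suc i) \<le> b" using h(2) by (simp add: t_def)
      moreover have "t (Suc i) - t i = h" by (simp add: t_def algebra_simps)
      ultimately show ?thesis using K[of "t i" "t (Suc i)"] h(1) by (simp add: t_def)
    qed
    then have "(\<Sum>i\<le>n. K (t i) - K (t (Suc i))) \<le> (\<Sum>i\<le>n. M * h\<^sup>2)" by (intro sum_mono) auto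
    moreover have "(\<Sum>i\<le>n. K (t i) - K (t (Suc i))) = K a - K b"
      using h(2) by (subst sum_telescope) (simp add: t_def)
    moreover have "(\<Sum>i\<le>n. M * h\<^sup>2) = M * (real (Suc n) * h) * h"
      by (simp add: power2_eq_square)
    moreover have "\<dots> = M * (b - a)\<^sup>2 * inverse (real (Suc n))"
      unfolding h(2) by (simp add: h_def power2_eq_square divide_inverse)
    ultimately show ?thesis by (simp only:)
  qed
  moreover have "(\<lambda>n. M * (b - a)\<^sup>2 * inverse (real (Suc n))) \<longlonglongrightarrow> M * (b - a)\<^sup>2 * 0"
    by (intro tendsto_intros LIMSEQ_inverse_real_of_nat)
  ultimately have "K a - K b \<le> M * (b - a)\<^sup>2 * 0"
    by (intro LIMSEQ_le_const) auto
  then show ?thesis by simp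
qed

lemma mean_final_lipschitz:
  assumes int: "\<And>u v. I integrable_on {u..v}" and bd: "\<And>x. \<bar>I x\<bar> \<le> M"
    and "r \<le> s" "s \<le> 1 - \<delta>" "\<delta> > 0"
  shows "mean s 1 I - mean r 1 I \<le> 2 * M / \<delta> * (s - r)"
proof -
  have "M \<ge> 0" using bd[of 0] by linarith
  have bounds: "- M \<le> I x" "I x \<le> M" for x using bd[of x] by auto
  have "mean r 1 I \<le> M" using assms bounds(2) by (intro mean_le_const int) auto
  have "integral {r..s} (\<lambda>_. - M) \<le> integral {r..s} I"
    by (rule integral_le) (use int bounds in auto)
  moreover have "(1 - s) * (mean s 1 I - mean r 1 I) = (s - r) * mean r 1 I - integral {r..s} I"
    using Henstock_Kurzweil_Integration.integral_combine[of r s 1 I] integral_eq_mean[of s 1 I]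
      integral_eq_mean[of r 1 I] assms
    by (simp add: algebra_simps)
  moreover have "(s - r) * mean r 1 I \<le> (s - r) * M"
    using \<open>mean r 1 I \<le> M\<close> \<open>r \<le> s\<close> by (intro mult_left_mono) auto
  ultimately have diff_le: "(1 - s) * (mean s 1 I - mean r 1 I) \<le> 2 * M * (s - r)"
    using \<open>r \<le> s\<close> by (simp add: algebra_simps)
  have "mean s 1 I - mean r 1 I \<le> 2 * M * (s - r) / (1 - s)"
    using diff_le assms by (simp add: pos_le_divide_eq mult.commute)
  also have "\<dots> \<le> 2 * M * (s - r) / \<delta>"
    using assms \<open>M \<ge> 0\<close> by (intro divide_left_mono) auto
  finally show ?thesis by simp
qed

context bellman_planes
begin

lemma support_plane_mean:
  assumes "a < b" "f integrable_on {a..b}" "(\<lambda>x. exp (\<xi> * f x)) integrable_on {a..b}"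
  shows "(\<lambda>x. support_plane r (f x) (exp (\<xi> * f x))) integrable_on {a..b}"
    and "mean a b (\<lambda>x. support_plane r (f x) (exp (\<xi> * f x)))
      = support_plane r (mean a b f) (mean a b (\<lambda>x. exp (\<xi> * f x)))"
proof -
  define A B C where "A = support_plane r 0 0" and "B = support_plane r 1 0 - A" and "C = p * exp_slope r"
  have plane: "support_plane r z y = A + B * z + C * y" for z y
    unfolding A_def B_def C_def by (rule support_plane_affine)
  note int = integrable_add[OF integrable_const_ivl integrable_on_mult_right[OF assms(2)]]
    integrable_on_mult_right[OF assms(3)]
  show "(\<lambda>x. support_plane r (f x) (exp (\<xi> * f x))) integrable_on {a..b}"
    unfolding plane by (intro integrable_add int)
  show "mean a b (\<lambda>x. support_plane r (f x) (exp (\<xi> * f x)))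
      = support_plane r (mean a b f) (mean a b (\<lambda>x. exp (\<xi> * f x)))"
    unfolding plane using assms int
    by (simp add: mean_add mean_cmult integrable_on_mult_right integrable_const_ivl)
qed

definition final_support :: "(real \<Rightarrow> real) \<Rightarrow> real \<Rightarrow> real" where
  "final_support I s = support_plane (mean s 1 I - 1) (mean s 1 I) (mean s 1 (\<lambda>x. exp (\<xi> * I x)))"

definition interpolated_support :: "(real \<Rightarrow> real) \<Rightarrow> real \<Rightarrow> real" where
  "interpolated_support I s = (1 - s) * final_support I s + integral {0..s} (\<lambda>x. \<bar>I x\<bar> powr p)"

context
  fixes I :: "real \<Rightarrow> real" and M :: real
  assumes mono: "mono I" and bd: "\<And>x. \<bar>I x\<bar> \<le> M"
    and below_tangent: "\<And>s. 0 \<le> s \<Longrightarrow> s < 1 \<Longrightarrow>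
      mean s 1 (\<lambda>x. exp (\<xi> * I x)) \<le> tangent_line (mean s 1 I - 1) (mean s 1 I)"
begin

lemma comp_integrable:
  fixes h :: "real \<Rightarrow> real"
  assumes "continuous_on UNIV h" shows "(\<lambda>x. h (I x)) integrable_on {a..b}"
proof -
  have "bounded (range I)" using bd by (auto simp: bounded_iff)
  then show ?thesis
    using bounded_measurable_on_compose_integrable[OF bounded_measurable_on_mono[OF mono]] assms by blast
qed

lemmas profile_integrable = comp_integrable[OF continuous_on_id]

lemma exp_integrable: "(\<lambda>x. exp (\<xi> * I x)) integrable_on {a..b}"
  by (rule comp_integrable) (intro continuous_intros)

lemma abs_powr_integrable: "(\<lambda>x. \<bar>I x\<bar> powr p) integrable_on {a..b}"
  using p by (intro comp_integrable[of "\<lambda>y. \<bar>y\<bar> powr p"] continuous_on_powr' continuous_intros) auto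

lemma final_mean_bounds:
  assumes "s < 1" shows "- M \<le> mean s 1 I" "mean s 1 I \<le> M"
  using assms bd by (auto intro!: mean_ge_const mean_le_const profile_integrable simp: abs_le_iff minus_le_iff)

lemma final_mean_mono: "r \<le> s \<Longrightarrow> s < 1 \<Longrightarrow> mean r 1 I \<le> mean s 1 I"
  by (rule mono_mean_final_mono[OF mono profile_integrable])

lemma support_plane_final_segment_le:
  assumes "r \<le> s" "s < 1" "v = mean s 1 I - 1"
  shows "(1 - r) * support_plane v (mean r 1 I) (mean r 1 (\<lambda>x. exp (\<xi> * I x)))
    \<le> integral {r..s} (\<lambda>x. \<bar>I x\<bar> powr p) + (1 - s) * support_plane v (mean s 1 I) (mean s 1 (\<lambda>x. exp (\<xi> * I x)))"
proof -
  let ?q = "\<lambda>x. support_plane v (I x) (exp (\<xi> * I x))"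
  have q: "?q integrable_on {a..b}" for a b
    by (intro comp_integrable[of "\<lambda>y. support_plane v y (exp (\<xi> * y))"] continuous_on_support_plane continuous_intros)
  have tail: "(1 - t) * support_plane v (mean t 1 I) (mean t 1 (\<lambda>x. exp (\<xi> * I x))) = integral {t..1} ?q"
    if "t < 1" for t
    using support_plane_mean(2)[OF that profile_integrable exp_integrable] that by (simp add: integral_eq_mean)
  have "I x \<le> v + 1" if "x \<in> {r..s}" for x
  proof -
    have "I x \<le> I s" using that monoD[OF mono] by simp
    also have "I s \<le> mean s 1 I"
      using monoD[OF mono] \<open>s < 1\<close> by (intro mean_ge_const profile_integrable) auto
    finally show ?thesis by (simp add: assms)
  qed
  then have "integral {r..s} ?q \<le> integral {r..s} (\<lambda>x. \<bar>I x\<bar> powr p)"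
    by (intro integral_le q abs_powr_integrable support_plane_le_lower_boundary)
  moreover have "integral {r..s} ?q + integral {s..1} ?q = integral {r..1} ?q"
    using assms by (intro Henstock_Kurzweil_Integration.integral_combine q) auto
  ultimately show ?thesis using tail[of r] tail[of s] assms by simp
qed

lemma final_support_shift_le:
  assumes "\<delta> > 0"
  obtains B where "B \<ge> 0" "\<And>r s. 0 \<le> r \<Longrightarrow> r \<le> s \<Longrightarrow> s \<le> 1 - \<delta> \<Longrightarrow>
    final_support I r \<le> support_plane (mean s 1 I - 1) (mean r 1 I) (mean r 1 (\<lambda>x. exp (\<xi> * I x))) + B * (s - r)\<^sup>2"
proof -
  define c where "c = exp (\<xi> * M) * (\<xi>\<^sup>2 / (1 - \<xi>))"
  define L where "L = 2 * M / \<delta>"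
  define V where "V = exp_slope (- M - 1) - exp_slope (M - 1)"
  have "M \<ge> 0" using bd[of 0] by linarith
  have c: "c \<ge> 0" using \<xi> by (simp add: c_def)
  have V: "V \<ge> 0" using exp_slope_antimono[of "- M - 1" "M - 1"] \<open>M \<ge> 0\<close> by (simp add: V_def)
  show ?thesis
  proof
    show "p * (c * L\<^sup>2) * V \<ge> 0" using p c V by simp
    fix r s assume rs: "0 \<le> r" "r \<le> s" "s \<le> 1 - \<delta>"
    define u v where "u = mean r 1 I - 1" and "v = mean s 1 I - 1"
    have uv: "u \<le> v" "v \<le> M - 1" "- M - 1 \<le> u"
      using final_mean_mono[of r s] final_mean_bounds[of s] final_mean_bounds[of r] rs \<open>\<delta> > 0\<close>
      by (auto simp: u_def v_def)
    have "(v - u)\<^sup>2 \<le> (L * (s - r))\<^sup>2"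
      using mean_final_lipschitz[OF profile_integrable bd rs(2,3) \<open>\<delta> > 0\<close>] uv(1)
      by (intro power_mono) (auto simp: u_def v_def L_def)
    then have sq: "c * (v - u)\<^sup>2 \<le> c * L\<^sup>2 * (s - r)\<^sup>2"
      using c by (simp add: mult_left_mono power_mult_distrib mult.assoc)
    have slope: "0 \<le> exp_slope u - exp_slope v" "exp_slope u - exp_slope v \<le> V"
      using exp_slope_antimono uv by (auto simp: V_def intro!: diff_mono)
    have "p * (c * (v - u)\<^sup>2) * (exp_slope u - exp_slope v) \<le> p * (c * L\<^sup>2 * (s - r)\<^sup>2) * V"
      using p c slope(1) by (intro mult_mono[OF mult_left_mono[OF sq] slope(2)]) auto
    moreover have "mean r 1 (\<lambda>x. exp (\<xi> * I x)) \<le> tangent_line u (u + 1)"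
      using below_tangent[of r] rs \<open>\<delta> > 0\<close> by (simp add: u_def)
    then have "support_plane u (u + 1) (mean r 1 (\<lambda>x. exp (\<xi> * I x)))
        \<le> support_plane v (u + 1) (mean r 1 (\<lambda>x. exp (\<xi> * I x))) + p * (c * (v - u)\<^sup>2) * (exp_slope u - exp_slope v)"
      unfolding c_def using uv by (intro support_plane_shift_le) auto
    ultimately show "final_support I r
        \<le> support_plane (mean s 1 I - 1) (mean r 1 I) (mean r 1 (\<lambda>x. exp (\<xi> * I x))) + p * (c * L\<^sup>2) * V * (s - r)\<^sup>2"
      by (simp add: final_support_def u_def v_def mult_ac)
  qed
qed

lemma final_support_bounded:
  obtains B where "\<And>s. 0 \<le> s \<Longrightarrow> s < 1 \<Longrightarrow> final_support I s \<le> B"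
proof -
  let ?S = "{- M..M} \<times> {0..exp (\<xi> * M)}"
  let ?f = "\<lambda>(z, y). support_plane (z - 1) z y"
  have "continuous_on ?S ?f"
    unfolding case_prod_unfold by (intro continuous_on_support_plane continuous_intros)
  then have "bounded (?f ` ?S)"
    by (intro compact_imp_bounded compact_continuous_image compact_Times) auto
  then obtain B where "\<forall>x\<in>?f ` ?S. \<bar>x\<bar> \<le> B" by (auto simp: bounded_iff)
  then have B: "support_plane (z - 1) z y \<le> B" if "z \<in> {- M..M}" "y \<in> {0..exp (\<xi> * M)}" for z y
    using that by (force simp: abs_le_iff)
  have "mean s 1 (\<lambda>x. exp (\<xi> * I x)) \<in> {0..exp (\<xi> * M)}" if "s < 1" for s
    using mean_ge_const[OF exp_integrable that, of 0] mean_le_const[OF exp_integrable that, of "exp (\<xi> * M)"]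
      that bd \<xi>
    by (auto simp: abs_le_iff)
  then show ?thesis
    using B final_mean_bounds by (intro that[of B]) (auto simp: final_support_def)
qed

lemma interpolated_support_increment:
  assumes "\<delta> > 0"
  obtains B where "\<And>r s. 0 \<le> r \<Longrightarrow> r \<le> s \<Longrightarrow> s \<le> 1 - \<delta> \<Longrightarrow>
    interpolated_support I r \<le> interpolated_support I s + B * (s - r)\<^sup>2"
proof -
  obtain B where "B \<ge> 0" and B: "\<And>r s. 0 \<le> r \<Longrightarrow> r \<le> s \<Longrightarrow> s \<le> 1 - \<delta> \<Longrightarrow>
      final_support I r \<le> support_plane (mean s 1 I - 1) (mean r 1 I) (mean r 1 (\<lambda>x. exp (\<xi> * I x))) + B * (s - r)\<^sup>2"
    using final_support_shift_le[OF \<open>\<delta> > 0\<close>] by blast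
  show ?thesis
  proof (rule that)
    fix r s assume rs: "0 \<le> r" "r \<le> s" "s \<le> 1 - \<delta>"
    then have "s < 1" using \<open>\<delta> > 0\<close> by simp
    let ?Q = "support_plane (mean s 1 I - 1) (mean r 1 I) (mean r 1 (\<lambda>x. exp (\<xi> * I x)))"
    have "(1 - r) * final_support I r \<le> (1 - r) * (?Q + B * (s - r)\<^sup>2)"
      using B[OF rs] rs \<open>s < 1\<close> by (intro mult_left_mono) auto
    also have "\<dots> \<le> integral {r..s} (\<lambda>x. \<bar>I x\<bar> powr p) + (1 - s) * final_support I s + (1 - r) * (B * (s - r)\<^sup>2)"
      using support_plane_final_segment_le[OF rs(2) \<open>s < 1\<close> refl] by (simp add: final_support_def distrib_left)
    also have "(1 - r) * (B * (s - r)\<^sup>2) \<le> B * (s - r)\<^sup>2"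
      using \<open>B \<ge> 0\<close> rs \<open>s < 1\<close> by (intro mult_left_le_one_le) auto
    finally show "interpolated_support I r \<le> interpolated_support I s + B * (s - r)\<^sup>2"
      using Henstock_Kurzweil_Integration.integral_combine[OF rs(1,2) abs_powr_integrable]
      by (simp add: interpolated_support_def)
  qed
qed

theorem support_plane_le_mean_abs_powr:
  "support_plane (mean 0 1 I - 1) (mean 0 1 I) (mean 0 1 (\<lambda>x. exp (\<xi> * I x))) \<le> mean 0 1 (\<lambda>x. \<bar>I x\<bar> powr p)"
proof -
  let ?K = "interpolated_support I" and ?F = "\<lambda>s. integral {0..s} (\<lambda>x. \<bar>I x\<bar> powr p)"
  obtain B where B: "\<And>s. 0 \<le> s \<Longrightarrow> s < 1 \<Longrightarrow> final_support I s \<le> B"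
    using final_support_bounded by blast
  have "?K 0 \<le> \<delta> * B + ?F 1" if \<delta>: "0 < \<delta>" "\<delta> < 1" for \<delta>
  proof -
    obtain B' where "\<And>r s. 0 \<le> r \<Longrightarrow> r \<le> s \<Longrightarrow> s \<le> 1 - \<delta> \<Longrightarrow> ?K r \<le> ?K s + B' * (s - r)\<^sup>2"
      using interpolated_support_increment[OF \<open>0 < \<delta>\<close>] by blast
    then have "?K 0 \<le> ?K (1 - \<delta>)"
      by (rule le_if_quadratic_increments[rotated]) (use \<delta> in auto)
    also have "\<dots> = \<delta> * final_support I (1 - \<delta>) + ?F (1 - \<delta>)"
      by (simp add: interpolated_support_def)
    also have "\<dots> \<le> \<delta> * B + ?F 1"
      using B[of "1 - \<delta>"] \<delta> by (intro add_mono mult_left_mono integral_subset_le abs_powr_integrable) auto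
    finally show ?thesis .
  qed
  then have "\<forall>\<^sub>F \<delta> in at_right 0. ?K 0 \<le> \<delta> * B + ?F 1"
    by (intro eventually_at_rightI[of 0 1]) auto
  moreover have "((\<lambda>\<delta>. \<delta> * B + ?F 1) \<longlongrightarrow> 0 * B + ?F 1) (at_right 0)"
    by (intro tendsto_intros)
  ultimately have "?K 0 \<le> 0 * B + ?F 1"
    by (intro tendsto_lowerbound[where F="at_right 0"]) auto
  then show ?thesis by (simp add: interpolated_support_def final_support_def mean_def)
qed

end

end

section \<open>The lower bound for the mean absolute value\<close>

text \<open>If \<open>exp (- w) = C * (1 - w)\<close>, the chord through \<open>(0, 1)\<close> and \<open>(w, 1 / (1 - w))\<close> is the tangent from
  \<open>(0, 1)\<close> to the upper boundary \<open>y = C * exp x\<close>, with point of tangency over \<open>w\<close>.\<close>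

definition exp_minus_chord :: "real \<Rightarrow> real \<Rightarrow> real" where
  "exp_minus_chord w z = exp z - 1 - z / (1 - w)"

lemma continuous_on_exp_minus_chord:
  "w < 1 \<Longrightarrow> continuous_on S (exp_minus_chord w)"
  unfolding exp_minus_chord_def[abs_def] by (intro continuous_intros) auto

lemma exp_minus_chord_nonpos:
  assumes "w < 1" "0 \<le> z \<and> z \<le> w \<or> w \<le> z \<and> z \<le> 0"
  shows "exp_minus_chord w z \<le> 0"
proof -
  have "z < 1" using assms by auto
  then have "exp z \<le> 1 / (1 - z)"
    using exp_ge_add_one_self[of "- z"] by (simp add: exp_minus field_simps)
  also have "\<dots> = 1 + z / (1 - z)" using \<open>z < 1\<close> by (simp add: field_simps)
  also have "z / (1 - z) \<le> z / (1 - w)"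
    using assms \<open>z < 1\<close> by (auto intro: divide_left_mono divide_left_mono_neg)
  finally show ?thesis by (simp add: exp_minus_chord_def)
qed

lemma integral_exp_minus_chord_nonpos:
  fixes f :: "real \<Rightarrow> real"
  assumes "c < d" and f: "f integrable_on {c..d}" "(\<lambda>t. exp (f t)) integrable_on {c..d}"
    and w: "w < 1" "exp (- w) = C * (1 - w)" and mean: "mean c d f = w" "mean c d (\<lambda>t. exp (f t)) \<le> C * exp w"
  shows "integral {c..d} (\<lambda>t. exp_minus_chord w (f t)) \<le> 0"
proof -
  have "1 / (1 - w) - 1 / (1 - w) * w = 1" using w by (simp add: field_simps)
  then have "mean c d (\<lambda>t. exp_minus_chord w (f t))
      = mean c d (\<lambda>t. exp (f t) - 1 / (1 - w) - 1 / (1 - w) * (f t - w))"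
    unfolding exp_minus_chord_def by (intro mean_cong) (simp add: right_diff_distrib)
  also have "\<dots> = mean c d (\<lambda>t. exp (f t)) - 1 / (1 - w)"
    using mean_affine_defect[OF \<open>c < d\<close> f, of "1 / (1 - w)" "1 / (1 - w)"] mean(1) by simp
  also have "C * exp w = 1 / (1 - w)" using w by (simp add: exp_minus field_simps)
  then have "mean c d (\<lambda>t. exp (f t)) - 1 / (1 - w) \<le> 0" using mean(2) by simp
  finally show ?thesis using \<open>c < d\<close> by (simp add: mean_def divide_le_0_iff)
qed

definition two_tangent_slope :: "real \<Rightarrow> real \<Rightarrow> real" where
  "two_tangent_slope x y = 2 * ((1 - y) * (1 - x) / (x - y))"

definition two_tangent_plane :: "real \<Rightarrow> real \<Rightarrow> real \<Rightarrow> real" where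
  "two_tangent_plane x y z = z + two_tangent_slope x y * exp_minus_chord x z"

lemma mean_two_tangent_plane:
  assumes "a < b" "f integrable_on {a..b}" "(\<lambda>t. exp (f t)) integrable_on {a..b}"
  shows "mean a b (\<lambda>t. two_tangent_plane x y (f t))
    = mean a b f + two_tangent_slope x y * (mean a b (\<lambda>t. exp (f t)) - 1 - mean a b f / (1 - x))"
proof -
  let ?\<beta> = "two_tangent_slope x y"
  have "two_tangent_plane x y z = (1 - ?\<beta> / (1 - x)) * z + (?\<beta> * exp z + - ?\<beta>)" for z
    by (simp add: two_tangent_plane_def exp_minus_chord_def algebra_simps)
  then have "mean a b (\<lambda>t. two_tangent_plane x y (f t))
      = (1 - ?\<beta> / (1 - x)) * mean a b f + (?\<beta> * mean a b (\<lambda>t. exp (f t)) + - ?\<beta>)"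
    using assms mean_add[OF integrable_on_mult_right[OF assms(2)]
        integrable_add[OF integrable_on_mult_right[OF assms(3)] integrable_const_ivl]]
    by (simp only: mean_cmult mean_affine)
  then show ?thesis by (simp add: algebra_simps)
qed

context
  fixes x y :: real
  assumes xy: "y < 0" "0 < x" "x < 1"
begin

lemma two_tangent_slope_nonneg: "0 \<le> two_tangent_slope x y"
  using xy by (simp add: two_tangent_slope_def)

lemma two_tangent_plane_eq: "two_tangent_plane x y z = - z + two_tangent_slope x y * exp_minus_chord y z"
proof -
  have "1 / (1 - x) - 1 / (1 - y) = (x - y) / ((1 - y) * (1 - x))"
    using xy by (simp add: field_simps)
  then have "two_tangent_slope x y * (1 / (1 - x) - 1 / (1 - y)) = 2"
    using xy by (simp add: two_tangent_slope_def)
  then have "two_tangent_slope x y * (1 / (1 - x) - 1 / (1 - y)) * z = 2 * z" by simp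
  then show ?thesis by (simp add: two_tangent_plane_def exp_minus_chord_def algebra_simps)
qed

lemma two_tangent_plane_le_abs:
  assumes "y \<le> z" "z \<le> x"
  shows "two_tangent_plane x y z \<le> \<bar>z\<bar>"
proof (cases "z \<ge> 0")
  case True
  then have "two_tangent_slope x y * exp_minus_chord x z \<le> 0"
    using assms xy by (intro mult_nonneg_nonpos two_tangent_slope_nonneg exp_minus_chord_nonpos) auto
  then show ?thesis using True by (simp add: two_tangent_plane_def)
next
  case False
  then have "two_tangent_slope x y * exp_minus_chord y z \<le> 0"
    using assms xy by (intro mult_nonneg_nonpos two_tangent_slope_nonneg exp_minus_chord_nonpos) auto
  then show ?thesis using False by (simp add: two_tangent_plane_eq)
qed

lemma two_tangent_plane_ge: "- \<bar>z\<bar> \<le> two_tangent_plane x y z"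
proof -
  define c where "c = (1 - y) * x / (x - y)"
  have slope: "two_tangent_slope x y * (1 - 1 / (1 - x)) = - (2 * c)"
    using xy by (simp add: two_tangent_slope_def c_def divide_simps)
  have "0 \<le> c" "c \<le> 1" using xy by (auto simp: c_def field_simps mult_le_cancel_left)
  then have "\<bar>1 - 2 * c\<bar> * \<bar>z\<bar> \<le> 1 * \<bar>z\<bar>" by (intro mult_right_mono) auto
  then have "- \<bar>z\<bar> \<le> (1 - 2 * c) * z"
    using abs_ge_minus_self[of "(1 - 2 * c) * z"] by (simp add: abs_mult)
  also have "\<dots> = z + two_tangent_slope x y * (1 - 1 / (1 - x)) * z"
    unfolding slope by (simp add: algebra_simps)
  also have "\<dots> = z + two_tangent_slope x y * (z - z / (1 - x))"
    by (simp add: algebra_simps)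
  also have "\<dots> \<le> z + two_tangent_slope x y * exp_minus_chord x z"
    using exp_ge_add_one_self[of z] unfolding exp_minus_chord_def
    by (intro add_left_mono mult_left_mono two_tangent_slope_nonneg) linarith
  finally show ?thesis by (simp add: two_tangent_plane_def)
qed

end

text \<open>If no final mean reaches \<open>x\<close>, the final segment is a single point.\<close>

lemma final_segment_of_mean:
  assumes "mono I" and int: "\<And>u v. I integrable_on {u..v}" and "mean 0 1 I \<le> x"
    and h: "\<And>t. 0 \<le> t \<Longrightarrow> t < 1 \<Longrightarrow> mean t 1 I = x \<Longrightarrow> integral {t..1} h \<le> 0"
  obtains t where "0 \<le> t" "t \<le> 1" "\<And>s. s < t \<Longrightarrow> I s \<le> x" "integral {t..1} h \<le> (0::real)"
proof (cases "\<exists>s. 0 \<le> s \<and> s < 1 \<and> x \<le> mean s 1 I")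
  case True
  then obtain s where s: "0 \<le> s" "s < 1" "x \<le> mean s 1 I" by blast
  have "continuous_on {0..s} (\<lambda>t. integral {t..1} I / (1 - t))"
    using s by (intro continuous_intros continuous_on_subset[OF indefinite_integral_continuous_1'[OF int]]) auto
  then obtain t where t: "0 \<le> t" "t \<le> s" "mean t 1 I = x"
    using IVT'[of "\<lambda>t. mean t 1 I" 0 x s] s assms(3) by (auto simp: mean_def)
  have "I u \<le> x" if "u < t" for u
    using t s that monoD[OF \<open>mono I\<close>] unfolding t(3)[symmetric] by (intro mean_ge_const int) auto
  then show ?thesis using t s h[of t] by (intro that[of t]) auto
next
  case False
  have "I s \<le> x" if "s < 1" for s
  proof -
    have "I s \<le> I (max s 0)" using monoD[OF \<open>mono I\<close>] by simp
    also have "\<dots> \<le> mean (max s 0) 1 I"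
      using monoD[OF \<open>mono I\<close>] that by (intro mean_ge_const int) auto
    finally show ?thesis using False that by (smt (verit) max.cobounded2 max_less_iff_conj zero_less_one)
  qed
  then show ?thesis by (intro that[of 1]) auto
qed

lemma initial_segment_of_mean:
  assumes "mono I" "bounded (range I)" and "y \<le> mean 0 1 I"
    and h: "\<And>t. 0 < t \<Longrightarrow> t \<le> 1 \<Longrightarrow> mean 0 t I = y \<Longrightarrow> integral {0..t} h \<le> 0"
  obtains t where "0 \<le> t" "t \<le> 1" "\<And>s. t < s \<Longrightarrow> y \<le> I s" "integral {0..t} h \<le> (0::real)"
proof (rule final_segment_of_mean)
  let ?J = "\<lambda>t. - I (1 - t)"
  show "mono ?J" by (rule mono_reflect[OF \<open>mono I\<close>])
  show "?J integrable_on {u..v}" for u v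
    using bounded_measurable_on_mono[OF mono_reflect[OF assms(1)] bounded_range_reflect[OF assms(2)]]
    by (intro bounded_measurable_on_imp_integrable) auto
  have mean_J: "mean t 1 ?J = - mean 0 (1 - t) I" for t
    using mean_reflect[of 1 "1 - t" 0 I] mean_cmult[of t 1 "- 1" "\<lambda>t. I (1 - t)"] by simp
  have reflect: "integral {t..1} (\<lambda>t. h (1 - t)) = integral {0..1 - t} h" for t
    using integral_reflect_shift[of 1 "1 - t" 0 h] by simp
  show "mean 0 1 ?J \<le> - y" using mean_J[of 0] assms(3) by simp
  show "integral {t..1} (\<lambda>t. h (1 - t)) \<le> 0" if "0 \<le> t" "t < 1" "mean t 1 ?J = - y" for t
    using that h[of "1 - t"] mean_J[of t] by (simp add: reflect)
  fix t assume t: "0 \<le> t" "t \<le> 1" "\<And>s. s < t \<Longrightarrow> ?J s \<le> - y" "integral {t..1} (\<lambda>t. h (1 - t)) \<le> 0"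
  show thesis
  proof (rule that[of "1 - t"])
    show "y \<le> I s" if "1 - t < s" for s using t(3)[of "1 - s"] that by simp
  qed (use t reflect in auto)
qed

lemma integral_le_integral_abs_two_segments:
  fixes F f :: "real \<Rightarrow> real"
  assumes F: "\<And>u v. F integrable_on {u..v}" and f: "\<And>u v. f integrable_on {u..v}"
    and abs_f: "\<And>u v. (\<lambda>t. \<bar>f t\<bar>) integrable_on {u..v}"
    and l: "0 \<le> l" "l \<le> 1" "integral {0..l} F \<le> - integral {0..l} f"
    and r: "0 \<le> r" "r \<le> 1" "integral {r..1} F \<le> integral {r..1} f"
    and middle: "\<And>t. l < t \<Longrightarrow> t < r \<Longrightarrow> F t \<le> \<bar>f t\<bar>" and ge: "\<And>t. - \<bar>f t\<bar> \<le> F t"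
  shows "integral {0..1} F \<le> integral {0..1} (\<lambda>t. \<bar>f t\<bar>)"
proof -
  have combine: "integral {u..v} g + integral {v..w} g = integral {u..w} g"
    if "u \<le> v" "v \<le> w" "\<And>u v. g integrable_on {u..v}" for u v w and g :: "real \<Rightarrow> real"
    using that by (intro Henstock_Kurzweil_Integration.integral_combine)
  have abs_ge: "\<bar>integral {u..v} f\<bar> \<le> integral {u..v} (\<lambda>t. \<bar>f t\<bar>)" for u v
    using integral_norm_bound_integral[OF f abs_f, of u v] by simp
  show ?thesis
  proof (cases "l \<le> r")
    case True
    have "integral {l..r} F = integral {l<..<r} F" using integral_open_interval_real by metis
    also have "\<dots> \<le> integral {l<..<r} (\<lambda>t. \<bar>f t\<bar>)"
      using middle F abs_f by (intro integral_le) (auto simp: integrable_on_open_interval_real)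
    also have "\<dots> = integral {l..r} (\<lambda>t. \<bar>f t\<bar>)" using integral_open_interval_real by metis
    finally show ?thesis
      using combine[OF _ _ F, of 0 l 1] combine[OF _ _ F, of l r 1] combine[OF _ _ abs_f, of 0 l 1]
        combine[OF _ _ abs_f, of l r 1] abs_ge[of r 1] abs_ge[of 0 l] l r True by linarith
  next
    case False
    have "integral {r..l} (\<lambda>t. - \<bar>f t\<bar>) \<le> integral {r..l} F"
      by (intro integral_le integrable_neg abs_f F ge)
    then show ?thesis
      using combine[OF _ _ F, of 0 r 1] combine[OF _ _ F, of 0 r l] combine[OF _ _ F, of r l 1]
        combine[OF _ _ abs_f, of 0 r 1] combine[OF _ _ abs_f, of r l 1] combine[OF _ _ f, of 0 r l]
        combine[OF _ _ f, of r l 1] abs_ge[of l 1] abs_ge[of 0 r] l r False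
      unfolding integral_neg by linarith
  qed
qed

theorem mean_abs_ge_two_tangent_slope:
  assumes "mono I" "bounded (range I)"
    and x: "0 < x" "x < 1" "exp (- x) = C * (1 - x)" and y: "y < 0" "exp (- y) = C * (1 - y)"
    and final: "\<And>s. 0 \<le> s \<Longrightarrow> s < 1 \<Longrightarrow> mean s 1 (\<lambda>t. exp (I t)) \<le> C * exp (mean s 1 I)"
    and initial: "\<And>s. 0 < s \<Longrightarrow> s \<le> 1 \<Longrightarrow> mean 0 s (\<lambda>t. exp (I t)) \<le> C * exp (mean 0 s I)"
    and zero: "mean 0 1 I = 0"
  shows "two_tangent_slope x y * (mean 0 1 (\<lambda>t. exp (I t)) - 1) \<le> mean 0 1 (\<lambda>t. \<bar>I t\<bar>)"
proof -
  let ?P = "two_tangent_plane x y" and ?\<beta> = "two_tangent_slope x y"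
  have int: "(\<lambda>t. h (I t)) integrable_on {u..v}" if "continuous_on UNIV h" for h :: "real \<Rightarrow> real" and u v
    using bounded_measurable_on_compose_integrable[OF bounded_measurable_on_mono] assms(1,2) that by blast
  note I_int = int[OF continuous_on_id] and exp_int = int[OF continuous_on_exp[OF continuous_on_id]]
  have chord_int: "(\<lambda>t. ?\<beta> * exp_minus_chord w (I t)) integrable_on {u..v}" if "w < 1" for w u v
    by (rule integrable_on_mult_right[OF int[OF continuous_on_exp_minus_chord[OF that]]])
  have xy: "y < 0" "0 < x" "x < 1" and "y < 1" using x y by auto
  note P_right = two_tangent_plane_def
    and P_left = two_tangent_plane_eq[OF xy]
    and \<beta> = two_tangent_slope_nonneg[OF xy]
  have P_int: "(\<lambda>t. ?P (I t)) integrable_on {u..v}" for u v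
    unfolding P_right using x by (intro integrable_add I_int chord_int)
  obtain r where r: "0 \<le> r" "r \<le> 1" "\<And>s. s < r \<Longrightarrow> I s \<le> x" "integral {r..1} (\<lambda>t. exp_minus_chord x (I t)) \<le> 0"
  proof (rule final_segment_of_mean[OF \<open>mono I\<close> I_int])
    show "mean 0 1 I \<le> x" using zero x by simp
    show "integral {t..1} (\<lambda>t. exp_minus_chord x (I t)) \<le> 0" if "0 \<le> t" "t < 1" "mean t 1 I = x" for t
      using that final[of t] x by (intro integral_exp_minus_chord_nonpos I_int exp_int) auto
  qed (rule that)
  obtain l where l: "0 \<le> l" "l \<le> 1" "\<And>s. l < s \<Longrightarrow> y \<le> I s" "integral {0..l} (\<lambda>t. exp_minus_chord y (I t)) \<le> 0"
  proof (rule initial_segment_of_mean[OF \<open>mono I\<close> \<open>bounded (range I)\<close>])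
    show "y \<le> mean 0 1 I" using zero y by simp
    show "integral {0..t} (\<lambda>t. exp_minus_chord y (I t)) \<le> 0" if "0 < t" "t \<le> 1" "mean 0 t I = y" for t
      using that initial[of t] y by (intro integral_exp_minus_chord_nonpos I_int exp_int) auto
  qed (rule that)
  have "integral {0..1} (\<lambda>t. ?P (I t)) \<le> integral {0..1} (\<lambda>t. \<bar>I t\<bar>)"
  proof (rule integral_le_integral_abs_two_segments[OF P_int I_int int l(1,2) _ r(1,2)])
    show "integral {0..l} (\<lambda>t. ?P (I t)) \<le> - integral {0..l} I"
      unfolding P_left using integral_add[OF integrable_neg[OF I_int] chord_int[OF \<open>y < 1\<close>], of 0 l] l(4) \<beta>
      by (simp add: mult_nonneg_nonpos)
    show "integral {r..1} (\<lambda>t. ?P (I t)) \<le> integral {r..1} I"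
      unfolding P_right using integral_add[OF I_int chord_int[OF \<open>x < 1\<close>], of r 1] r(4) \<beta>
      by (simp add: mult_nonneg_nonpos)
    show "?P (I t) \<le> \<bar>I t\<bar>" if "l < t" "t < r" for t
      using two_tangent_plane_le_abs[OF xy] l(3) r(3) that by blast
    show "- \<bar>I t\<bar> \<le> ?P (I t)" for t
      by (rule two_tangent_plane_ge[OF xy])
  qed (intro continuous_intros)
  moreover have "mean 0 1 (\<lambda>t. ?P (I t)) = ?\<beta> * (mean 0 1 (\<lambda>t. exp (I t)) - 1)"
    using mean_two_tangent_plane[OF _ I_int exp_int] zero by simp
  ultimately show ?thesis by (simp add: mean_def)
qed

section \<open>Averages over subintervals\<close>

lemma subintervalsD:
  assumes "J \<in> subintervals Q"
  shows "J \<in> sets lebesgue" "Inf J < Sup J" "{Inf J<..<Sup J} \<subseteq> J" "J \<subseteq> {Inf J..Sup J}" "J \<subseteq> Q"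
proof -
  have J: "is_interval J" "bounded J" "interior J \<noteq> {}" "J \<subseteq> Q"
    using assms by (auto simp: subintervals_def)
  then have "J \<noteq> {}" using interior_subset by blast
  note sub = is_interval_Inf_Sup[OF J(1,2) \<open>J \<noteq> {}\<close>]
  show "J \<in> sets lebesgue"
    using J by (intro fmeasurableD measurable_convex is_interval_convex)
  show "{Inf J<..<Sup J} \<subseteq> J" "J \<subseteq> {Inf J..Sup J}" "J \<subseteq> Q"
    by (fact sub J)+
  show "Inf J < Sup J"
  proof (rule ccontr)
    assume "\<not> Inf J < Sup J"
    then have "interior {Inf J..Sup J} = {}" by (simp add: interior_atLeastAtMost_real)
    then show False using interior_mono[OF sub(2)] J(3) by blast
  qed
qed

lemma Ioo_in_subintervals: "u \<le> a \<Longrightarrow> a < b \<Longrightarrow> b \<le> v \<Longrightarrow> {a<..<b::real} \<in> subintervals {u<..<v}"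
  by (auto simp: subintervals_def is_interval_1)

lemma subintervals_Ioo_bounds:
  assumes "J \<in> subintervals {u<..<v}"
  shows "u \<le> Inf J" "Sup J \<le> v"
proof -
  have "{Inf J<..<Sup J} \<subseteq> {u<..<v}" using subintervalsD(3,5)[OF assms] by blast
  then show "u \<le> Inf J" "Sup J \<le> v"
    using subintervalsD(2)[OF assms] by (simp_all add: greaterThanLessThan_subseteq_greaterThanLessThan)
qed

lemma subinterval_symdiff: "J \<in> subintervals Q \<Longrightarrow> sym_diff J {Inf J<..<Sup J} \<subseteq> {Inf J, Sup J}"
  using subintervalsD(3,4)[of J Q] by force

lemma avg_subinterval:
  assumes "J \<in> subintervals Q"
  shows "avg J f = avg {Inf J<..<Sup J} f"
proof -
  have "measure lebesgue J = measure lebesgue {Inf J<..<Sup J}"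
    using negligible_subset[OF _ subinterval_symdiff[OF assms]]
    by (intro measure_negligible_symdiff) (auto simp: Un_commute)
  moreover have "(LINT x:J|lebesgue. f x) = (LINT x:{Inf J<..<Sup J}|lebesgue. f x)"
    by (rule set_integral_discrete_difference[OF _ subinterval_symdiff[OF assms]]) auto
  ultimately show ?thesis by (simp add: avg_def)
qed

lemma nnavg_subinterval:
  assumes "J \<in> subintervals Q"
  shows "nnavg J f = nnavg {Inf J<..<Sup J} f"
proof -
  have "sym_diff J {Inf J<..<Sup J} \<in> null_sets lebesgue"
    using negligible_subset[OF _ subinterval_symdiff[OF assms]] by (simp add: negligible_iff_null_sets)
  then have eq: "set_nn_integral lebesgue J g = set_nn_integral lebesgue {Inf J<..<Sup J} g" for g
    using subintervalsD(1)[OF assms] by (intro nn_integral_null_delta) auto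
  moreover have "emeasure lebesgue J = emeasure lebesgue {Inf J<..<Sup J}"
    using eq[of "\<lambda>_. 1"] subintervalsD(1)[OF assms] by simp
  ultimately show ?thesis by (simp add: nnavg_def)
qed

lemma avg_Ioo_eq_mean:
  assumes "f absolutely_integrable_on {a<..<b}" "a < b"
  shows "avg {a<..<b} f = mean a b f"
  using assms set_lebesgue_integral_eq_integral(2)[OF assms(1)] integral_open_interval_real[of a b f]
  by (simp add: avg_def mean_def)

lemma nnavg_Ioo_eq_mean:
  assumes f: "f absolutely_integrable_on {a<..<b}" "a < b" and nonneg: "\<And>x. x \<in> {a<..<b} \<Longrightarrow> 0 \<le> f x"
  shows "nnavg {a<..<b} f = ennreal (mean a b f)"
proof -
  have "(\<integral>\<^sup>+x\<in>{a<..<b}. ennreal (f x) \<partial>lebesgue) = (\<integral>\<^sup>+x. ennreal (indicator {a<..<b} x * f x) \<partial>lebesgue)"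
    by (intro nn_integral_cong) (simp add: indicator_def)
  also have "\<dots> = ennreal (LINT x:{a<..<b}|lebesgue. f x)"
    using f(1) nonneg unfolding set_lebesgue_integral_def set_integrable_def
    by (subst nn_integral_eq_integral) (auto simp: indicator_def)
  also have "(LINT x:{a<..<b}|lebesgue. f x) = (b - a) * mean a b f"
    using avg_Ioo_eq_mean[OF f] f(2) by (simp add: avg_def field_simps)
  finally have "nnavg {a<..<b} f = ennreal ((b - a) * mean a b f) / ennreal (b - a)"
    using \<open>a < b\<close> by (simp add: nnavg_def)
  also have "\<dots> = ennreal (mean a b f)"
    using \<open>a < b\<close> by (simp add: ennreal_mult'  ennreal_mult_divide_eq mult.commute[of "ennreal (b - a)"])
  finally show ?thesis .
qed

lemma epowr_le_iff:
  assumes p: "p > 0" and r: "r \<ge> 0"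
  shows "epowr x (1 / p) \<le> ennreal r \<longleftrightarrow> x \<le> ennreal (r powr p)"
proof (cases "x = \<infinity>")
  case False
  then obtain t where t: "x = ennreal t" "t \<ge> 0" by (cases x) auto
  have "t powr (1 / p) \<le> r \<longleftrightarrow> (t powr (1 / p)) powr p \<le> r powr p"
    using p r by (metis powr_ge_zero powr_less_mono2 powr_mono2 less_imp_le not_less)
  also have "(t powr (1 / p)) powr p = t" using p t by (simp add: powr_powr)
  finally show ?thesis using t r by (simp add: epowr_def)
qed (simp add: epowr_def top_unique)

lemma bmo_norm_le_iff:
  assumes "p > 0" "\<epsilon> \<ge> 0"
  shows "bmo_norm p {u<..<v} \<phi> \<le> ennreal \<epsilon> \<longleftrightarrow>
    (\<forall>a b. u \<le> a \<longrightarrow> a < b \<longrightarrow> b \<le> v \<longrightarrow>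
      nnavg {a<..<b} (\<lambda>x. \<bar>\<phi> x - avg {a<..<b} \<phi>\<bar> powr p) \<le> ennreal (\<epsilon> powr p))" (is "_ \<longleftrightarrow> ?R")
proof -
  have "bmo_norm p {u<..<v} \<phi> \<le> ennreal \<epsilon> \<longleftrightarrow>
      (\<forall>J\<in>subintervals {u<..<v}. nnavg J (\<lambda>x. \<bar>\<phi> x - avg J \<phi>\<bar> powr p) \<le> ennreal (\<epsilon> powr p))" (is "_ \<longleftrightarrow> ?L")
    unfolding bmo_norm_def SUP_le_iff using epowr_le_iff[OF assms] by simp
  also have "?L \<longleftrightarrow> ?R"
  proof
    assume ?R
    show ?L
    proof
      fix J assume J: "J \<in> subintervals {u<..<v}"
      show "nnavg J (\<lambda>x. \<bar>\<phi> x - avg J \<phi>\<bar> powr p) \<le> ennreal (\<epsilon> powr p)"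
        unfolding nnavg_subinterval[OF J] avg_subinterval[OF J]
        using \<open>?R\<close> subintervals_Ioo_bounds[OF J] subintervalsD(2)[OF J] by blast
    qed
  qed (use Ioo_in_subintervals in blast)
  finally show ?thesis .
qed

lemma jn_admissible_iff:
  "jn_admissible \<epsilon> p C \<longleftrightarrow>
    (\<forall>\<phi>\<in>bmo p {0<..<1}. bmo_norm p {0<..<1} \<phi> \<le> ennreal \<epsilon> \<longrightarrow>
      (\<forall>a b. 0 \<le> a \<longrightarrow> a < b \<longrightarrow> b \<le> 1 \<longrightarrow>
        nnavg {a<..<b} (\<lambda>x. exp (\<phi> x)) \<le> C * ennreal (exp (avg {a<..<b} \<phi>))))"
  (is "_ \<longleftrightarrow> ?R")
proof
  assume ?R
  show "jn_admissible \<epsilon> p C"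
    unfolding jn_admissible_def
  proof (intro ballI impI)
    fix \<phi> J
    assume \<phi>: "\<phi> \<in> bmo p {0<..<1}" "bmo_norm p {0<..<1} \<phi> \<le> ennreal \<epsilon>" and J: "J \<in> subintervals {0<..<1}"
    show "nnavg J (\<lambda>x. exp (\<phi> x)) \<le> C * ennreal (exp (avg J \<phi>))"
      unfolding nnavg_subinterval[OF J] avg_subinterval[OF J]
      using \<open>?R\<close> \<phi> subintervals_Ioo_bounds[OF J] subintervalsD(2)[OF J] by blast
  qed
qed (use Ioo_in_subintervals in \<open>auto simp: jn_admissible_def\<close>)

section \<open>Comparison of centered means\<close>

lemma mono_sgn_powr:
  assumes "a \<ge> 0" shows "mono (sgn_powr a)"
proof (rule monoI)
  fix x y :: real assume "x \<le> y"
  then show "sgn_powr a x \<le> sgn_powr a y"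
    using powr_mono2[OF assms, of x y] powr_mono2[OF assms, of "- y" "- x"]
      powr_ge_zero[of "- x" a] powr_ge_zero[of y a]
    by (auto simp: sgn_powr_def sgn_if abs_if simp del: powr_ge_zero)
qed

lemma abs_powr_above_tangent:
  fixes a b p :: real
  assumes "p \<ge> 1"
  shows "\<bar>b\<bar> powr p + p * sgn_powr (p - 1) b * (a - b) \<le> \<bar>a\<bar> powr p"
proof -
  have Young: "p * (\<bar>a\<bar> * \<bar>b\<bar> powr (p - 1)) \<le> \<bar>a\<bar> powr p + (p - 1) * \<bar>b\<bar> powr p"
  proof (cases "p = 1")
    case False
    then have "\<bar>a\<bar> * \<bar>b\<bar> powr (p - 1) \<le> \<bar>a\<bar> powr p / p + (\<bar>b\<bar> powr (p - 1)) powr (p / (p - 1)) / (p / (p - 1))"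
      using assms by (intro Youngs_inequality) (auto simp: field_simps)
    then have "p * (\<bar>a\<bar> * \<bar>b\<bar> powr (p - 1)) \<le> p * (\<bar>a\<bar> powr p / p + \<bar>b\<bar> powr p / (p / (p - 1)))"
      using assms False by (intro mult_left_mono) (auto simp: powr_powr)
    also have "\<dots> = \<bar>a\<bar> powr p + (p - 1) * \<bar>b\<bar> powr p"
      using assms by (simp add: distrib_left)
    finally show ?thesis .
  qed simp
  have "\<bar>b\<bar> powr p = \<bar>b\<bar> powr (p - 1) * \<bar>b\<bar>"
    using powr_add[of "\<bar>b\<bar>" "p - 1" 1] by simp
  then have "sgn_powr (p - 1) b * (a - b) = \<bar>b\<bar> powr (p - 1) * (sgn b * a) - \<bar>b\<bar> powr p"
    by (simp add: sgn_powr_def algebra_simps abs_sgn)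
  also have "\<dots> \<le> \<bar>b\<bar> powr (p - 1) * \<bar>a\<bar> - \<bar>b\<bar> powr p"
    by (intro diff_right_mono mult_left_mono) (auto simp: sgn_if)
  finally have "p * (sgn_powr (p - 1) b * (a - b)) \<le> p * (\<bar>b\<bar> powr (p - 1) * \<bar>a\<bar> - \<bar>b\<bar> powr p)"
    using assms by (intro mult_left_mono) auto
  with Young show ?thesis by (simp add: algebra_simps)
qed

definition comonotone_on :: "'a set \<Rightarrow> ('a \<Rightarrow> real) \<Rightarrow> ('a \<Rightarrow> real) \<Rightarrow> bool" where
  "comonotone_on S f g \<longleftrightarrow> (\<forall>x\<in>S. \<forall>y\<in>S. 0 \<le> (f x - f y) * (g x - g y))"

lemma comonotone_crossing:
  assumes d: "integrable M d" "integral\<^sup>L M d = 0" and com: "comonotone_on (space M) g d"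
  obtains y where "AE x in M. 0 \<le> (g x - y) * d x"
proof -
  consider "\<And>x. x \<in> space M \<Longrightarrow> 0 \<le> d x" | "\<And>x. x \<in> space M \<Longrightarrow> d x \<le> 0"
    | u v where "u \<in> space M" "d u < 0" "v \<in> space M" "0 < d v"
    by (meson not_less)
  then show ?thesis
  proof cases
    case 1
    then have "AE x in M. d x = 0" using d by (subst integral_nonneg_eq_0_iff_AE[symmetric]) auto
    then show ?thesis by (intro that[of 0]) auto
  next
    case 2
    then have "AE x in M. - d x = 0" using d by (subst integral_nonneg_eq_0_iff_AE[symmetric]) auto
    then show ?thesis by (intro that[of 0]) auto
  next
    case 3
    define N where "N = {x \<in> space M. d x < 0}"
    have g_le: "g x \<le> g x'" if "x \<in> N" "x' \<in> space M" "0 < d x'" for x x'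
    proof -
      have "0 \<le> (g x' - g x) * (d x' - d x)" "0 < d x' - d x"
        using com that by (auto simp: comonotone_on_def N_def)
      then show ?thesis by (simp add: zero_le_mult_iff)
    qed
    have "bdd_above (g ` N)" using g_le[OF _ 3(3,4)] by (intro bdd_aboveI[of _ "g v"]) auto
    have "u \<in> N" using 3 by (simp add: N_def)
    show ?thesis
    proof (rule that[of "Sup (g ` N)"], rule AE_I2)
      fix x assume x: "x \<in> space M"
      have "g x \<le> Sup (g ` N)" if "d x < 0"
        using that x \<open>bdd_above (g ` N)\<close> by (intro cSup_upper) (auto simp: N_def)
      moreover have "Sup (g ` N) \<le> g x" if "0 < d x"
        using that x \<open>u \<in> N\<close> by (intro cSup_least) (auto intro: g_le)
      ultimately show "0 \<le> (g x - Sup (g ` N)) * d x"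
        by (cases "d x" "0::real" rule: linorder_cases) (auto simp: zero_le_mult_iff)
    qed
  qed
qed

text \<open>Comonotonicity makes \<open>f\<close> a spread of \<open>g\<close>, so that \<open>f\<close> dominates \<open>g\<close> in the convex order.\<close>

lemma nn_integral_abs_powr_le_comonotone:
  fixes f g :: "'a \<Rightarrow> real"
  assumes p: "p \<ge> 1" and f: "integrable M f" and g: "integrable M g" and eq: "integral\<^sup>L M f = integral\<^sup>L M g"
    and com: "comonotone_on (space M) g (\<lambda>x. f x - g x)"
  shows "(\<integral>\<^sup>+x. ennreal (\<bar>g x\<bar> powr p) \<partial>M) \<le> (\<integral>\<^sup>+x. ennreal (\<bar>f x\<bar> powr p) \<partial>M)"
proof (cases "(\<integral>\<^sup>+x. ennreal (\<bar>f x\<bar> powr p) \<partial>M) = \<infinity>")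
  case False
  have [measurable]: "f \<in> borel_measurable M" "g \<in> borel_measurable M" using f g by auto
  have diff: "integrable M (\<lambda>x. f x - g x)" "integral\<^sup>L M (\<lambda>x. f x - g x) = 0" using f g eq by auto
  obtain y where y: "AE x in M. 0 \<le> (g x - y) * (f x - g x)"
    using comonotone_crossing[OF diff com] .
  define s where "s = p * sgn_powr (p - 1) y"
  have below_tangent: "AE x in M. \<bar>g x\<bar> powr p \<le> \<bar>f x\<bar> powr p - s * (f x - g x)"
    using y
  proof eventually_elim
    fix x assume "0 \<le> (g x - y) * (f x - g x)"
    then have "0 \<le> (sgn_powr (p - 1) (g x) - sgn_powr (p - 1) y) * (f x - g x)"
      using monoD[OF mono_sgn_powr[of "p - 1"], of "g x" y] monoD[OF mono_sgn_powr[of "p - 1"], of y "g x"] p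
      by (cases "g x = y") (auto simp: zero_le_mult_iff)
    then have "0 \<le> p * ((sgn_powr (p - 1) (g x) - sgn_powr (p - 1) y) * (f x - g x))"
      using p by (simp add: zero_le_mult_iff)
    then show "\<bar>g x\<bar> powr p \<le> \<bar>f x\<bar> powr p - s * (f x - g x)"
      using abs_powr_above_tangent[OF p, of "g x" "f x"] by (simp add: s_def algebra_simps)
  qed
  have f_powr: "integrable M (\<lambda>x. \<bar>f x\<bar> powr p)"
    using False by (intro integrableI_nonneg) (auto simp: less_top)
  have nonneg: "AE x in M. 0 \<le> \<bar>f x\<bar> powr p - s * (f x - g x)"
    using below_tangent by eventually_elim (meson order_trans powr_ge_zero)
  have "(\<integral>\<^sup>+x. ennreal (\<bar>g x\<bar> powr p) \<partial>M) \<le> (\<integral>\<^sup>+x. ennreal (\<bar>f x\<bar> powr p - s * (f x - g x)) \<partial>M)"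
    using below_tangent by (intro nn_integral_mono_AE) (auto intro: ennreal_leI)
  also have "\<dots> = ennreal (integral\<^sup>L M (\<lambda>x. \<bar>f x\<bar> powr p - s * (f x - g x)))"
    using f_powr diff nonneg by (intro nn_integral_eq_integral) auto
  also have "\<dots> = ennreal (integral\<^sup>L M (\<lambda>x. \<bar>f x\<bar> powr p))"
    using diff f_powr by (subst Bochner_Integration.integral_diff) auto
  also have "\<dots> = (\<integral>\<^sup>+x. ennreal (\<bar>f x\<bar> powr p) \<partial>M)"
    by (intro nn_integral_eq_integral[symmetric] f_powr) auto
  finally show ?thesis .
qed (simp only: top_greatest infinity_ennreal_def)

lemma nnavg_oscillation_le_comonotone:
  fixes \<phi> \<psi> :: "real \<Rightarrow> real"
  assumes p: "p \<ge> 1" and "a < b"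
    and \<phi>: "\<phi> absolutely_integrable_on {a<..<b}" and \<psi>: "\<psi> absolutely_integrable_on {a<..<b}"
    and com: "comonotone_on {a<..<b} \<psi> (\<lambda>x. \<phi> x - \<psi> x)"
  shows "nnavg {a<..<b} (\<lambda>x. \<bar>\<psi> x - avg {a<..<b} \<psi>\<bar> powr p) \<le> nnavg {a<..<b} (\<lambda>x. \<bar>\<phi> x - avg {a<..<b} \<phi>\<bar> powr p)"
proof -
  let ?J = "{a<..<b}" and ?M = "lebesgue_on {a<..<b}"
  have centered: "integrable ?M (\<lambda>x. h x - avg ?J h)" "integral\<^sup>L ?M (\<lambda>x. h x - avg ?J h) = 0"
    if "h absolutely_integrable_on ?J" for h :: "real \<Rightarrow> real"
  proof -
    have h: "integrable ?M h" "integral\<^sup>L ?M h = (b - a) * avg ?J h"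
      using that \<open>a < b\<close>
      by (auto simp: set_integrable_def integrable_restrict_space integral_restrict_space avg_def
          set_lebesgue_integral_def)
    have "finite_measure ?M" by (rule finite_measure_lebesgue_on) simp
    then have const: "integrable ?M (\<lambda>x. avg ?J h)" by (rule finite_measure.integrable_const)
    show "integrable ?M (\<lambda>x. h x - avg ?J h)" using h const by simp
    show "integral\<^sup>L ?M (\<lambda>x. h x - avg ?J h) = 0"
      using h const \<open>a < b\<close> by (subst Bochner_Integration.integral_diff) (auto simp: measure_restrict_space)
  qed
  have "comonotone_on (space ?M) (\<lambda>x. \<psi> x - avg ?J \<psi>) (\<lambda>x. (\<phi> x - avg ?J \<phi>) - (\<psi> x - avg ?J \<psi>))"
    using com by (simp add: comonotone_on_def algebra_simps)
  then have "(\<integral>\<^sup>+x. ennreal (\<bar>\<psi> x - avg ?J \<psi>\<bar> powr p) \<partial>?M) \<le> (\<integral>\<^sup>+x. ennreal (\<bar>\<phi> x - avg ?J \<phi>\<bar> powr p) \<partial>?M)"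
    using centered[OF \<phi>] centered[OF \<psi>] by (intro nn_integral_abs_powr_le_comonotone p) auto
  then show ?thesis
    unfolding nnavg_def by (simp add: nn_integral_restrict_space divide_right_mono_ennreal)
qed

lemma comonotone_onI:
  assumes "\<And>x y. x \<in> S \<Longrightarrow> y \<in> S \<Longrightarrow> (f x \<le> f y \<and> g x \<le> g y) \<or> (f y \<le> f x \<and> g y \<le> g x)"
  shows "comonotone_on S f g"
  unfolding comonotone_on_def using assms by (auto simp: zero_le_mult_iff)

definition clip :: "real \<Rightarrow> real \<Rightarrow> real" where
  "clip n u = max (- n) (min u n)"

lemma nnavg_oscillation_clip_le:
  assumes "p \<ge> 1" "a < b" "n \<ge> 0" and \<phi>: "\<phi> absolutely_integrable_on {a<..<b}"
  shows "nnavg {a<..<b} (\<lambda>x. \<bar>clip n (\<phi> x) - avg {a<..<b} (\<lambda>x. clip n (\<phi> x))\<bar> powr p)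
    \<le> nnavg {a<..<b} (\<lambda>x. \<bar>\<phi> x - avg {a<..<b} \<phi>\<bar> powr p)"
proof (rule nnavg_oscillation_le_comonotone[OF assms(1,2) \<phi>])
  show "(\<lambda>x. clip n (\<phi> x)) absolutely_integrable_on {a<..<b}"
    unfolding clip_def using \<phi>
    by (intro absolutely_integrable_max_1 absolutely_integrable_min_1 absolutely_integrable_on_const) auto
  show "comonotone_on {a<..<b} (\<lambda>x. clip n (\<phi> x)) (\<lambda>x. \<phi> x - clip n (\<phi> x))"
    using \<open>n \<ge> 0\<close> by (intro comonotone_onI) (auto simp: clip_def max_def min_def)
qed

section \<open>Oscillation of the logarithm\<close>

definition log_moment :: "real \<Rightarrow> real" where
  "log_moment p = p / exp 1 * (Gamma p - integral {0..1} (\<lambda>t. t powr (p - 1) * exp t)) + 1"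

lemma integral_powr_exp_by_parts:
  fixes p :: real assumes p: "p \<ge> 1"
  shows "((\<lambda>u. u powr p * exp u) has_integral exp 1 - p * integral {0..1} (\<lambda>t. t powr (p - 1) * exp t)) {0..1}"
proof -
  have cont: "continuous_on {0..1::real} (\<lambda>u. u powr p * exp u)"
    using p by (intro continuous_on_mult continuous_on_powr' continuous_intros) auto
  let ?i = "integral {0..1} (\<lambda>u. u powr p * exp u)"
  have i: "((\<lambda>u. u powr p * exp u) has_integral ?i) {0..1}"
    using cont by (intro integrable_integral integrable_continuous_real)
  have "((\<lambda>u. p * (u powr (p - 1) * exp u) + u powr p * exp u) has_integral
      (1 powr p * exp 1 - 0 powr p * exp 0)) {0..1::real}"
    by (rule fundamental_theorem_of_calculus_interior[OF _ cont])
       (auto intro!: derivative_eq_intros simp: algebra_simps simp flip: has_real_derivative_iff_has_vector_derivative)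
  from has_integral_diff[OF this i]
  have "((\<lambda>u. p * (u powr (p - 1) * exp u)) has_integral exp 1 - ?i) {0..1}" by simp
  from integral_unique[OF this] have "p * integral {0..1} (\<lambda>t. t powr (p - 1) * exp t) = exp 1 - ?i"
    by (simp add: integral_mult_right)
  with i show ?thesis by simp
qed

lemma has_integral_exp_minus_substitution:
  fixes f :: "real \<Rightarrow> real"
  assumes i: "((\<lambda>t. exp (c - t) * f (exp (c - t))) has_integral i) S" and S: "S \<in> sets lebesgue"
    and f: "\<And>t. t \<in> S \<Longrightarrow> 0 \<le> f (exp (c - t))"
  shows "(f has_integral i) ((\<lambda>t. exp (c - t)) ` S)"
proof -
  have deriv: "((\<lambda>t. exp (c - t)) has_real_derivative - exp (c - t)) (at t within S)" for t
    by (auto intro!: derivative_eq_intros)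
  have eq: "(\<lambda>t. \<bar>- exp (c - t)\<bar> * f (exp (c - t))) = (\<lambda>t. exp (c - t) * f (exp (c - t)))" by auto
  have "(\<lambda>t. exp (c - t) * f (exp (c - t))) absolutely_integrable_on S"
    using i f by (intro nonnegative_absolutely_integrable_1) auto
  moreover have "integral S (\<lambda>t. exp (c - t) * f (exp (c - t))) = i" using i by (rule integral_unique)
  ultimately have "f absolutely_integrable_on ((\<lambda>t. exp (c - t)) ` S) \<and> integral ((\<lambda>t. exp (c - t)) ` S) f = i"
    using has_absolute_integral_change_of_variables_1'[OF S, of "\<lambda>t. exp (c - t)" "\<lambda>t. - exp (c - t)" f i] deriv
    unfolding eq by (auto simp: inj_on_def)
  then show ?thesis
    using set_lebesgue_integral_eq_integral(1) has_integral_iff by blast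
qed

lemma image_exp_minus: "(\<lambda>t. exp (c - t)) ` S = {x. 0 < x \<and> c - ln x \<in> S}" for c :: real
proof
  show "{x. 0 < x \<and> c - ln x \<in> S} \<subseteq> (\<lambda>t. exp (c - t)) ` S"
    by (auto intro!: image_eqI[of _ _ "c - ln _"])
qed auto

lemma Gamma_has_integral:
  fixes p :: real assumes "p > -1"
  shows "((\<lambda>t. exp (- t) * t powr p) has_integral Gamma (p + 1)) {0..}"
  using Gamma_integral_real[of "p + 1"] assms by (simp add: exp_minus field_simps)

lemma neg_ln_has_integral: "((\<lambda>x. - ln x) has_integral 1) {0<..<1::real}"
proof -
  have "((\<lambda>t::real. exp (- t) * t powr 1) has_integral 1) {0..}"
    using Gamma_has_integral[of 1] Gamma_fact[of 1, where 'a=real] by simp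
  then have "((\<lambda>t::real. exp (0 - t) * (- ln (exp (0 - t)))) has_integral 1) {0..}"
    by (rule has_integral_eq[rotated]) auto
  then have "((\<lambda>x. - ln x) has_integral 1) {x::real. 0 < x \<and> 0 - ln x \<in> {0..}}"
    unfolding image_exp_minus[symmetric] by (rule has_integral_exp_minus_substitution) auto
  then show ?thesis
    by (rule has_integral_spike_set_eq[THEN iffD1, rotated 2]) (auto intro: negligible_subset[of "{1}"])
qed

lemma ln_moment_initial_has_integral:
  fixes p :: real assumes "p > - 1"
  shows "((\<lambda>x. \<bar>- ln x - 1\<bar> powr p) has_integral Gamma (p + 1) / exp 1) {0<..exp (- 1)}"
proof -
  have shift: "exp (- 1 - t) = exp (- 1) * exp (- t)" for t :: real by (simp add: mult_exp_exp)
  have "((\<lambda>t. exp (- 1) * (exp (- t) * t powr p)) has_integral exp (- 1) * Gamma (p + 1)) {0..}"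
    using assms by (intro has_integral_mult_right Gamma_has_integral)
  then have "((\<lambda>t. exp (- 1 - t) * \<bar>- ln (exp (- 1 - t)) - 1\<bar> powr p) has_integral exp (- 1) * Gamma (p + 1)) {0..}"
    by (rule has_integral_eq[rotated]) (subst ln_exp, subst shift, simp)
  then have "((\<lambda>x. \<bar>- ln x - 1\<bar> powr p) has_integral exp (- 1) * Gamma (p + 1)) {x. 0 < x \<and> - 1 - ln x \<in> {0..}}"
    unfolding image_exp_minus[symmetric] by (rule has_integral_exp_minus_substitution) auto
  moreover have "{x. 0 < x \<and> - 1 - ln x \<in> {0..}} = {0<..exp (- 1)::real}"
    using ln_le_cancel_iff[of _ "exp (- 1)"] by auto
  ultimately show ?thesis by (simp add: exp_minus field_simps)
qed

lemma ln_moment_final_has_integral: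
  fixes p :: real assumes "p \<ge> 1"
  shows "((\<lambda>x. \<bar>- ln x - 1\<bar> powr p) has_integral 1 - p / exp 1 * integral {0..1} (\<lambda>t. t powr (p - 1) * exp t))
    {exp (- 1)..1}"
proof -
  let ?i = "exp (- 1) * (exp 1 - p * integral {0..1} (\<lambda>t. t powr (p - 1) * exp t))"
  have shift: "exp (- 1 - t) = exp (- 1) * exp (- t)" for t :: real by (simp add: mult_exp_exp)
  have "((\<lambda>u. exp (- 1) * (u powr p * exp u)) has_integral ?i) {0..1}"
    by (intro has_integral_mult_right integral_powr_exp_by_parts assms)
  then have "((\<lambda>t. exp (- 1) * ((- t) powr p * exp (- t))) has_integral ?i) {- 1..0}"
    using has_integral_reflect_real[where f = "\<lambda>u. exp (- 1) * (u powr p * exp u)" and a = 0 and b = 1] by simp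
  then have "((\<lambda>t. exp (- 1 - t) * \<bar>- ln (exp (- 1 - t)) - 1\<bar> powr p) has_integral ?i) {- 1..0}"
    by (rule has_integral_eq[rotated]) (subst ln_exp, subst shift, simp)
  then have "((\<lambda>x. \<bar>- ln x - 1\<bar> powr p) has_integral ?i) {x. 0 < x \<and> - 1 - ln x \<in> {- 1..0}}"
    unfolding image_exp_minus[symmetric] by (rule has_integral_exp_minus_substitution) auto
  moreover have "0 < x" if "exp (- 1) \<le> x" for x :: real
    using that exp_gt_zero[of "- 1 :: real"] by linarith
  then have "{x. 0 < x \<and> - 1 - ln x \<in> {- 1..0}} = {exp (- 1)..1::real}"
    by (auto simp: ln_ge_iff)
  ultimately show ?thesis by (simp add: exp_minus field_simps)
qed

lemma log_moment_has_integral: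
  fixes p :: real assumes p: "p \<ge> 1"
  shows "((\<lambda>x. \<bar>- ln x - 1\<bar> powr p) has_integral log_moment p) {0<..<1}"
proof -
  have "p \<notin> \<int>\<^sub>\<le>\<^sub>0" using p by (auto elim!: nonpos_Ints_cases)
  from Gamma_plus1[OF this]
  have "Gamma (p + 1) / exp 1 + (1 - p / exp 1 * integral {0..1} (\<lambda>t. t powr (p - 1) * exp t)) = log_moment p"
    by (simp add: log_moment_def field_simps)
  moreover have "{0<..c} \<union> {c..1} = {0<..1}" if "0 < c" "c \<le> 1" for c :: real using that by auto
  then have "{0<..exp (- 1)} \<union> {exp (- 1)..1} = {0<..1::real}" by simp
  moreover have "((\<lambda>x. \<bar>- ln x - 1\<bar> powr p) has_integral
      Gamma (p + 1) / exp 1 + (1 - p / exp 1 * integral {0..1} (\<lambda>t. t powr (p - 1) * exp t)))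
      ({0<..exp (- 1)} \<union> {exp (- 1)..1})"
    using p by (intro has_integral_Un ln_moment_initial_has_integral ln_moment_final_has_integral)
      (auto intro: negligible_subset[of "{exp (- 1)}"])
  ultimately have "((\<lambda>x. \<bar>- ln x - 1\<bar> powr p) has_integral log_moment p) {0<..1}" by simp
  then show ?thesis
    by (rule has_integral_spike_set_eq[THEN iffD1, rotated 2]) (auto intro: negligible_subset[of "{1}"])
qed

lemma log_moment_pos:
  fixes p :: real assumes p: "p \<ge> 1" shows "log_moment p > 0"
proof -
  have "x < 1" if "x \<le> exp (- 1)" for x :: real
    using that by (rule order_le_less_trans) simp
  then have "{0<..exp (- 1)} \<subseteq> {0<..<1::real}" by auto
  have "0 < Gamma (p + 1) / exp 1" using p by (simp add: Gamma_real_pos)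
  also have "\<dots> \<le> log_moment p"
    using \<open>{0<..exp (- 1)} \<subseteq> {0<..<1}\<close> p
    by (intro has_integral_subset_le[OF _ ln_moment_initial_has_integral log_moment_has_integral[OF p]]) auto
  finally show ?thesis .
qed

definition log_norm :: "real \<Rightarrow> real" where
  "log_norm p = log_moment p powr (1 / p)"

lemma log_norm_pos: "p \<ge> 1 \<Longrightarrow> log_norm p > 0"
  using log_moment_pos[of p] by (simp add: log_norm_def)

lemma log_norm_powr: "p \<ge> 1 \<Longrightarrow> log_norm p powr p = log_moment p"
  using log_moment_pos[of p] by (simp add: log_norm_def powr_powr)

lemma has_integral_rescale:
  fixes h :: "real \<Rightarrow> real"
  assumes "(h has_integral i) {0<..<1}" "a < b"
  shows "((\<lambda>x. h ((x - a) / (b - a))) has_integral (b - a) * i) {a<..<b}"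
proof -
  have "(h has_integral i) (cbox 0 1)" "1 / (b - a) > 0"
    using assms by (auto simp: has_integral_Icc_iff_Ioo)
  from has_integral_affinity'[OF this, of "- a / (b - a)"]
  have "((\<lambda>x. h (x / (b - a) - a / (b - a))) has_integral i * (b - a))
      {(a / (b - a)) * (b - a)..(1 + a / (b - a)) * (b - a)}" 
    using \<open>a < b\<close> by (simp add: mult.commute)
  moreover have "(1 + a / (b - a)) * (b - a) = b" "a / (b - a) * (b - a) = a"
    using assms by (auto simp: field_simps)
  ultimately show ?thesis
    using assms by (simp add: has_integral_Icc_iff_Ioo diff_divide_distrib mult.commute)
qed

lemma nnavg_eq_has_integral:
  assumes "(h has_integral (b - a) * i) {a<..<b}" "a < b" "\<And>x. x \<in> {a<..<b} \<Longrightarrow> 0 \<le> h x"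
  shows "nnavg {a<..<b} h = ennreal i"
proof -
  have "h absolutely_integrable_on {a<..<b}"
    using assms by (intro nonnegative_absolutely_integrable_1) auto
  moreover have "mean a b h = i"
    using integral_unique[OF assms(1)] assms(2) by (simp add: mean_def integral_open_interval_real)
  ultimately show ?thesis using nnavg_Ioo_eq_mean assms by metis
qed

lemma rescaled_neg_ln:
  fixes \<xi> :: real
  assumes "p \<ge> 1" "\<xi> \<ge> 0" "a < b"
  defines "\<phi> \<equiv> \<lambda>x. \<xi> * (- ln ((x - a) / (b - a)))"
  shows "\<phi> absolutely_integrable_on {a<..<b}" "avg {a<..<b} \<phi> = \<xi>"
    and "nnavg {a<..<b} (\<lambda>x. \<bar>\<phi> x - \<xi>\<bar> powr p) = ennreal (\<xi> powr p * log_moment p)"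
proof -
  have \<phi>: "(\<phi> has_integral (b - a) * \<xi>) {a<..<b}"
    using has_integral_rescale[OF has_integral_mult_right[OF neg_ln_has_integral] \<open>a < b\<close>, of \<xi>]
    by (simp add: \<phi>_def)
  then show abs: "\<phi> absolutely_integrable_on {a<..<b}"
    using \<open>\<xi> \<ge> 0\<close> \<open>a < b\<close> by (intro nonnegative_absolutely_integrable_1) (auto simp: \<phi>_def mult_nonneg_nonpos)
  show "avg {a<..<b} \<phi> = \<xi>"
    using avg_Ioo_eq_mean[OF abs \<open>a < b\<close>] integral_unique[OF \<phi>] \<open>a < b\<close>
    by (simp add: mean_def integral_open_interval_real)
  have "\<bar>\<phi> x - \<xi>\<bar> powr p = \<xi> powr p * \<bar>- ln ((x - a) / (b - a)) - 1\<bar> powr p" for x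
  proof -
    have "\<phi> x - \<xi> = \<xi> * (- ln ((x - a) / (b - a)) - 1)" by (simp add: \<phi>_def algebra_simps)
    then show ?thesis using \<open>\<xi> \<ge> 0\<close> by (simp add: abs_mult powr_mult)
  qed
  then have "((\<lambda>x. \<bar>\<phi> x - \<xi>\<bar> powr p) has_integral (b - a) * (\<xi> powr p * log_moment p)) {a<..<b}"
    using has_integral_rescale[OF has_integral_mult_right[OF log_moment_has_integral[OF \<open>p \<ge> 1\<close>]] \<open>a < b\<close>]
    by simp
  then show "nnavg {a<..<b} (\<lambda>x. \<bar>\<phi> x - \<xi>\<bar> powr p) = ennreal (\<xi> powr p * log_moment p)"
    using \<open>a < b\<close> by (intro nnavg_eq_has_integral) auto
qed

lemma comonotone_neg_ln_rescaled:
  fixes \<xi> :: real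
  assumes "\<xi> \<ge> 0" "0 \<le> a" "a < b"
  shows "comonotone_on {a<..<b} (\<lambda>x. \<xi> * (- ln x)) (\<lambda>x. \<xi> * (- ln ((x - a) / (b - a))) - \<xi> * (- ln x))"
    (is "comonotone_on _ ?\<psi> ?d")
proof (rule comonotone_onI)
  have decr: "?\<psi> y \<le> ?\<psi> x \<and> ?d y \<le> ?d x" if "x \<in> {a<..<b}" "x \<le> y" for x y
  proof -
    have pos: "0 < x" "0 < y" "0 < x - a" "0 < y - a" using that \<open>0 \<le> a\<close> by auto
    have "a * x \<le> a * y" using that \<open>0 \<le> a\<close> by (intro mult_left_mono) auto
    then have "ln (y * (x - a)) \<le> ln (x * (y - a))" using pos by (simp add: algebra_simps)
    then have "ln y + ln (x - a) \<le> ln x + ln (y - a)" using pos by (simp add: ln_mult)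
    moreover have "?d z = \<xi> * (ln z - ln (z - a) + ln (b - a))" if "0 < z - a" for z
      using that \<open>a < b\<close> by (simp add: ln_div algebra_simps)
    ultimately show ?thesis using pos \<open>x \<le> y\<close> \<open>\<xi> \<ge> 0\<close> by (auto intro!: mult_left_mono)
  qed
  fix x y assume "x \<in> {a<..<b}" "y \<in> {a<..<b}"
  then show "(?\<psi> x \<le> ?\<psi> y \<and> ?d x \<le> ?d y) \<or> (?\<psi> y \<le> ?\<psi> x \<and> ?d y \<le> ?d x)"
    using decr[of x y] decr[of y x] by (metis linear)
qed

lemma bmo_norm_neg_ln_le:
  assumes p: "p \<ge> 1" and "\<xi> \<ge> 0"
  shows "bmo_norm p {0<..<1} (\<lambda>x. \<xi> * (- ln x)) \<le> ennreal (\<xi> * log_norm p)"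
proof -
  have "((\<lambda>x. \<xi> * (- ln x)) has_integral \<xi> * 1) {0<..<1}"
    by (intro has_integral_mult_right neg_ln_has_integral)
  then have "(\<lambda>x. \<xi> * (- ln x)) absolutely_integrable_on {0<..<1}"
    using \<open>\<xi> \<ge> 0\<close> by (intro nonnegative_absolutely_integrable_1) (auto simp: mult_nonneg_nonpos)
  then have abs: "(\<lambda>x. \<xi> * (- ln x)) absolutely_integrable_on {a<..<b}" if "0 \<le> a" "b \<le> 1" for a b
    by (rule set_integrable_subset) (use that in auto)
  have "nnavg {a<..<b} (\<lambda>x. \<bar>\<xi> * (- ln x) - avg {a<..<b} (\<lambda>x. \<xi> * (- ln x))\<bar> powr p)
      \<le> ennreal (\<xi> powr p * log_moment p)" if "0 \<le> a" "a < b" "b \<le> 1" for a b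
    using nnavg_oscillation_le_comonotone[OF p \<open>a < b\<close> rescaled_neg_ln(1)[OF assms \<open>a < b\<close>] abs
        comonotone_neg_ln_rescaled] rescaled_neg_ln(2,3)[OF assms \<open>a < b\<close>] that \<open>\<xi> \<ge> 0\<close>
    by simp
  moreover have "(\<xi> * log_norm p) powr p = \<xi> powr p * log_moment p"
    using assms log_norm_pos[OF p] by (simp add: powr_mult log_norm_powr)
  ultimately show ?thesis using assms log_norm_pos[OF p] by (subst bmo_norm_le_iff) auto
qed

lemma bmo_of_bmo_norm_le:
  assumes "\<phi> absolutely_integrable_on Q" "bmo_norm p Q \<phi> \<le> ennreal \<epsilon>"
  shows "\<phi> \<in> bmo p Q"
proof -
  have "\<phi> absolutely_integrable_on K" if "compact K" "K \<subseteq> Q" for K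
    using that assms(1)
    by (intro set_integrable_subset[OF assms(1)]) (auto intro: lmeasurable_compact fmeasurableD)
  moreover have "bmo_norm p Q \<phi> < \<infinity>"
    using assms(2) ennreal_less_top[of \<epsilon>] by (simp add: order_le_less_trans)
  ultimately show ?thesis by (simp add: bmo_def locally_integrable_def)
qed

lemma jn_C_ge_neg_ln:
  assumes p: "p \<ge> 1" and \<xi>: "0 \<le> \<xi>" "\<xi> < 1"
  shows "ennreal (exp (- \<xi>) / (1 - \<xi>)) \<le> jn_C (\<xi> * log_norm p) p"
  unfolding jn_C_def
proof (rule Inf_greatest, clarify)
  let ?\<epsilon> = "\<xi> * log_norm p"
  define \<phi> where "\<phi> x = \<xi> * (- ln x)" for x :: real
  have \<phi>: "(\<phi> has_integral \<xi>) {0<..<1}"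
    unfolding \<phi>_def using has_integral_mult_right[OF neg_ln_has_integral, of \<xi>] by simp
  have \<phi>_abs: "\<phi> absolutely_integrable_on {0<..<1}"
    using \<phi> \<xi> by (intro nonnegative_absolutely_integrable_1) (auto simp: \<phi>_def mult_nonneg_nonpos)
  have "avg {0<..<1} \<phi> = \<xi>"
    using avg_Ioo_eq_mean[OF \<phi>_abs] integral_unique[OF \<phi>] by (simp add: mean_def integral_open_interval_real)
  moreover have "nnavg {0<..<1} (\<lambda>x. exp (\<phi> x)) = ennreal (1 / (1 - \<xi>))"
  proof (rule nnavg_eq_has_integral)
    have "((\<lambda>x. x powr (- \<xi>)) has_integral 1 powr (- \<xi> + 1) / (- \<xi> + 1)) {0..1}"
      using \<xi> by (intro has_integral_powr_from_0) auto
    then have "((\<lambda>x. x powr (- \<xi>)) has_integral 1 / (1 - \<xi>)) {0<..<1}"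
      by (simp add: has_integral_Icc_iff_Ioo)
    then have "((\<lambda>x. exp (\<phi> x)) has_integral 1 / (1 - \<xi>)) {0<..<1}"
      by (rule has_integral_eq[rotated]) (simp add: \<phi>_def powr_def)
    then show "((\<lambda>x. exp (\<phi> x)) has_integral (1 - 0) * (1 / (1 - \<xi>))) {0<..<1}" by simp
  qed auto
  moreover have norm: "bmo_norm p {0<..<1} \<phi> \<le> ennreal ?\<epsilon>"
    unfolding \<phi>_def by (rule bmo_norm_neg_ln_le[OF p \<xi>(1)])
  ultimately have ratio: "ennreal (1 / (1 - \<xi>)) \<le> C * ennreal (exp \<xi>)" if "jn_admissible ?\<epsilon> p C" for C
    using that[unfolded jn_admissible_iff, rule_format, OF bmo_of_bmo_norm_le[OF \<phi>_abs norm] norm, of 0 1] by simp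
  fix C :: ennreal assume "1 \<le> C" "jn_admissible ?\<epsilon> p C"
  have "ennreal (exp (- \<xi>) / (1 - \<xi>)) = ennreal (1 / (1 - \<xi>)) * ennreal (exp (- \<xi>))"
    using \<xi> by (simp flip: ennreal_mult)
  also have "\<dots> \<le> C * ennreal (exp \<xi>) * ennreal (exp (- \<xi>))"
    using ratio[OF \<open>jn_admissible ?\<epsilon> p C\<close>] by (intro mult_right_mono) auto
  also have "\<dots> = C" by (simp add: mult.assoc flip: ennreal_mult exp_add)
  finally show "ennreal (exp (- \<xi>) / (1 - \<xi>)) \<le> C" .
qed

section \<open>The function \<open>jn_k\<close>\<close>

lemma exp_minus_div_ge_1:
  fixes x :: real
  assumes "x < 1"
  shows "1 \<le> exp (- x) / (1 - x)"
  using assms exp_ge_add_one_self[of "- x"] by (simp add: pos_le_divide_eq)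

lemma xi_equation_iff:
  fixes C x :: real
  assumes "C \<ge> 1"
  shows "exp (- x) = C * (1 - x) \<longleftrightarrow> (1 - x) * exp x = 1 / C"
  using assms by (auto simp: exp_minus field_simps)

lemma one_minus_exp_strict_antimono:
  fixes x y :: real
  assumes "0 \<le> x" "x < y"
  shows "(1 - y) * exp y < (1 - x) * exp x"
proof (rule DERIV_neg_imp_decreasing_open[where f="\<lambda>x. (1 - x) * exp x"])
  fix z assume "x < z" "z < y"
  then show "\<exists>D. ((\<lambda>x. (1 - x) * exp x) has_real_derivative D) (at z) \<and> D < 0"
    using assms by (intro exI[of _ "- z * exp z"]) (auto intro!: derivative_eq_intros simp: algebra_simps)
qed (use assms in \<open>auto intro!: continuous_intros\<close>)

lemma one_minus_exp_strict_mono: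
  fixes x y :: real
  assumes "x < y" "y \<le> 0"
  shows "(1 - x) * exp x < (1 - y) * exp y"
proof (rule DERIV_pos_imp_increasing_open[where f="\<lambda>x. (1 - x) * exp x"])
  fix z assume "x < z" "z < y"
  then show "\<exists>D. ((\<lambda>x. (1 - x) * exp x) has_real_derivative D) (at z) \<and> D > 0"
    using assms
    by (intro exI[of _ "- z * exp z"]) (auto intro!: derivative_eq_intros simp: algebra_simps mult_less_0_iff)
qed (use assms in \<open>auto intro!: continuous_intros\<close>)

lemma xi_plus_ex1:
  fixes C :: real
  assumes C: "C \<ge> 1"
  shows "\<exists>!x. 0 \<le> x \<and> x < 1 \<and> exp (- x) = C * (1 - x)"
proof (rule ex_ex1I)
  have "\<exists>x\<ge>0. x \<le> 1 \<and> (1 - x) * exp x = 1 / C"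
    using C by (intro IVT2'[of "\<lambda>x. (1 - x) * exp x"]) (auto intro!: continuous_intros)
  then obtain x where "0 \<le> x" "x \<le> 1" "(1 - x) * exp x = 1 / C" by auto
  moreover from this have "x \<noteq> 1" using C by auto
  ultimately show "\<exists>x. 0 \<le> x \<and> x < 1 \<and> exp (- x) = C * (1 - x)"
    using xi_equation_iff[OF C] by (intro exI[of _ x]) auto
next
  fix x y assume "0 \<le> x \<and> x < 1 \<and> exp (- x) = C * (1 - x)" "0 \<le> y \<and> y < 1 \<and> exp (- y) = C * (1 - y)"
  then show "x = y"
    using one_minus_exp_strict_antimono[of x y] one_minus_exp_strict_antimono[of y x]
    by (cases x y rule: linorder_cases) (auto simp: xi_equation_iff[OF C])
qed

lemma xi_minus_ex1:
  fixes C :: real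
  assumes C: "C \<ge> 1"
  shows "\<exists>!x. x \<le> 0 \<and> exp (- x) = C * (1 - x)"
proof (rule ex_ex1I)
  have "1 + 2 * C + (2 * C)\<^sup>2 / 2 \<le> exp (2 * C)" using exp_lower_Taylor_quadratic[of "2 * C"] C by simp
  then have "C * (1 + 2 * C) \<le> exp (2 * C)" using C by (simp add: power2_eq_square algebra_simps)
  then have "(1 + 2 * C) * exp (- (2 * C)) \<le> 1 / C" using C by (simp add: exp_minus field_simps)
  then have "\<exists>x\<ge>-(2*C). x \<le> 0 \<and> (1 - x) * exp x = 1 / C"
    using C by (intro IVT'[of "\<lambda>x. (1 - x) * exp x"]) (auto intro!: continuous_intros)
  then show "\<exists>x. x \<le> 0 \<and> exp (- x) = C * (1 - x)" using xi_equation_iff[OF C] by auto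
next
  fix x y assume "x \<le> 0 \<and> exp (- x) = C * (1 - x)" "y \<le> 0 \<and> exp (- y) = C * (1 - y)"
  then show "x = y"
    using one_minus_exp_strict_mono[of x y] one_minus_exp_strict_mono[of y x]
    by (cases x y rule: linorder_cases) (auto simp: xi_equation_iff[OF C])
qed

lemma xi_plus:
  assumes "C \<ge> 1"
  shows "0 \<le> xi_plus C" "xi_plus C < 1" "exp (- xi_plus C) = C * (1 - xi_plus C)"
  using theI'[OF xi_plus_ex1[OF assms]] unfolding xi_plus_def by auto

lemma xi_minus:
  assumes "C \<ge> 1"
  shows "xi_minus C \<le> 0" "exp (- xi_minus C) = C * (1 - xi_minus C)"
  using theI'[OF xi_minus_ex1[OF assms]] unfolding xi_minus_def by auto

lemma xi_plus_eqI:
  assumes "C \<ge> 1" "0 \<le> x" "x < 1" "exp (- x) = C * (1 - x)"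
  shows "xi_plus C = x"
  using xi_plus_ex1[OF assms(1)] xi_plus[OF assms(1)] assms by blast

lemma xi_minus_eqI:
  assumes "C \<ge> 1" "x \<le> 0" "exp (- x) = C * (1 - x)"
  shows "xi_minus C = x"
  using xi_minus_ex1[OF assms(1)] xi_minus[OF assms(1)] assms by blast

lemma xi_plus_pos: "C > 1 \<Longrightarrow> xi_plus C > 0"
  using xi_plus[of C] by (cases "xi_plus C = 0") auto

lemma xi_minus_neg: "C > 1 \<Longrightarrow> xi_minus C < 0"
  using xi_minus[of C] by (cases "xi_minus C = 0") auto

lemma continuous_on_closed_segment_inverse:
  fixes f g :: "real \<Rightarrow> real"
  assumes f: "continuous_on {a..b} f" and "a \<le> b" and inv: "\<And>x. x \<in> {a..b} \<Longrightarrow> g (f x) = x"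
  shows "continuous_on (closed_segment (f a) (f b)) g"
proof (rule continuous_on_subset)
  show "continuous_on (f ` {a..b}) g"
    using f inv by (intro continuous_on_inv) auto
  have "convex (f ` {a..b})"
    using f connected_continuous_image[of "{a..b}" f]
    by (simp add: is_interval_connected_1 flip: is_interval_convex_1)
  then show "closed_segment (f a) (f b) \<subseteq> f ` {a..b}"
    using \<open>a \<le> b\<close> by (intro closed_segment_subset) auto
qed

lemma continuous_on_xi:
  assumes "D \<ge> 1"
  shows "continuous_on {1..D} xi_plus" "continuous_on {1..D} xi_minus"
proof -
  define K where "K x = exp (- x) / (1 - x)" for x :: real
  have eq_K: "exp (- x) = C * (1 - x) \<longleftrightarrow> C = K x" if "x < 1" for x C
    using that by (auto simp: K_def field_simps)
  have K_ge_1: "1 \<le> K x" if "x < 1" for x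
    using exp_minus_div_ge_1[OF that] by (simp add: K_def)
  have K_0: "K 0 = 1" by (simp add: K_def)
  have K_xi: "K (xi_plus D) = D" "K (xi_minus D) = D"
    using xi_plus[OF assms] xi_minus[OF assms] eq_K[of "xi_plus D" D] eq_K[of "xi_minus D" D] by auto
  have cont: "continuous_on S K" if "S \<subseteq> {..<1}" for S
    unfolding K_def using that by (intro continuous_intros) auto
  have "continuous_on (closed_segment (K 0) (K (xi_plus D))) xi_plus"
    using xi_plus[OF assms] K_ge_1 eq_K
    by (intro continuous_on_closed_segment_inverse cont) (auto intro!: xi_plus_eqI)
  then show "continuous_on {1..D} xi_plus"
    using assms by (simp add: K_0 K_xi closed_segment_eq_real_ivl)
  have "continuous_on (closed_segment (K (xi_minus D)) (K 0)) xi_minus"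
    using xi_minus[OF assms] K_ge_1 eq_K
    by (intro continuous_on_closed_segment_inverse cont) (auto intro!: xi_minus_eqI)
  then show "continuous_on {1..D} xi_minus"
    using assms by (simp add: K_0 K_xi closed_segment_eq_real_ivl split: if_splits)
qed

text \<open>The convex function \<open>relative_entropy\<close> takes the value \<open>1 - 1 / C\<close> at \<open>exp (xi_plus C)\<close> and \<open>exp (xi_minus C)\<close>,
  so \<open>jn_k C\<close> is twice a height divided by the width of the sublevel set at that height.\<close>

definition relative_entropy :: "real \<Rightarrow> real" where
  "relative_entropy t = t * ln t - t + 1"

lemma relative_entropy_1: "relative_entropy 1 = 0"
  by (simp add: relative_entropy_def)

lemma relative_entropy_above_tangent:
  assumes "t > 0" "z > 0"
  shows "relative_entropy z + ln z * (t - z) \<le> relative_entropy t"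
proof -
  have "ln (z / t) \<le> z / t - 1" using assms by (intro ln_le_minus_one) simp
  then have "t * ln (z / t) \<le> t * (z / t - 1)" using assms by (intro mult_left_mono) auto
  then show ?thesis using assms by (simp add: relative_entropy_def ln_div algebra_simps)
qed

lemma relative_entropy_above_tangent_strict:
  assumes "t > 0" "z > 0" "t \<noteq> z"
  shows "relative_entropy z + ln z * (t - z) < relative_entropy t"
proof -
  have "ln (z / t) < z / t - 1"
    using assms ln_eq_minus_one[of "z / t"] ln_le_minus_one[of "z / t"] by fastforce
  then have "t * ln (z / t) < t * (z / t - 1)" using assms by (intro mult_strict_left_mono) auto
  then show ?thesis using assms by (simp add: relative_entropy_def ln_div algebra_simps)
qed

lemma relative_entropy_mono:
  assumes "1 \<le> x" "x \<le> y"
  shows "relative_entropy x \<le> relative_entropy y"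
proof -
  have "0 \<le> ln x * (y - x)" using assms by simp
  then show ?thesis using relative_entropy_above_tangent[of y x] assms by linarith
qed

lemma relative_entropy_antimono:
  assumes "0 < x" "x \<le> y" "y \<le> 1"
  shows "relative_entropy y \<le> relative_entropy x"
proof -
  have "0 \<le> ln y * (x - y)" using assms by (intro mult_nonpos_nonpos) auto
  then show ?thesis using relative_entropy_above_tangent[of x y] assms by linarith
qed

lemma relative_entropy_contract_less:
  assumes "t > 0" "t \<noteq> 1" "0 < l" "l < 1"
  shows "relative_entropy (1 + l * (t - 1)) < l * relative_entropy t"
proof -
  define z where "z = 1 + l * (t - 1)"
  have "z = (1 - l) + l * t" "t - z = (1 - l) * (t - 1)" by (simp_all add: z_def algebra_simps)
  then have "z > 0" "t \<noteq> z" using assms by (auto simp: add_pos_pos)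
  then have "l * (relative_entropy z + ln z * (t - z)) < l * relative_entropy t"
    using assms by (intro mult_strict_left_mono relative_entropy_above_tangent_strict) auto
  moreover have "(1 - l) * (relative_entropy z + ln z * (1 - z)) \<le> (1 - l) * relative_entropy 1"
    using assms \<open>z > 0\<close> by (intro mult_left_mono relative_entropy_above_tangent) auto
  moreover have "l * (t - z) + (1 - l) * (1 - z) = 0" by (simp add: z_def algebra_simps)
  then have "ln z * (l * (t - z) + (1 - l) * (1 - z)) = 0" by simp
  then have "l * (relative_entropy z + ln z * (t - z)) + (1 - l) * (relative_entropy z + ln z * (1 - z))
      = relative_entropy z"
    by (simp add: algebra_simps)
  ultimately show ?thesis by (simp add: relative_entropy_1 z_def)
qed

lemma relative_entropy_level_width:
  assumes "1 < x" "1 < x'" "0 < y" "y < 1" "0 < y'" "y' < 1"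
    and "relative_entropy x = l * h" "relative_entropy y = l * h"
      "relative_entropy x' = h" "relative_entropy y' = h"
    and l: "0 < l" "l < 1"
  shows "l * (x' - y') < x - y"
proof -
  have "1 + l * (x' - 1) < x"
  proof (rule ccontr)
    assume "\<not> 1 + l * (x' - 1) < x"
    then have "relative_entropy x \<le> relative_entropy (1 + l * (x' - 1))"
      using assms by (intro relative_entropy_mono) auto
    then show False using relative_entropy_contract_less[of x' l] assms by auto
  qed
  moreover have "y < 1 + l * (y' - 1)"
  proof (rule ccontr)
    have "0 < (1 - l) + l * y'" using assms by (simp add: add_pos_pos)
    then have "0 < 1 + l * (y' - 1)" by (simp add: algebra_simps)
    moreover assume "\<not> y < 1 + l * (y' - 1)"
    ultimately have "relative_entropy y \<le> relative_entropy (1 + l * (y' - 1))"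
      using assms by (intro relative_entropy_antimono) auto
    then show False using relative_entropy_contract_less[of y' l] assms by auto
  qed
  ultimately show ?thesis by (simp add: algebra_simps)
qed

context
  fixes C :: real
  assumes C: "C > 1"
begin

lemma relative_entropy_exp_xi:
  "relative_entropy (exp (xi_plus C)) = 1 - 1 / C" "relative_entropy (exp (xi_minus C)) = 1 - 1 / C"
proof -
  have "(1 - xi_plus C) * exp (xi_plus C) = 1 / C" "(1 - xi_minus C) * exp (xi_minus C) = 1 / C"
    using xi_plus[of C] xi_minus[of C] C xi_equation_iff[of C] by auto
  then show "relative_entropy (exp (xi_plus C)) = 1 - 1 / C" "relative_entropy (exp (xi_minus C)) = 1 - 1 / C"
    by (auto simp: relative_entropy_def algebra_simps)
qed

lemma jn_k_eq_level_width: "jn_k C = 2 * (1 - 1 / C) / (exp (xi_plus C) - exp (xi_minus C))"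
proof -
  define X where "X = exp (xi_plus C)"
  define Y where "Y = exp (xi_minus C)"
  have XY: "X > 0" "Y > 0" "X > Y" using xi_plus_pos[OF C] xi_minus_neg[OF C] by (auto simp: X_def Y_def)
  have x: "1 - xi_plus C = 1 / (C * X)" using xi_plus[of C] C by (simp add: X_def exp_minus field_simps)
  have y: "1 - xi_minus C = 1 / (C * Y)" using xi_minus[of C] C by (simp add: Y_def exp_minus field_simps)
  have "xi_plus C - xi_minus C = 1 / (C * Y) - 1 / (C * X)" using x y by linarith
  also have "\<dots> = (X - Y) / (C * X * Y)" using XY C by (simp add: field_simps)
  finally have "jn_k C = 2 * (1 / (C * Y) * (1 / (C * X)) / ((X - Y) / (C * X * Y))) * (C - 1)"
    using C by (simp add: jn_k_def x y)
  also have "\<dots> = 2 * (1 - 1 / C) / (X - Y)" using XY C by (simp add: field_simps)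
  finally show ?thesis by (simp add: X_def Y_def)
qed

lemma jn_k_pos: "jn_k C > 0"
  unfolding jn_k_eq_level_width using C xi_plus_pos[OF C] xi_minus_neg[OF C]
  by (intro divide_pos_pos mult_pos_pos) auto

lemma jn_k_gt: "2 * (1 - 1 / C) / exp 1 < jn_k C"
proof -
  have "exp (xi_plus C) < exp 1" using xi_plus(2)[of C] C by simp
  then have "exp (xi_plus C) - exp (xi_minus C) < exp 1"
    using exp_gt_zero[of "xi_minus C"] by linarith
  then show ?thesis
    unfolding jn_k_eq_level_width using C xi_plus_pos[OF C] xi_minus_neg[OF C]
    by (intro divide_strict_left_mono mult_pos_pos) auto
qed

lemma jn_k_le: "jn_k C \<le> 2 * sqrt (1 - 1 / C)"
proof -
  define X where "X = exp (xi_plus C)"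
  define h where "h = 1 - 1 / C"
  have X: "X > 1" using xi_plus_pos[OF C] by (simp add: X_def)
  have "exp (xi_minus C) < 1" using xi_minus_neg[OF C] by simp
  with X have width: "X - exp (xi_minus C) > 0" by linarith
  have h: "h > 0" using C by (simp add: h_def)
  have "h = X * ln X - X + 1" using relative_entropy_exp_xi by (simp add: h_def X_def relative_entropy_def)
  also have "\<dots> \<le> X * (X - 1) - X + 1" using X ln_le_minus_one[of X] by (simp add: mult_left_mono)
  also have "\<dots> = (X - 1)\<^sup>2" by (simp add: power2_eq_square algebra_simps)
  finally have "sqrt h \<le> X - 1" using X by (simp add: real_le_lsqrt)
  also have "\<dots> \<le> X - exp (xi_minus C)" using \<open>exp (xi_minus C) < 1\<close> by linarith
  finally have "2 * h / (X - exp (xi_minus C)) \<le> 2 * h / sqrt h"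
    using h width by (intro divide_left_mono mult_pos_pos) auto
  also have "\<dots> = 2 * sqrt h" using h real_div_sqrt[of h] by (simp flip: times_divide_eq_right)
  finally show ?thesis unfolding jn_k_eq_level_width h_def X_def .
qed

end

lemma jn_k_strict_mono:
  assumes "1 \<le> C" "C < D"
  shows "jn_k C < jn_k D"
proof (cases "C = 1")
  case True
  then show ?thesis using jn_k_pos[of D] assms by (simp add: jn_k_def)
next
  case False
  then have C: "C > 1" and D: "D > 1" using assms by auto
  define width where "width B = exp (xi_plus B) - exp (xi_minus B)" for B
  have pos: "width B > 0" if "B > 1" for B
    using xi_plus_pos[OF that] xi_minus_neg[OF that] by (simp add: width_def)
  define l where "l = (1 - 1 / C) / (1 - 1 / D)"
  have "0 < 1 - 1 / C" "1 - 1 / C < 1 - 1 / D" using C assms by (auto simp: field_simps)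
  then have l: "0 < l" "l < 1" "1 - 1 / C = l * (1 - 1 / D)" by (auto simp: l_def)
  then have "l * width D < width C"
    unfolding width_def using C D xi_plus_pos xi_minus_neg relative_entropy_exp_xi
    by (intro relative_entropy_level_width[where h = "1 - 1 / D"]) auto
  moreover have "0 < 2 * (1 - 1 / D)" using D by (simp add: field_simps)
  ultimately have "2 * (1 - 1 / D) * (l * width D) < 2 * (1 - 1 / D) * width C"
    by (rule mult_strict_left_mono)
  then have "2 * (l * (1 - 1 / D)) * width D < 2 * (1 - 1 / D) * width C" by (simp only: ac_simps)
  then have "2 * (1 - 1 / C) / width C < 2 * (1 - 1 / D) / width D"
    using pos[OF C] pos[OF D] by (simp only: l(3) divide_less_eq less_divide_eq) (simp add: field_simps)
  then show ?thesis using jn_k_eq_level_width[OF C] jn_k_eq_level_width[OF D] by (simp add: width_def)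
qed

lemma continuous_on_jn_k:
  assumes "1 < c"
  shows "continuous_on {c..d} jn_k"
proof (cases "c \<le> d")
  case True
  have xi: "continuous_on {c..d} xi_plus" "continuous_on {c..d} xi_minus"
    using True assms
    by (auto intro!: continuous_on_subset[OF continuous_on_xi(1)[of d]] continuous_on_subset[OF continuous_on_xi(2)[of d]])
  have "xi_plus x \<noteq> xi_minus x" if "x \<in> {c..d}" for x
    using that assms xi_plus_pos[of x] xi_minus_neg[of x] by auto
  with assms have nonzero: "\<forall>x\<in>{c..d}. x \<noteq> 0" "\<forall>x\<in>{c..d}. exp (xi_plus x) - exp (xi_minus x) \<noteq> 0"
    by auto
  have "continuous_on {c..d} (\<lambda>C. 2 * (1 - 1 / C) / (exp (xi_plus C) - exp (xi_minus C)))"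
    by (intro continuous_intros xi nonzero)
  then show ?thesis
    by (rule continuous_on_eq) (use assms jn_k_eq_level_width in auto)
qed simp

lemma jn_k_surj:
  assumes "0 \<le> \<epsilon>" "\<epsilon> < 2 / exp 1"
  obtains C where "C \<ge> 1" "jn_k C = \<epsilon>"
proof (cases "\<epsilon> = 0")
  case True
  then show ?thesis by (intro that[of 1]) (simp_all add: jn_k_def)
next
  case False
  define h where "h = (\<epsilon> / 2)\<^sup>2"
  define g where "g = exp 1 * \<epsilon> / 2"
  define c where "c = 1 / (1 - h)"
  define d where "d = 1 / (1 - g)"
  have "exp 1 > (2::real)" using e_approx_32 by (simp add: abs_if split: if_splits)
  moreover from this have "\<epsilon> < 1" using assms by (smt (verit) divide_less_eq_1_pos)
  ultimately have "\<epsilon> / 2 * (\<epsilon> / 2) \<le> exp 1 * (\<epsilon> / 2)" using assms by (intro mult_right_mono) auto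
  then have "0 < h" "h \<le> g" "g < 1"
    using False assms by (auto simp: h_def g_def power2_eq_square field_simps)
  then have "1 < c" "c \<le> d" by (auto simp: c_def d_def field_simps)
  moreover have "jn_k c \<le> \<epsilon>"
    using jn_k_le[OF \<open>1 < c\<close>] assms by (simp add: c_def h_def)
  moreover have "\<epsilon> \<le> jn_k d"
    using jn_k_gt[of d] \<open>1 < c\<close> \<open>c \<le> d\<close> by (simp add: d_def g_def)
  ultimately obtain C where "c \<le> C" "jn_k C = \<epsilon>"
    using IVT'[of jn_k c \<epsilon> d] continuous_on_jn_k by auto
  then show ?thesis using \<open>1 < c\<close> by (intro that[of C]) auto
qed

lemma inv_into_jn_k:
  assumes "0 \<le> \<epsilon>" "\<epsilon> < 2 / exp 1"
  shows "1 \<le> inv_into {1..} jn_k \<epsilon>" "jn_k (inv_into {1..} jn_k \<epsilon>) = \<epsilon>"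
proof -
  have "\<epsilon> \<in> jn_k ` {1..}" by (rule jn_k_surj[OF assms]) auto
  from inv_into_into[OF this] f_inv_into_f[OF this]
  show "1 \<le> inv_into {1..} jn_k \<epsilon>" "jn_k (inv_into {1..} jn_k \<epsilon>) = \<epsilon>" by auto
qed

section \<open>Integrability and truncation\<close>

lemma nnavg_Ioo_eq_nn_integral:
  assumes "f \<in> borel_measurable (lebesgue_on {a<..<b})" "a < b"
  shows "nnavg {a<..<b} f = (\<integral>\<^sup>+x. ennreal (f x / (b - a)) \<partial>lebesgue_on {a<..<b})"
proof -
  have "nnavg {a<..<b} f = (\<integral>\<^sup>+x. ennreal (f x) \<partial>lebesgue_on {a<..<b}) * ennreal (1 / (b - a))"
    using \<open>a < b\<close>
    by (simp add: nnavg_def nn_integral_restrict_space divide_ennreal_def inverse_ennreal inverse_eq_divide)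
  also have "\<dots> = (\<integral>\<^sup>+x. ennreal (f x) * ennreal (1 / (b - a)) \<partial>lebesgue_on {a<..<b})"
    using assms by (intro nn_integral_multc[symmetric]) auto
  also have "\<dots> = (\<integral>\<^sup>+x. ennreal (f x / (b - a)) \<partial>lebesgue_on {a<..<b})"
    using \<open>a < b\<close> by (intro nn_integral_cong) (simp flip: ennreal_mult'')
  finally show ?thesis .
qed

lemma nnavg_Ioo_le_of_LIMSEQ:
  fixes f :: "nat \<Rightarrow> real \<Rightarrow> real"
  assumes "a < b" and meas: "\<And>n. f n \<in> borel_measurable (lebesgue_on {a<..<b})"
    and lim: "\<And>x. x \<in> {a<..<b} \<Longrightarrow> (\<lambda>n. f n x) \<longlonglongrightarrow> g x"
    and nnavg_le: "\<And>n. nnavg {a<..<b} (f n) \<le> ennreal (k n)" and "k \<longlonglongrightarrow> l"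
  shows "nnavg {a<..<b} g \<le> ennreal l"
proof -
  let ?M = "lebesgue_on {a<..<b}"
  have g: "g \<in> borel_measurable ?M"
    by (rule borel_measurable_LIMSEQ_real[OF _ meas]) (use lim in simp)
  have "(\<lambda>n. ennreal (f n x / (b - a))) \<longlonglongrightarrow> ennreal (g x / (b - a))" if "x \<in> {a<..<b}" for x
    using \<open>a < b\<close> by (intro tendsto_ennrealI tendsto_divide lim that tendsto_const) auto
  then have "nnavg {a<..<b} g = (\<integral>\<^sup>+x. liminf (\<lambda>n. ennreal (f n x / (b - a))) \<partial>?M)"
    unfolding nnavg_Ioo_eq_nn_integral[OF g \<open>a < b\<close>]
    by (intro nn_integral_cong lim_imp_Liminf[symmetric]) auto
  also have "\<dots> \<le> liminf (\<lambda>n. \<integral>\<^sup>+x. ennreal (f n x / (b - a)) \<partial>?M)"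
    by (intro nn_integral_liminf measurable_compose[OF _ measurable_ennreal] borel_measurable_divide meas) auto
  also have "\<dots> \<le> liminf (\<lambda>n. ennreal (k n))"
    using nnavg_le
    by (intro Liminf_mono always_eventually allI) (simp flip: nnavg_Ioo_eq_nn_integral[OF meas \<open>a < b\<close>])
  also have "\<dots> = ennreal l"
    using \<open>k \<longlonglongrightarrow> l\<close> by (intro lim_imp_Liminf tendsto_ennrealI) auto
  finally show ?thesis .
qed

lemma locally_integrable_imp_borel_measurable:
  assumes "locally_integrable Q \<phi>" "open Q"
  shows "\<phi> \<in> borel_measurable (lebesgue_on Q)"
proof -
  obtain C :: "nat \<Rightarrow> real set" where C: "\<And>n. compact (C n)" "\<And>n. C n \<subseteq> Q" "\<Union>(range C) = Q"
    using open_Union_compact_subsets[OF \<open>open Q\<close>] by metis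
  have C_meas: "C n \<in> sets lebesgue" for n
    using C(1) by (simp add: lmeasurable_compact fmeasurableD)
  show ?thesis
  proof (rule measurable_piecewise_restrict[where C = "range C"])
    fix \<Omega> assume "\<Omega> \<in> range C"
    then obtain n where n: "\<Omega> = C n" by blast
    have "\<phi> \<in> borel_measurable (lebesgue_on (C n))"
      using assms(1) C C_meas
      by (intro absolutely_integrable_imp_borel_measurable) (auto simp: locally_integrable_def)
    then show "\<phi> \<in> borel_measurable (restrict_space (lebesgue_on Q) \<Omega>)"
      using C(2)[of n] C_meas \<open>open Q\<close> by (simp add: n restrict_restrict_space Int_absorb1)
    show "\<Omega> \<inter> space (lebesgue_on Q) \<in> sets (lebesgue_on Q)"
      using C(2)[of n] C_meas \<open>open Q\<close> by (simp add: n sets_restrict_space_iff Int_absorb2)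
  qed (use C(3) in auto)
qed

lemma absolutely_integrable_of_nnavg_powr:
  assumes p: "p \<ge> 1" and "a < b" and \<phi>: "\<phi> \<in> borel_measurable (lebesgue_on {a<..<b})"
    and fin: "nnavg {a<..<b} (\<lambda>x. \<bar>\<phi> x - c\<bar> powr p) < \<infinity>"
  shows "\<phi> absolutely_integrable_on {a<..<b}"
proof -
  let ?M = "lebesgue_on {a<..<b}" and ?h = "\<lambda>x. \<bar>\<phi> x - c\<bar> powr p"
  have h: "?h \<in> borel_measurable ?M" using \<phi> by measurable
  have "integrable ?M (\<lambda>x. ?h x / (b - a))"
    using h fin \<open>a < b\<close> by (intro integrableI_nonneg) (auto simp: nnavg_Ioo_eq_nn_integral)
  from integrable_mult_right[OF this, of "b - a"] have "integrable ?M ?h" using \<open>a < b\<close> by simp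
  moreover have "integrable ?M (\<lambda>x. \<bar>c\<bar> + 1)"
    by (rule finite_measure.integrable_const[OF finite_measure_lebesgue_on]) simp
  ultimately have bound_int: "integrable ?M (\<lambda>x. (\<bar>c\<bar> + 1) + ?h x)" by simp
  have bound: "\<bar>\<phi> x\<bar> \<le> (\<bar>c\<bar> + 1) + ?h x" for x
  proof -
    have "\<bar>\<phi> x - c\<bar> \<le> 1 + ?h x"
    proof (cases "\<bar>\<phi> x - c\<bar> \<le> 1")
      case False
      then have "\<bar>\<phi> x - c\<bar> powr 1 \<le> ?h x" using p by (intro powr_mono) auto
      then show ?thesis using False by simp
    qed (simp add: add_increasing2)
    then show ?thesis by linarith
  qed
  have "integrable ?M \<phi>"
    by (rule Bochner_Integration.integrable_bound[OF bound_int \<phi>]) (simp add: bound)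
  then show ?thesis by (simp add: set_integrable_def integrable_restrict_space)
qed

lemma bmo_absolutely_integrable:
  assumes p: "p \<ge> 1" and "u < v" and \<phi>: "\<phi> \<in> bmo p {u<..<v}"
  shows "\<phi> absolutely_integrable_on {u<..<v}"
proof (rule absolutely_integrable_of_nnavg_powr[OF p \<open>u < v\<close>])
  show "\<phi> \<in> borel_measurable (lebesgue_on {u<..<v})"
    using \<phi> by (intro locally_integrable_imp_borel_measurable) (auto simp: bmo_def)
  let ?osc = "nnavg {u<..<v} (\<lambda>x. \<bar>\<phi> x - avg {u<..<v} \<phi>\<bar> powr p)"
  have "epowr ?osc (1 / p) \<le> bmo_norm p {u<..<v} \<phi>"
    unfolding bmo_norm_def using Ioo_in_subintervals[of u u v v] \<open>u < v\<close> by (intro SUP_upper) auto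
  then have "epowr ?osc (1 / p) < \<infinity>" using \<phi> by (simp add: bmo_def le_less_trans)
  then show "?osc < \<infinity>" by (auto simp: epowr_def less_top split: if_splits)
qed

lemma bounded_measurable_on_clip:
  assumes "\<phi> \<in> borel_measurable (lebesgue_on S)" "n \<ge> 0"
  shows "bounded_measurable_on S (\<lambda>x. clip n (\<phi> x))"
proof -
  have "\<bar>clip n u\<bar> \<le> n" for u using \<open>n \<ge> 0\<close> by (auto simp: clip_def)
  then have "bounded ((\<lambda>x. clip n (\<phi> x)) ` S)" by (auto simp: bounded_iff)
  moreover have "(\<lambda>x. clip n (\<phi> x)) \<in> borel_measurable (lebesgue_on S)"
    using assms unfolding clip_def by measurable
  ultimately show ?thesis by (simp add: bounded_measurable_on_def)
qed

lemma tendsto_clip: "(\<lambda>n. clip (real n) u) \<longlonglongrightarrow> u"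
proof -
  obtain N where "\<bar>u\<bar> \<le> real N" using real_arch_simple by blast
  then have "u = clip (real n) u" if "n \<ge> N" for n
    using that by (auto simp: clip_def)
  then have "\<forall>\<^sub>F n in sequentially. u = clip (real n) u"
    by (rule eventually_sequentiallyI)
  then show ?thesis by (rule Lim_transform_eventually[OF tendsto_const])
qed

lemma tendsto_mean_clip:
  assumes "\<phi> absolutely_integrable_on {a..b}"
  shows "(\<lambda>n. mean a b (\<lambda>x. clip (real n) (\<phi> x))) \<longlonglongrightarrow> mean a b \<phi>"
proof -
  have "(\<lambda>n. integral {a..b} (\<lambda>x. clip (real n) (\<phi> x))) \<longlonglongrightarrow> integral {a..b} \<phi>"
  proof (rule dominated_convergence(2))
    have "\<phi> \<in> borel_measurable (lebesgue_on {a..b})"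
      using assms by (intro absolutely_integrable_imp_borel_measurable) auto
    then show "(\<lambda>x. clip (real n) (\<phi> x)) integrable_on {a..b}" for n
      by (intro bounded_measurable_on_imp_integrable bounded_measurable_on_clip) auto
    show "(\<lambda>x. \<bar>\<phi> x\<bar>) integrable_on {a..b}"
      using assms by (simp add: absolutely_integrable_on_def)
    show "(\<lambda>n. clip (real n) (\<phi> x)) \<longlonglongrightarrow> \<phi> x" for x by (rule tendsto_clip)
  qed (auto simp: clip_def)
  then show ?thesis unfolding mean_def by (cases "a = b") (auto intro: tendsto_divide)
qed

lemma mean_oscillation_clip_le:
  assumes "p \<ge> 1" "a < b" "n \<ge> 0" "E \<ge> 0" and \<phi>: "\<phi> absolutely_integrable_on {a..b}"
    and osc: "nnavg {a<..<b} (\<lambda>x. \<bar>\<phi> x - avg {a<..<b} \<phi>\<bar> powr p) \<le> ennreal E"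
  shows "mean a b (\<lambda>x. \<bar>clip n (\<phi> x) - mean a b (\<lambda>x. clip n (\<phi> x))\<bar> powr p) \<le> E"
proof -
  let ?\<psi> = "\<lambda>x. clip n (\<phi> x)"
  have \<phi>_Ioo: "\<phi> absolutely_integrable_on {a<..<b}"
    using \<phi> by (simp add: absolutely_integrable_on_Icc_iff_Ioo)
  then have bm: "bounded_measurable_on {a<..<b} ?\<psi>"
    using \<open>n \<ge> 0\<close> by (intro bounded_measurable_on_clip absolutely_integrable_imp_borel_measurable) auto
  then have "avg {a<..<b} ?\<psi> = mean a b ?\<psi>"
    using \<open>a < b\<close> by (intro avg_Ioo_eq_mean bounded_measurable_on_imp_absolutely_integrable) auto
  then have "nnavg {a<..<b} (\<lambda>x. \<bar>?\<psi> x - mean a b ?\<psi>\<bar> powr p) \<le> ennreal E"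
    using order_trans[OF nnavg_oscillation_clip_le[OF assms(1-3) \<phi>_Ioo] osc] by simp
  moreover have "continuous_on UNIV (\<lambda>y. \<bar>y - mean a b ?\<psi>\<bar> powr p)"
    using \<open>p \<ge> 1\<close> by (intro continuous_on_powr' continuous_intros) auto
  then have "(\<lambda>x. \<bar>?\<psi> x - mean a b ?\<psi>\<bar> powr p) absolutely_integrable_on {a<..<b}"
    by (intro bounded_measurable_on_imp_absolutely_integrable bounded_measurable_on_compose[OF bm]) simp_all
  ultimately show ?thesis
    using nnavg_Ioo_eq_mean[OF _ \<open>a < b\<close>] \<open>E \<ge> 0\<close> by (simp add: ennreal_le_iff)
qed

section \<open>The best constant\<close>

text \<open>The A-infinity weight is \<open>exp \<circ> \<phi>\<close>, not \<open>\<phi>\<close>.\<close>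

definition A_infinity :: "real \<Rightarrow> real \<Rightarrow> real \<Rightarrow> (real \<Rightarrow> real) \<Rightarrow> bool" where
  "A_infinity C = mean_dominated exp (\<lambda>m. C * exp m)"

definition oscillation_bound :: "real \<Rightarrow> real \<Rightarrow> real \<Rightarrow> real \<Rightarrow> bool" where
  "oscillation_bound p C B \<tau> \<longleftrightarrow>
    (\<forall>a b \<psi>. a < b \<longrightarrow> bounded_measurable_on {a..b} \<psi> \<longrightarrow> A_infinity C a b \<psi> \<longrightarrow> mean a b \<psi> = 0 \<longrightarrow>
      B + \<tau> * (mean a b (\<lambda>x. exp (\<psi> x)) - C) \<le> mean a b (\<lambda>x. \<bar>\<psi> x\<bar> powr p))"

lemma A_infinity_weaken:
  assumes "A_infinity C a b \<psi>" "C \<le> D"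
  shows "A_infinity D a b \<psi>"
proof -
  have "C * exp m \<le> D * exp m" for m using \<open>C \<le> D\<close> by simp
  then show ?thesis using assms(1) unfolding A_infinity_def mean_dominated_def by (meson order_trans)
qed

lemma A_infinity_subinterval_shift:
  assumes bm: "bounded_measurable_on {a..b} \<psi>" and A: "A_infinity C a b \<psi>" and "a \<le> c" "d \<le> b"
  shows "A_infinity C c d (\<lambda>x. \<psi> x - k)"
  unfolding A_infinity_def mean_dominated_def
proof (intro allI impI)
  fix u v assume uv: "c \<le> u" "u < v" "v \<le> d"
  have int: "\<psi> integrable_on {u..v}"
    using bounded_measurable_on_compose_integrable[OF bm continuous_on_id, of u v] uv assms by simp
  have "mean u v (\<lambda>x. exp (\<psi> x - k)) = exp (- k) * mean u v (\<lambda>x. exp (\<psi> x))"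
    by (simp add: exp_diff exp_minus field_simps flip: mean_cmult)
  also have "\<dots> \<le> exp (- k) * (C * exp (mean u v \<psi>))"
    using mean_dominatedD[OF A[unfolded A_infinity_def], of u v] uv assms(3,4) by (intro mult_left_mono) auto
  also have "mean u v \<psi> = mean u v (\<lambda>x. \<psi> x - k) + k"
    using mean_affine[OF int, of 1 "- k"] uv by simp
  also have "exp (- k) * (C * exp (mean u v (\<lambda>x. \<psi> x - k) + k)) = C * exp (mean u v (\<lambda>x. \<psi> x - k))"
    by (simp add: exp_add exp_minus)
  finally show "mean u v (\<lambda>x. exp (\<psi> x - k)) \<le> C * exp (mean u v (\<lambda>x. \<psi> x - k))" .
qed

lemma best_A_infinity_constant:
  assumes bm: "bounded_measurable_on {a..b} \<psi>" and "a < b"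
  obtains C where "A_infinity C a b \<psi>"
    and "\<And>\<eta>. \<eta> > 0 \<Longrightarrow> \<exists>c d. a \<le> c \<and> c < d \<and> d \<le> b \<and> (C - \<eta>) * exp (mean c d \<psi>) < mean c d (\<lambda>x. exp (\<psi> x))"
proof -
  define R where "R c d = mean c d (\<lambda>x. exp (\<psi> x)) / exp (mean c d \<psi>)" for c d
  define S where "S = {R c d | c d. a \<le> c \<and> c < d \<and> d \<le> b}"
  obtain M where M: "\<And>x. x \<in> {a..b} \<Longrightarrow> \<bar>\<psi> x\<bar> \<le> M"
    using bm unfolding bounded_measurable_on_def bounded_iff by fastforce
  have "R c d \<le> exp M / exp (- M)" if "a \<le> c" "c < d" "d \<le> b" for c d
  proof -
    note int = bounded_measurable_on_compose_integrable[OF bm _ \<open>a \<le> c\<close> \<open>d \<le> b\<close>]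
    have \<psi>: "\<psi> x \<le> M \<and> - M \<le> \<psi> x" if "x \<in> {c..d}" for x
      using M[of x] that \<open>a \<le> c\<close> \<open>d \<le> b\<close> by auto
    have "mean c d (\<lambda>x. exp (\<psi> x)) \<le> exp M"
      using \<psi> \<open>c < d\<close> by (intro mean_le_const int continuous_intros) auto
    moreover have "exp (- M) \<le> exp (mean c d \<psi>)"
      using \<psi> \<open>c < d\<close> int[OF continuous_on_id] by (auto intro!: mean_ge_const)
    ultimately show ?thesis unfolding R_def by (intro frac_le) auto
  qed
  then have "bdd_above S" by (auto simp: S_def intro!: bdd_aboveI)
  have "R a b \<in> S" using \<open>a < b\<close> by (auto simp: S_def)
  show ?thesis
  proof (rule that[of "Sup S"])
    have "R c d \<le> Sup S" if "a \<le> c" "c < d" "d \<le> b" for c d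
      using that \<open>bdd_above S\<close> by (intro cSup_upper) (auto simp: S_def)
    then show "A_infinity (Sup S) a b \<psi>"
      by (simp add: A_infinity_def mean_dominated_def R_def pos_divide_le_eq)
    fix \<eta> :: real assume "\<eta> > 0"
    then obtain c d where "a \<le> c" "c < d" "d \<le> b" "Sup S - \<eta> < R c d"
      using less_cSup_iff[OF _ \<open>bdd_above S\<close>, of "Sup S - \<eta>"] \<open>R a b \<in> S\<close> by (auto simp: S_def)
    then show "\<exists>c d. a \<le> c \<and> c < d \<and> d \<le> b \<and> (Sup S - \<eta>) * exp (mean c d \<psi>) < mean c d (\<lambda>x. exp (\<psi> x))"
      by (auto simp: R_def pos_less_divide_eq)
  qed
qed

lemma oscillation_bound_subinterval:
  assumes bound: "oscillation_bound p C B \<tau>" and bm: "bounded_measurable_on {a..b} \<psi>" and A: "A_infinity C a b \<psi>"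
    and cd: "a \<le> c" "c < d" "d \<le> b"
  shows "B + \<tau> * (mean c d (\<lambda>x. exp (\<psi> x)) / exp (mean c d \<psi>) - C) \<le> mean c d (\<lambda>x. \<bar>\<psi> x - mean c d \<psi>\<bar> powr p)"
proof -
  define \<zeta> where "\<zeta> = (\<lambda>x. \<psi> x - mean c d \<psi>)"
  have int: "\<psi> integrable_on {c..d}"
    using bounded_measurable_on_compose_integrable[OF bm continuous_on_id] cd by simp
  have "bounded_measurable_on {c..d} \<zeta>"
    unfolding \<zeta>_def using bounded_measurable_on_subset[OF bm, of "{c..d}"] cd
    by (intro bounded_measurable_on_compose[where h = "\<lambda>y. y - mean c d \<psi>"] continuous_intros) auto
  moreover have "A_infinity C c d \<zeta>"
    unfolding \<zeta>_def by (rule A_infinity_subinterval_shift[OF bm A cd(1,3)])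
  moreover have "mean c d \<zeta> = 0"
    using mean_affine[OF int \<open>c < d\<close>, of 1 "- mean c d \<psi>"] by (simp add: \<zeta>_def)
  ultimately have "B + \<tau> * (mean c d (\<lambda>x. exp (\<zeta> x)) - C) \<le> mean c d (\<lambda>x. \<bar>\<zeta> x\<bar> powr p)"
    using bound \<open>c < d\<close> unfolding oscillation_bound_def by blast
  moreover have "mean c d (\<lambda>x. exp (\<zeta> x)) = mean c d (\<lambda>x. exp (\<psi> x)) / exp (mean c d \<psi>)"
    by (simp add: \<zeta>_def exp_diff mean_def)
  ultimately show ?thesis by (simp add: \<zeta>_def)
qed

text \<open>If the best A-infinity constant \<open>C\<close> of \<open>\<psi>\<close> exceeded \<open>D\<close>, a subinterval on which it is almost attained would
  violate the oscillation bound.\<close>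

lemma A_infinity_of_small_oscillation:
  assumes bm: "bounded_measurable_on {a..b} \<psi>" and "a < b"
    and osc: "\<And>c d. a \<le> c \<Longrightarrow> c < d \<Longrightarrow> d \<le> b \<Longrightarrow> mean c d (\<lambda>x. \<bar>\<psi> x - mean c d \<psi>\<bar> powr p) \<le> E"
    and bound: "\<And>C. C > D \<Longrightarrow> \<exists>B \<tau>. E < B \<and> oscillation_bound p C B \<tau>"
  shows "A_infinity D a b \<psi>"
proof -
  obtain C where C: "A_infinity C a b \<psi>"
    and sharp: "\<And>\<eta>. \<eta> > 0 \<Longrightarrow> \<exists>c d. a \<le> c \<and> c < d \<and> d \<le> b \<and> (C - \<eta>) * exp (mean c d \<psi>) < mean c d (\<lambda>x. exp (\<psi> x))"
    using best_A_infinity_constant[OF bm \<open>a < b\<close>] by metis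
  have "C \<le> D"
  proof (rule ccontr)
    assume "\<not> C \<le> D"
    then obtain B \<tau> where "E < B" and B: "oscillation_bound p C B \<tau>" using bound[of C] by auto
    define \<eta> where "\<eta> = (B - E) / (\<bar>\<tau>\<bar> + 1)"
    have \<eta>: "\<eta> > 0" "(\<bar>\<tau>\<bar> + 1) * \<eta> = B - E" using \<open>E < B\<close> by (auto simp: \<eta>_def)
    obtain c d where cd: "a \<le> c" "c < d" "d \<le> b" "(C - \<eta>) * exp (mean c d \<psi>) < mean c d (\<lambda>x. exp (\<psi> x))"
      using sharp[OF \<open>\<eta> > 0\<close>] by blast
    define R where "R = mean c d (\<lambda>x. exp (\<psi> x)) / exp (mean c d \<psi>)"
    have "R \<le> C"
      using mean_dominatedD[OF C[unfolded A_infinity_def] cd(1-3)] by (simp add: R_def pos_divide_le_eq)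
    moreover have "C - \<eta> < R" using cd(4) by (simp add: R_def pos_less_divide_eq)
    ultimately have near: "\<bar>R - C\<bar> \<le> \<eta>" by simp
    have "B + \<tau> * (R - C) \<le> E"
      using oscillation_bound_subinterval[OF B bm C cd(1-3)] osc[OF cd(1-3)] by (simp add: R_def)
    then have "B - E \<le> - (\<tau> * (R - C))" by simp
    also have "\<dots> \<le> \<bar>\<tau>\<bar> * \<bar>R - C\<bar>" by (simp flip: abs_mult)
    also have "\<dots> \<le> \<bar>\<tau>\<bar> * \<eta>" by (intro mult_left_mono near) simp
    finally show False using \<eta> by (simp add: distrib_right)
  qed
  with C show ?thesis by (rule A_infinity_weaken)
qed

lemma nnavg_exp_le_of_A_infinity_clip:
  assumes "a < b" "C \<ge> 0" and \<phi>: "\<phi> absolutely_integrable_on {a..b}"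
    and A: "\<And>n. A_infinity C a b (\<lambda>x. clip (real n) (\<phi> x))"
  shows "nnavg {a<..<b} (\<lambda>x. exp (\<phi> x)) \<le> ennreal C * ennreal (exp (avg {a<..<b} \<phi>))"
proof -
  have \<phi>_Ioo: "\<phi> absolutely_integrable_on {a<..<b}"
    using \<phi> by (simp add: absolutely_integrable_on_Icc_iff_Ioo)
  have bm: "bounded_measurable_on {a<..<b} (\<lambda>x. exp (clip (real n) (\<phi> x)))" for n
    using absolutely_integrable_imp_borel_measurable[OF \<phi>_Ioo]
    by (intro bounded_measurable_on_compose[where h = exp] bounded_measurable_on_clip continuous_intros) auto
  have "nnavg {a<..<b} (\<lambda>x. exp (\<phi> x)) \<le> ennreal (C * exp (mean a b \<phi>))"
  proof (rule nnavg_Ioo_le_of_LIMSEQ[OF \<open>a < b\<close>])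
    show "(\<lambda>x. exp (clip (real n) (\<phi> x))) \<in> borel_measurable (lebesgue_on {a<..<b})" for n
      using bm by (simp add: bounded_measurable_on_def)
    show "(\<lambda>n. exp (clip (real n) (\<phi> x))) \<longlonglongrightarrow> exp (\<phi> x)" for x
      by (intro tendsto_exp tendsto_clip)
    show "nnavg {a<..<b} (\<lambda>x. exp (clip (real n) (\<phi> x))) \<le> ennreal (C * exp (mean a b (\<lambda>x. clip (real n) (\<phi> x))))"
      for n
      using mean_dominatedD[OF A[unfolded A_infinity_def] order_refl \<open>a < b\<close> order_refl]
        nnavg_Ioo_eq_mean[OF bounded_measurable_on_imp_absolutely_integrable[OF bm] \<open>a < b\<close>]
      by (simp add: ennreal_leI)
    show "(\<lambda>n. C * exp (mean a b (\<lambda>x. clip (real n) (\<phi> x)))) \<longlonglongrightarrow> C * exp (mean a b \<phi>)"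
      by (intro tendsto_intros tendsto_mean_clip \<phi>)
  qed
  then show ?thesis using avg_Ioo_eq_mean[OF \<phi>_Ioo \<open>a < b\<close>] \<open>C \<ge> 0\<close> by (simp add: ennreal_mult)
qed

lemma jn_C_le:
  assumes p: "p \<ge> 1" and "\<epsilon> \<ge> 0" "C \<ge> 1"
    and bound: "\<And>C'. C' > C \<Longrightarrow> \<exists>B \<tau>. \<epsilon> powr p < B \<and> oscillation_bound p C' B \<tau>"
  shows "jn_C \<epsilon> p \<le> ennreal C"
proof -
  have "jn_admissible \<epsilon> p (ennreal C)"
    unfolding jn_admissible_iff
  proof (intro ballI impI allI)
    fix \<phi> a b assume \<phi>: "\<phi> \<in> bmo p {0<..<1}" "bmo_norm p {0<..<1} \<phi> \<le> ennreal \<epsilon>"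
      and ab: "0 \<le> a" "a < b" "b \<le> (1::real)"
    have "\<phi> absolutely_integrable_on {0..1}"
      using bmo_absolutely_integrable[OF p _ \<phi>(1)] by (simp add: absolutely_integrable_on_Icc_iff_Ioo)
    then have abs: "\<phi> absolutely_integrable_on {c..d}" if "0 \<le> c" "d \<le> 1" for c d
      by (rule set_integrable_subset) (use that in auto)
    have "A_infinity C a b (\<lambda>x. clip (real n) (\<phi> x))" for n
    proof (rule A_infinity_of_small_oscillation[OF _ \<open>a < b\<close> _ bound])
      show "bounded_measurable_on {a..b} (\<lambda>x. clip (real n) (\<phi> x))"
        using absolutely_integrable_imp_borel_measurable[OF abs, of a b] ab
        by (intro bounded_measurable_on_clip) auto
      fix c d assume "a \<le> c" "c < d" "d \<le> b"
      then show "mean c d (\<lambda>x. \<bar>clip (real n) (\<phi> x) - mean c d (\<lambda>x. clip (real n) (\<phi> x))\<bar> powr p) \<le> \<epsilon> powr p"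
        using \<phi>(2) ab unfolding bmo_norm_le_iff[OF order_less_le_trans[OF zero_less_one p] \<open>\<epsilon> \<ge> 0\<close>]
        by (intro mean_oscillation_clip_le p abs) auto
    qed
    then show "nnavg {a<..<b} (\<lambda>x. exp (\<phi> x)) \<le> ennreal C * ennreal (exp (avg {a<..<b} \<phi>))"
      using nnavg_exp_le_of_A_infinity_clip[OF \<open>a < b\<close> _ abs] ab \<open>C \<ge> 1\<close> by simp
  qed
  then show ?thesis
    unfolding jn_C_def using \<open>C \<ge> 1\<close> by (intro Inf_lower) (simp flip: ennreal_1)
qed

lemma A_infinity_rearrangement:
  assumes bm: "bounded_measurable_on {a..b} \<psi>" and "a < b" "C \<ge> 1" and A: "A_infinity C a b \<psi>"
  obtains I where "monotone_rearrangement a b \<psi> I"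
    and "\<And>s. 0 \<le> s \<Longrightarrow> s < 1 \<Longrightarrow> mean s 1 (\<lambda>t. exp (I t)) \<le> C * exp (mean s 1 I)"
    and "\<And>s. 0 < s \<Longrightarrow> s \<le> 1 \<Longrightarrow> mean 0 s (\<lambda>t. exp (I t)) \<le> C * exp (mean 0 s I)"
proof -
  obtain I where I: "monotone_rearrangement a b \<psi> I"
    using monotone_rearrangement_exists[OF bm \<open>a < b\<close>] .
  have exp_le: "exp y \<le> C * exp y" for y using \<open>C \<ge> 1\<close> by simp
  note dom = exp_convex exp_le A[unfolded A_infinity_def]
  show ?thesis
    by (rule that[OF I mean_dominated_rearrangement_final[OF bm \<open>a < b\<close> I dom]
          mean_dominated_rearrangement_initial[OF bm \<open>a < b\<close> I dom]])
qed

lemma tangent_slope_minus_1: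
  "tangent_slope p (- 1) = (Gamma p - integral {0..1} (\<lambda>t. t powr (p - 1) * exp t)) / exp 1"
  by (simp add: tangent_slope_def incomplete_Gamma_def exp_minus divide_inverse mult.commute)

lemma (in bellman_planes) oscillation_bound_log_moment:
  "oscillation_bound p (exp (- \<xi>) / (1 - \<xi>)) (\<xi> powr p * log_moment p) (\<xi> powr p * (p * exp_slope (- 1)))"
  unfolding oscillation_bound_def
proof (intro allI impI)
  define C where "C = exp (- \<xi>) / (1 - \<xi>)"
  fix a b :: real and \<psi>
  assume "a < b" and bm: "bounded_measurable_on {a..b} \<psi>" and A: "A_infinity (exp (- \<xi>) / (1 - \<xi>)) a b \<psi>"
    and zero: "mean a b \<psi> = 0"
  have "C \<ge> 1" unfolding C_def by (rule exp_minus_div_ge_1[OF \<xi>(3)])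
  obtain I where I: "monotone_rearrangement a b \<psi> I"
    and final: "\<And>s. 0 \<le> s \<Longrightarrow> s < 1 \<Longrightarrow> mean s 1 (\<lambda>t. exp (I t)) \<le> C * exp (mean s 1 I)"
    using A_infinity_rearrangement[OF bm \<open>a < b\<close> \<open>C \<ge> 1\<close>] A unfolding C_def by metis
  note law = monotone_rearrangementD(4)[OF I]
  define Z where "Z t = I t / \<xi>" for t
  have scale: "\<xi> * Z t = I t" for t using \<xi> by (simp add: Z_def)
  have mean_Z: "\<xi> * mean s 1 Z = mean s 1 I" for s by (simp add: scale flip: mean_cmult)
  obtain M where M: "\<And>t. \<bar>I t\<bar> \<le> M"
    using monotone_rearrangementD(2)[OF I] by (auto simp: bounded_iff)
  have "support_plane (mean 0 1 Z - 1) (mean 0 1 Z) (mean 0 1 (\<lambda>t. exp (\<xi> * Z t))) \<le> mean 0 1 (\<lambda>t. \<bar>Z t\<bar> powr p)"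
  proof (rule support_plane_le_mean_abs_powr)
    show "mono Z" using monotone_rearrangementD(1)[OF I] \<xi> by (simp add: Z_def mono_def divide_right_mono)
    show "\<bar>Z t\<bar> \<le> M / \<xi>" for t using M[of t] \<xi> by (simp add: Z_def abs_divide divide_right_mono)
    show "mean s 1 (\<lambda>t. exp (\<xi> * Z t)) \<le> tangent_line (mean s 1 Z - 1) (mean s 1 Z)" if "0 \<le> s" "s < 1" for s
      using final[OF that] by (simp add: tangent_line_touch C_def scale mean_Z)
  qed
  moreover have "mean 0 1 I = 0" using law[of "\<lambda>y. y"] zero by simp
  then have "mean 0 1 Z = 0" using mean_Z[of 0] \<xi> by simp
  moreover have "support_plane (- 1) 0 w = log_moment p + p * exp_slope (- 1) * (w - C)" for w
    using tangent_line_touch[of 0] by (simp add: support_plane_def C_def tangent_slope_minus_1 log_moment_def)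
  ultimately have "log_moment p + p * exp_slope (- 1) * (mean a b (\<lambda>x. exp (\<psi> x)) - C)
      \<le> mean 0 1 (\<lambda>t. \<bar>Z t\<bar> powr p)"
    using law[of exp] by (simp add: scale continuous_on_exp)
  then have "\<xi> powr p * (log_moment p + p * exp_slope (- 1) * (mean a b (\<lambda>x. exp (\<psi> x)) - C))
      \<le> mean 0 1 (\<lambda>t. \<xi> powr p * \<bar>Z t\<bar> powr p)"
    unfolding mean_cmult by (intro mult_left_mono) auto
  also have "\<dots> = mean 0 1 (\<lambda>t. \<bar>I t\<bar> powr p)"
    using \<xi> by (simp add: Z_def abs_divide powr_divide)
  also have "\<dots> = mean a b (\<lambda>x. \<bar>\<psi> x\<bar> powr p)"
    using p by (intro law[of "\<lambda>y. \<bar>y\<bar> powr p"] continuous_on_powr' continuous_intros) auto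
  finally show "\<xi> powr p * log_moment p + \<xi> powr p * (p * exp_slope (- 1)) *
      (mean a b (\<lambda>x. exp (\<psi> x)) - exp (- \<xi>) / (1 - \<xi>)) \<le> mean a b (\<lambda>x. \<bar>\<psi> x\<bar> powr p)"
    by (simp add: C_def distrib_left mult.assoc)
qed

lemma oscillation_bound_jn_k:
  assumes "C > 1"
  shows "oscillation_bound 1 C (jn_k C) (two_tangent_slope (xi_plus C) (xi_minus C))"
  unfolding oscillation_bound_def
proof (intro allI impI)
  let ?\<beta> = "two_tangent_slope (xi_plus C) (xi_minus C)"
  fix a b \<psi>
  assume "a < b" and bm: "bounded_measurable_on {a..b} \<psi>" and A: "A_infinity C a b \<psi>" and zero: "mean a b \<psi> = 0"
  have "C \<ge> 1" using assms by simp
  obtain I where I: "monotone_rearrangement a b \<psi> I"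
    and final: "\<And>s. 0 \<le> s \<Longrightarrow> s < 1 \<Longrightarrow> mean s 1 (\<lambda>t. exp (I t)) \<le> C * exp (mean s 1 I)"
    and initial: "\<And>s. 0 < s \<Longrightarrow> s \<le> 1 \<Longrightarrow> mean 0 s (\<lambda>t. exp (I t)) \<le> C * exp (mean 0 s I)"
    using A_infinity_rearrangement[OF bm \<open>a < b\<close> \<open>C \<ge> 1\<close> A] by metis
  note law = monotone_rearrangementD(4)[OF I]
  have "mean 0 1 I = 0" using law[of "\<lambda>y. y"] zero by simp
  have "?\<beta> * (mean 0 1 (\<lambda>t. exp (I t)) - 1) \<le> mean 0 1 (\<lambda>t. \<bar>I t\<bar>)"
    by (rule mean_abs_ge_two_tangent_slope[OF monotone_rearrangementD(1,2)[OF I] xi_plus_pos[OF assms]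
          xi_plus(2,3)[OF \<open>C \<ge> 1\<close>] xi_minus_neg[OF assms] xi_minus(2)[OF \<open>C \<ge> 1\<close>] final initial \<open>mean 0 1 I = 0\<close>])
  also have "mean 0 1 (\<lambda>t. \<bar>I t\<bar>) = mean a b (\<lambda>x. \<bar>\<psi> x\<bar>)"
    by (rule law) (intro continuous_intros)
  also have "mean 0 1 (\<lambda>t. exp (I t)) = mean a b (\<lambda>x. exp (\<psi> x))"
    by (rule law) (intro continuous_intros)
  finally have "?\<beta> * (mean a b (\<lambda>x. exp (\<psi> x)) - 1) \<le> mean a b (\<lambda>x. \<bar>\<psi> x\<bar>)" .
  moreover have "jn_k C = ?\<beta> * (C - 1)"
    using assms by (simp add: jn_k_def two_tangent_slope_def)
  ultimately show "jn_k C + ?\<beta> * (mean a b (\<lambda>x. exp (\<psi> x)) - C) \<le> mean a b (\<lambda>x. \<bar>\<psi> x\<bar> powr 1)"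
    by (simp add: right_diff_distrib)
qed

lemma less_xi_plus:
  assumes "0 \<le> s" "s < 1" "exp (- s) / (1 - s) < C"
  shows "C > 1" "s < xi_plus C"
proof -
  show "C > 1" using exp_minus_div_ge_1[OF \<open>s < 1\<close>] assms(3) by simp
  then have xi: "0 \<le> xi_plus C" "(1 - xi_plus C) * exp (xi_plus C) = 1 / C"
    using xi_plus[of C] xi_equation_iff[of C] by auto
  have "1 / C < (1 - s) * exp s" using assms \<open>C > 1\<close> by (simp add: exp_minus field_simps)
  then show "s < xi_plus C"
    using one_minus_exp_strict_antimono[OF xi(1), of s] xi(2) by (cases s "xi_plus C" rule: linorder_cases) auto
qed

lemma jn_C_le_power:
  assumes p: "1 < p" "p \<le> 2" and s: "2 - p \<le> s" "0 \<le> s" "s < 1"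
  shows "jn_C (s * log_norm p) p \<le> ennreal (exp (- s) / (1 - s))"
proof (rule jn_C_le)
  show "1 \<le> p" "0 \<le> s * log_norm p" using p s log_norm_pos[of p] by auto
  show "1 \<le> exp (- s) / (1 - s)" by (rule exp_minus_div_ge_1[OF s(3)])
  fix C assume C: "C > exp (- s) / (1 - s)"
  define \<xi> where "\<xi> = xi_plus C"
  have \<xi>: "s < \<xi>" "\<xi> < 1" "C = exp (- \<xi>) / (1 - \<xi>)"
    using less_xi_plus[OF s(2,3) C] xi_plus(2,3)[of C] by (auto simp: \<xi>_def)
  interpret B: bellman_planes p \<xi> using p s \<xi> by unfold_locales auto
  have "(s * log_norm p) powr p = s powr p * log_moment p"
    using p s log_norm_pos[of p] by (simp add: powr_mult log_norm_powr)
  also have "\<dots> < \<xi> powr p * log_moment p"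
    using \<xi> s p log_moment_pos[of p] by (intro mult_strict_right_mono powr_less_mono2) auto
  finally show "\<exists>B \<tau>. (s * log_norm p) powr p < B \<and> oscillation_bound p C B \<tau>"
    using B.oscillation_bound_log_moment \<xi>(3) by blast
qed

lemma jn_C_one_le:
  assumes "0 \<le> \<epsilon>" "\<epsilon> < 2 / exp 1"
  shows "jn_C \<epsilon> 1 \<le> ennreal (inv_into {1..} jn_k \<epsilon>)"
proof (rule jn_C_le)
  show "1 \<le> inv_into {1..} jn_k \<epsilon>" by (rule inv_into_jn_k[OF assms])
  fix C assume C: "C > inv_into {1..} jn_k \<epsilon>"
  then have "\<epsilon> < jn_k C"
    using jn_k_strict_mono[OF inv_into_jn_k(1)[OF assms] C] inv_into_jn_k(2)[OF assms] by simp
  moreover have "C > 1" using C inv_into_jn_k(1)[OF assms] by simp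
  ultimately show "\<exists>B \<tau>. \<epsilon> powr 1 < B \<and> oscillation_bound 1 C B \<tau>"
    using oscillation_bound_jn_k assms(1) by fastforce
qed (use assms in auto)

section \<open>The critical norm\<close>

lemma log_norm_1: "log_norm 1 = 2 / exp 1"
proof -
  have "integral {0..1} (\<lambda>t::real. t powr (1 - 1) * exp t) = integral {0..1} (\<lambda>t. exp t)"
    by (rule integral_spike[of "{0}"]) auto
  also have "\<dots> = exp 1 - exp 0"
    by (intro integral_unique fundamental_theorem_of_calculus)
      (auto intro!: derivative_eq_intros simp flip: has_real_derivative_iff_has_vector_derivative)
  finally show ?thesis by (simp add: log_norm_def log_moment_def field_simps)
qed

lemma jn_C_mono:
  assumes "\<epsilon> \<le> \<epsilon>'"
  shows "jn_C \<epsilon> p \<le> jn_C \<epsilon>' p"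
  unfolding jn_C_def
proof (rule Inf_superset_mono, safe)
  fix C assume "jn_admissible \<epsilon>' p C"
  then show "jn_admissible \<epsilon> p C"
    unfolding jn_admissible_def using ennreal_leI[OF assms] by (meson order_trans)
qed

lemma jn_C_log_norm_eq_infinity:
  assumes p: "p \<ge> 1"
  shows "jn_C (log_norm p) p = \<infinity>"
proof (rule ccontr)
  assume "jn_C (log_norm p) p \<noteq> \<infinity>"
  then obtain r where r: "jn_C (log_norm p) p = ennreal r" "r \<ge> 0" by (cases "jn_C (log_norm p) p") auto
  then have "r \<ge> 1" using jn_admissible_jn_C(1)[of "log_norm p" p] by (simp flip: ennreal_1)
  define \<xi> where "\<xi> = 1 - exp (- 1) / (2 * r)"
  have "exp (- 1) < 2 * r" using \<open>r \<ge> 1\<close> order_less_trans[of "exp (- 1)" 1 "2 * r"] by simp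
  then have \<xi>: "0 \<le> \<xi>" "\<xi> < 1" "2 * r * (1 - \<xi>) = exp (- 1)"
    using \<open>r \<ge> 1\<close> by (auto simp: \<xi>_def)
  then have "2 * r \<le> exp (- \<xi>) / (1 - \<xi>)"
    by (simp add: pos_le_divide_eq)
  moreover have "\<xi> * log_norm p \<le> log_norm p"
    using \<xi> log_norm_pos[OF p] by (simp add: mult_left_le_one_le)
  then have "ennreal (exp (- \<xi>) / (1 - \<xi>)) \<le> ennreal r"
    using jn_C_ge_neg_ln[OF p \<xi>(1,2)] jn_C_mono r(1) by (metis order_trans)
  ultimately show False using \<open>r \<ge> 1\<close> by simp
qed

lemma jn_C_finite:
  assumes p: "1 \<le> p" "p \<le> 2" and \<epsilon>: "0 \<le> \<epsilon>" "\<epsilon> < log_norm p"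
  shows "jn_C \<epsilon> p < \<infinity>"
proof (cases "p = 1")
  case True
  then show ?thesis
    using jn_C_one_le[of \<epsilon>] \<epsilon> by (simp add: log_norm_1 order_le_less_trans)
next
  case False
  define s where "s = max (\<epsilon> / log_norm p) (2 - p)"
  have s: "2 - p \<le> s" "0 \<le> s" "s < 1" using \<epsilon> p False by (auto simp: s_def le_max_iff_disj)
  have "\<epsilon> = \<epsilon> / log_norm p * log_norm p" using \<epsilon> by simp
  also have "\<dots> \<le> s * log_norm p" using \<epsilon> by (intro mult_right_mono) (auto simp: s_def)
  finally have "jn_C \<epsilon> p \<le> jn_C (s * log_norm p) p" by (rule jn_C_mono)
  also have "\<dots> \<le> ennreal (exp (- s) / (1 - s))" using p False s by (intro jn_C_le_power) auto
  finally show ?thesis by (simp add: order_le_less_trans)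
qed

lemma jn_eps0_eq_log_norm:
  assumes p: "1 \<le> p" "p \<le> 2"
  shows "jn_eps0 p = ereal (log_norm p)"
  unfolding jn_eps0_def
proof (rule antisym)
  show "ereal (log_norm p) \<le> Sup {d. \<forall>\<epsilon>\<ge>0. ereal \<epsilon> < d \<longrightarrow> jn_C \<epsilon> p < \<infinity>}"
    using jn_C_finite[OF p] by (intro Sup_upper) auto
  show "Sup {d. \<forall>\<epsilon>\<ge>0. ereal \<epsilon> < d \<longrightarrow> jn_C \<epsilon> p < \<infinity>} \<le> ereal (log_norm p)"
  proof (rule Sup_least, rule ccontr)
    fix d assume "d \<in> {d. \<forall>\<epsilon>\<ge>0. ereal \<epsilon> < d \<longrightarrow> jn_C \<epsilon> p < \<infinity>}" "\<not> d \<le> ereal (log_norm p)"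
    then have "jn_C (log_norm p) p < \<infinity>" using log_norm_pos[OF p(1)] by (simp add: not_le)
    then show False using jn_C_log_norm_eq_infinity[OF p(1)] by simp
  qed
qed

lemma jn_C_eq_power:
  assumes "1 < p" "p \<le> 2" "(2 - p) * log_norm p \<le> \<epsilon>" "\<epsilon> < log_norm p"
  shows "jn_C \<epsilon> p = ennreal (exp (- (\<epsilon> / log_norm p)) / (1 - \<epsilon> / log_norm p))"
proof -
  define s where "s = \<epsilon> / log_norm p"
  have "log_norm p > 0" using log_norm_pos assms(1) by simp
  then have s: "2 - p \<le> s" "s < 1" "\<epsilon> = s * log_norm p" using assms by (auto simp: s_def field_simps)
  have "jn_C (s * log_norm p) p = ennreal (exp (- s) / (1 - s))"
    using assms s by (intro antisym jn_C_le_power jn_C_ge_neg_ln) auto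
  then show ?thesis unfolding s(3)[symmetric] by (simp add: s_def)
qed

theorem theorem1p1:
  shows "(\<forall>p::real. 1 \<le> p \<and> p \<le> 2 \<longrightarrow>
            jn_eps0 p =
              ereal ((p / exp 1 * (Gamma p - integral {0..1} (\<lambda>t. t powr (p - 1) * exp t)) + 1)
                       powr (1 / p))) \<and>
         (\<forall>p \<epsilon> :: real. 1 < p \<and> p \<le> 2 \<and>
            ereal (2 - p) * jn_eps0 p \<le> ereal \<epsilon> \<and> ereal \<epsilon> < jn_eps0 p \<longrightarrow>
            jn_C \<epsilon> p =
              ennreal (exp (- (\<epsilon> / real_of_ereal (jn_eps0 p))) /
                       (1 - \<epsilon> / real_of_ereal (jn_eps0 p)))) \<and>
         (\<forall>\<epsilon>::real. 0 \<le> \<epsilon> \<and> \<epsilon> < 2 / exp 1 \<longrightarrow>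
            ennreal (exp (- (exp 1 / 2 * \<epsilon>)) / (1 - exp 1 / 2 * \<epsilon>)) \<le> jn_C \<epsilon> 1 \<and>
            jn_C \<epsilon> 1 \<le> ennreal (inv_into {1..} jn_k \<epsilon>))"
proof (intro conjI allI impI)
  fix p :: real assume "1 \<le> p \<and> p \<le> 2"
  then show "jn_eps0 p =
      ereal ((p / exp 1 * (Gamma p - integral {0..1} (\<lambda>t. t powr (p - 1) * exp t)) + 1) powr (1 / p))"
    using jn_eps0_eq_log_norm[of p] by (simp add: log_norm_def log_moment_def)
next
  fix p \<epsilon> :: real
  assume \<epsilon>: "1 < p \<and> p \<le> 2 \<and> ereal (2 - p) * jn_eps0 p \<le> ereal \<epsilon> \<and> ereal \<epsilon> < jn_eps0 p"
  then have "jn_eps0 p = ereal (log_norm p)" by (intro jn_eps0_eq_log_norm) auto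
  then show "jn_C \<epsilon> p = ennreal (exp (- (\<epsilon> / real_of_ereal (jn_eps0 p))) / (1 - \<epsilon> / real_of_ereal (jn_eps0 p)))"
    using jn_C_eq_power[of p \<epsilon>] \<epsilon> by simp
next
  fix \<epsilon> :: real assume \<epsilon>: "0 \<le> \<epsilon> \<and> \<epsilon> < 2 / exp 1"
  then show "jn_C \<epsilon> 1 \<le> ennreal (inv_into {1..} jn_k \<epsilon>)" by (intro jn_C_one_le) auto
  have "exp 1 / 2 * \<epsilon> < 1" using \<epsilon> by (simp add: field_simps)
  then show "ennreal (exp (- (exp 1 / 2 * \<epsilon>)) / (1 - exp 1 / 2 * \<epsilon>)) \<le> jn_C \<epsilon> 1"
    using jn_C_ge_neg_ln[of 1 "exp 1 / 2 * \<epsilon>"] \<epsilon> by (simp add: log_norm_1)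
qed

end
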